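(* Let $p=p(n)\in(0,1)$ and, for any integer $m\ge 1$, let $Z^{(m)}_n$ be the $m$-th order generalized Zagreb index of $G(n,p)$. For any given integer $k\ge 2$, as $n\to \infty$, the following assertions hold, where $\mathbf{U}_k$ denotes the $k\times k$ matrix with all entries equal to 1. (i) If $np\to c$ for some constant $c > 0$, then $$\frac{1}{\sqrt{n}}\big(Z^{(1)}_n-\mathbb{E}[Z^{(1)}_n],\,Z^{(2)}_n-\mathbb{E}[Z^{(2)}_n],\, \cdots,\, Z^{(k)}_n-\mathbb{E}[Z^{(k)}_n]\big)^{\top}$$ converges in distribution to $N(\mathbf{0},\mathbf{\Sigma}_k)$, where the covariance matrix $\mathbf{\Sigma}_k=(\sigma_{ml})_{k\times k}$ is given by $$\sigma_{ml}=\sum_{i=1}^{m}\sum_{j=1}^{l}\genfrac\{\}{0pt}{}{m}{i}\genfrac\{\}{0pt}{}{l}{j}\bigg[ij\, c^{i+j-1}+\sum_{s=1}^{\min\{i,j\}}\frac{i!\,j!\, c^{i+j-s}}{s!(i-s)!(j-s)!}\bigg], \quad 1\le m,l\le k.$$ (ii) If $np\to \infty$ and $n^2 (1-p)^3\to \infty$, then $$\sqrt{\frac{p}{2(1-p)}}\bigg(\frac{Z^{(1)}_n-\mathbb{E}[Z^{(1)}_n]}{np},\,\frac{Z^{(2)}_n-\mathbb{E}[Z^{(2)}_n]}{2(np)^2},\,\cdots,\,\frac{Z^{(k)}_n-\mathbb{E}[Z^{(k)}_n]}{k(np)^k}\bigg)^{\top}$$ converges in distribution to $N(\mathbf{0},\mathbf{U}_{k})$.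 (iii) If $np\to 0$ and $n^{2}p\to \infty$, then $$\frac{1}{\sqrt{2n^2p}}\bigg(Z^{(1)}_n-n^2p,\,Z^{(2)}_n-n^3p^2-n^2p,\,\cdots,\,Z^{(k)}_n-\sum_{m=1}^k \genfrac\{\}{0pt}{}{k}{m}n^{m+1}p^m\bigg)^{\top}$$ (the $r$-th coordinate inside the parentheses being $Z^{(r)}_n-\sum_{m=1}^r \genfrac\{\}{0pt}{}{r}{m}n^{m+1}p^m$, $1\le r\le k$) converges in distribution to $N(\mathbf{0},\mathbf{U}_{k})$.
   Context: $G(n,p)$ is the Erdős–Rényi random graph on the vertex set $\{1,\dots,n\}$, in which each possible edge is present independently with probability $p$, where $0<p<1$ and $p=p(n)$ may depend on $n$. $I_{ij}$ is the indicator of the event that there is an edge between $i$ and $j$ (so $I_{ii}=0$, $I_{ij}=I_{ji}$). For an integer $k\ge1$, the $k$-th order generalized Zagreb index is $Z_n^{(k)}=\sum_{i=1}^n\big(\sum_{j=1}^n I_{ij}\big)^k$, the sum of the $k$-th powers of the vertex degrees. $\genfrac\{\}{0pt}{}{m}{i}$ denotes the Stirling number of the second kind. $N(\mathbf 0,\mathbf\Sigma)$ is the $k$-dimensional normal distribution with mean vector $\mathbf 0$ and covariance matrix $\mathbf\Sigma$, allowed to be degenerate (singular covariance matrix). *)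

theory Defs
  imports "HOL-Probability.Probability" "HOL-Combinatorics.Stirling"
begin

text \<open>
  A graph on the vertex set \<open>{1..n}\<close> is represented by its set of edges, an edge being a
  two-element set of vertices.
\<close>

definition all_edges :: "nat \<Rightarrow> nat set set" where
  "all_edges n = {e. e \<subseteq> {1..n} \<and> card e = 2}"

definition erdos_renyi :: "nat \<Rightarrow> real \<Rightarrow> nat set set pmf" where
  "erdos_renyi n p =
     map_pmf (\<lambda>present. {e \<in> all_edges n. present e})
       (Pi_pmf (all_edges n) False (\<lambda>_. bernoulli_pmf p))"

text \<open>
  For \<open>i = j\<close> the indicator vanishes on every graph in the support of \<open>erdos_renyi n p\<close>,
  because \<open>{i, i}\<close> is a singleton.
\<close>

definition edge_ind :: "nat set set \<Rightarrow> nat \<Rightarrow> nat \<Rightarrow> real" where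
  "edge_ind E i j = (if {i, j} \<in> E then 1 else 0)"

definition zagreb :: "nat \<Rightarrow> nat \<Rightarrow> nat set set \<Rightarrow> real" where
  "zagreb n m E = (\<Sum>i = 1..n. (\<Sum>j = 1..n. edge_ind E i j) ^ m)"

definition zagreb_mean :: "nat \<Rightarrow> real \<Rightarrow> nat \<Rightarrow> real" where
  "zagreb_mean n p m = measure_pmf.expectation (erdos_renyi n p) (zagreb n m)"

text \<open>
  The normal law on \<open>\<real>\<^sup>k\<close> is specified by its characteristic function
  \<open>t \<mapsto> exp (\<i> t \<bullet> \<mu> - (t \<bullet> \<Sigma> t) / 2)\<close>, so that singular
  covariance matrices are covered.  The characteristic function alone only sees the symmetric part
  of the matrix, hence the first conjunct.
\<close>

definition multivariate_normal ::
    "(real ^ 'k) measure \<Rightarrow> real ^ 'k \<Rightarrow> real ^ 'k ^ 'k \<Rightarrow> bool" where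
  "multivariate_normal N \<mu> S \<longleftrightarrow>
     transpose S = S \<and> prob_space N \<and> sets N = sets borel \<and>
     (\<forall>t. (CLINT x|N. iexp (t \<bullet> x)) =
          exp (\<i> * complex_of_real (t \<bullet> \<mu>) - complex_of_real (t \<bullet> (S *v t)) / 2))"

text \<open>
  The library's \<open>weak_conv_m\<close> is restricted to laws on the real line.
\<close>

definition weak_conv_vec :: "(nat \<Rightarrow> (real ^ 'k) measure) \<Rightarrow> (real ^ 'k) measure \<Rightarrow> bool" where
  "weak_conv_vec M N \<longleftrightarrow>
     (\<forall>f :: real ^ 'k \<Rightarrow> real. continuous_on UNIV f \<longrightarrow> bounded (range f) \<longrightarrow>
        (\<lambda>n. \<integral>x. f x \<partial>M n) \<longlonglongrightarrow> (\<integral>x. f x \<partial>N))"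

definition zagreb_cov :: "real \<Rightarrow> nat \<Rightarrow> nat \<Rightarrow> real" where
  "zagreb_cov c m l =
     (\<Sum>i = 1..m. \<Sum>j = 1..l. real (Stirling m i) * real (Stirling l j) *
        (real i * real j * c ^ (i + j - 1) +
         (\<Sum>s = 1..min i j. fact i * fact j * c ^ (i + j - s) /
            (fact s * fact (i - s) * fact (j - s)))))"

end

theory Submission
  imports Defs
begin

text \<open>
  Under \<open>np \<rightarrow> c\<close> a linear combination of the indices is a sum \<open>\<Sum>\<^sub>v P (d\<^sub>v)\<close> over the degrees, and its
  centred version \<open>W\<close> divided by \<open>sqrt n\<close> is treated by Stein's method for characteristic functions:
  deleting a vertex \<open>v\<close> leaves a random graph independent of the edges at \<open>v\<close>, and a first order
  expansion of \<open>exp (i t W)\<close> in the contribution of these edges gives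
  \<open>\<psi>' t = - \<sigma>\<^sup>2 t \<psi> t + O (n powr (-1/2))\<close> for the characteristic function \<open>\<psi>\<close>, hence
  \<open>\<psi> t \<rightarrow> exp (- \<sigma>\<^sup>2 t\<^sup>2 / 2)\<close>. In the other two regimes the Efron-Stein inequality shows that every
  normalised index is close in mean square to a multiple of the number of edges, a binomial variable;
  this is why the limit covariance has rank one. Weak convergence in \<open>\<real>\<^sup>k\<close> follows from convergence
  of characteristic functions and bounded second moments.
\<close>

section \<open>Independent Bernoulli variables on a finite set\<close>

text \<open>In the first regime the summand of \<open>W\<close> at \<open>v\<close> depends on the
  edges at \<open>v\<close> alone and is centred, so against the graph without \<open>v\<close> the
  zeroth order term vanishes and the first order term is a covariance. The obstacle is that
  \<open>v\<close> also changes the degrees of its neighbours: the covariance still depends on the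
  remaining graph, through a sum of increments. That sum is again a degree functional and
  concentrates by the Efron-Stein bound. Error constants have to be uniform in \<open>n\<close>;
  hence \<open>P\<close> is allowed to grow like \<open>2 ^ x\<close>, a class stable under shifts
  whose squares and cubes are controlled by exponential moments of a binomial variable of bounded
  mean. In the other two regimes a new edge changes the normalised index by a nearly constant
  amount, because degrees concentrate around \<open>n * p\<close> or, if \<open>n * p\<close> tends
  to 0, a typical edge joins otherwise isolated vertices. Expectations are finite weighted sums with
  values in any real vector space, which serves moments and characteristic functions alike. The
  existence of each limit law rests on an explicit Gram factor of its covariance matrix, since that
  matrix may be singular.\<close>

definition bexp :: "real \<Rightarrow> 'a set \<Rightarrow> ('a set \<Rightarrow> 'b::real_vector) \<Rightarrow> 'b" where
  "bexp p A f = (\<Sum>S\<in>Pow A. (p ^ card S * (1 - p) ^ card (A - S)) *\<^sub>R f S)"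

lemma bexp_empty [simp]: "bexp p {} f = f {}"
  by (simp add: bexp_def)

text \<open>Conditioning on the coordinate \<open>e\<close>. Later inductions over the index set use
  this recursion and not the weights themselves.\<close>

lemma bexp_insert:
  assumes "finite A" "e \<notin> A"
  shows "bexp p (insert e A) f =
    p *\<^sub>R bexp p A (\<lambda>S. f (insert e S)) + (1 - p) *\<^sub>R bexp p A f"
proof -
  let ?w = "\<lambda>B S. (p ^ card S * (1 - p) ^ card (B - S)) *\<^sub>R f S"
  have inj: "inj_on (insert e) (Pow A)"
    using assms(2) by (auto simp: inj_on_def)
  have "bexp p (insert e A) f = sum (?w (insert e A)) (Pow A) + sum (?w (insert e A)) (insert e ` Pow A)"
    unfolding bexp_def Pow_insert using assms by (intro sum.union_disjoint) auto
  also have "sum (?w (insert e A)) (insert e ` Pow A) = p *\<^sub>R bexp p A (\<lambda>S. f (insert e S))"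
  proof -
    have "?w (insert e A) (insert e S) =
        p *\<^sub>R ((p ^ card S * (1 - p) ^ card (A - S)) *\<^sub>R f (insert e S))" if "S \<in> Pow A" for S
    proof -
      have "finite S" "e \<notin> S" using that assms finite_subset by auto
      moreover have "insert e A - insert e S = A - S" using assms(2) by auto
      ultimately show ?thesis by simp
    qed
    then show ?thesis
      unfolding sum.reindex[OF inj] bexp_def o_def scaleR_sum_right by (rule sum.cong[OF refl])
  qed
  also have "sum (?w (insert e A)) (Pow A) = (1 - p) *\<^sub>R bexp p A f"
  proof -
    have "?w (insert e A) S = (1 - p) *\<^sub>R ?w A S" if "S \<in> Pow A" for S
    proof -
      have "insert e A - S = insert e (A - S)" "e \<notin> A - S" using that assms(2) by auto
      then show ?thesis using assms(1) by simp
    qed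
    then show ?thesis
      unfolding bexp_def scaleR_sum_right by (rule sum.cong[OF refl])
  qed
  finally show ?thesis by simp
qed

lemma bexp_cong:
  "A = B \<Longrightarrow> (\<And>S. S \<subseteq> B \<Longrightarrow> f S = g S) \<Longrightarrow> bexp p A f = bexp p B g"
  unfolding bexp_def by (intro sum.cong) auto

lemma bexp_add: "bexp p A (\<lambda>S. f S + g S) = bexp p A f + bexp p A g"
  by (simp add: bexp_def scaleR_add_right sum.distrib)

lemma bexp_diff: "bexp p A (\<lambda>S. f S - g S) = bexp p A f - bexp p A g"
  by (simp add: bexp_def scaleR_diff_right sum_subtractf)

lemma bexp_sum: "bexp p A (\<lambda>S. \<Sum>i\<in>I. f i S) = (\<Sum>i\<in>I. bexp p A (f i))"
  unfolding bexp_def by (simp add: scaleR_sum_right) (rule sum.swap)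

lemma bexp_cmult:
  fixes c :: "'b::real_algebra"
  shows "bexp p A (\<lambda>S. c * f S) = c * bexp p A f"
  by (simp add: bexp_def sum_distrib_left)

lemma bexp_multc:
  fixes c :: "'b::real_algebra"
  shows "bexp p A (\<lambda>S. f S * c) = bexp p A f * c"
  by (simp add: bexp_def sum_distrib_right)

lemma bexp_divc:
  fixes c :: "'b::real_field"
  shows "bexp p A (\<lambda>S. f S / c) = bexp p A f / c"
  by (simp add: divide_inverse bexp_multc)

lemma bexp_of_real: "bexp p A (\<lambda>S. of_real (f S)) = (of_real (bexp p A f) :: 'b::real_algebra_1)"
  by (simp add: bexp_def scaleR_conv_of_real)

lemma bexp_const [simp]: "finite A \<Longrightarrow> bexp p A (\<lambda>S. c) = c"
  by (induction A rule: finite_induct) (simp_all add: bexp_insert flip: scaleR_add_left)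

text \<open>Independence of disjoint blocks of coordinates, in Fubini form; it lets the edges at one
  vertex be averaged separately from all others.\<close>

lemma bexp_union:
  assumes "finite A" "finite B" "A \<inter> B = {}"
  shows "bexp p (A \<union> B) f = bexp p A (\<lambda>S. bexp p B (\<lambda>T. f (S \<union> T)))"
  using assms
  by (induction A arbitrary: f rule: finite_induct) (simp_all add: bexp_insert)

lemma bexp_swap:
  "bexp p A (\<lambda>S. bexp q B (f S)) = bexp q B (\<lambda>T. bexp p A (\<lambda>S. f S T))"
  unfolding bexp_def
  by (simp add: scaleR_sum_right mult.commute) (rule sum.swap)

lemma bexp_remove:
  assumes "finite A" "e \<in> A"
  shows "bexp p A f = p *\<^sub>R bexp p (A - {e}) (\<lambda>S. f (insert e S)) + (1 - p) *\<^sub>R bexp p (A - {e}) f"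
  using bexp_insert[of "A - {e}" e p f] assms by (simp add: insert_absorb)

context
  fixes p :: real
  assumes p: "0 \<le> p" "p \<le> 1"
begin

lemma bexp_mono:
  fixes f :: "'a set \<Rightarrow> real"
  assumes "\<And>S. S \<subseteq> A \<Longrightarrow> f S \<le> g S"
  shows "bexp p A f \<le> bexp p A g"
  unfolding bexp_def using p assms by (intro sum_mono) (auto intro!: mult_left_mono)

lemma bexp_nonneg:
  fixes f :: "'a set \<Rightarrow> real"
  assumes "\<And>S. S \<subseteq> A \<Longrightarrow> 0 \<le> f S"
  shows "0 \<le> bexp p A f"
  unfolding bexp_def using p assms by (intro sum_nonneg) auto

lemma norm_bexp_le:
  fixes f :: "'a set \<Rightarrow> 'b::real_normed_vector"
  shows "norm (bexp p A f) \<le> bexp p A (\<lambda>S. norm (f S))"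
  unfolding bexp_def using p by (intro order.trans[OF norm_sum] sum_mono) auto

lemma bexp_square_le:
  fixes f :: "'a set \<Rightarrow> real"
  assumes "finite A"
  shows "(bexp p A f)\<^sup>2 \<le> bexp p A (\<lambda>S. (f S)\<^sup>2)"
proof -
  let ?m = "bexp p A f"
  have "0 \<le> bexp p A (\<lambda>S. (f S - ?m)\<^sup>2)"
    by (rule bexp_nonneg) simp
  also have "\<dots> = bexp p A (\<lambda>S. (f S)\<^sup>2 - 2 * ?m * f S + ?m\<^sup>2)"
    by (intro bexp_cong) (auto simp: power2_diff algebra_simps)
  also have "\<dots> = bexp p A (\<lambda>S. (f S)\<^sup>2) - ?m\<^sup>2"
    using assms by (simp add: bexp_add bexp_diff bexp_cmult power2_eq_square)
  finally show ?thesis by simp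
qed

lemma bexp_abs_le_sqrt:
  fixes f :: "'a set \<Rightarrow> real"
  assumes "finite A"
  shows "bexp p A (\<lambda>S. \<bar>f S\<bar>) \<le> sqrt (bexp p A (\<lambda>S. (f S)\<^sup>2))"
  using bexp_square_le[OF assms, of "\<lambda>S. \<bar>f S\<bar>"] by (simp add: real_le_rsqrt)

text \<open>For two-valued coordinates the conditional variance in \<open>e\<close> is
  \<open>p * (1 - p)\<close> times a squared discrete derivative, which does not involve
  \<open>e\<close> itself; hence the average over \<open>A - {e}\<close>. The induction is the law
  of total variance: the slices with \<open>e\<close> present and \<open>e\<close> absent contribute
  by hypothesis, and the variance of the two slice means is bounded by Jensen's inequality.\<close>

lemma efron_stein:
  fixes f :: "'a set \<Rightarrow> real"
  assumes "finite A"
  shows "bexp p A (\<lambda>S. (f S - bexp p A f)\<^sup>2) \<le>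
    (\<Sum>e\<in>A. p * (1 - p) * bexp p (A - {e}) (\<lambda>S. (f (insert e S) - f S)\<^sup>2))"
  using assms
proof (induction A arbitrary: f rule: finite_induct)
  case (insert e A)
  define q where "q = 1 - p"
  have q: "0 \<le> q" "p + q = 1" using p by (auto simp: q_def)
  define g where "g = (\<lambda>S. f (insert e S))"
  define a where "a = bexp p A g"
  define b where "b = bexp p A f"
  have A: "finite A" "e \<notin> A" by fact+
  have m: "bexp p (insert e A) f = p * a + q * b"
    by (simp add: bexp_insert[OF A] a_def b_def g_def q_def)
  \<comment> \<open>The mean square about an arbitrary point is the variance plus the squared bias;
    the point will be the overall mean and \<open>h\<close> one of the two slices.\<close>
  have sq: "bexp p A (\<lambda>S. (h S - m)\<^sup>2) = bexp p A (\<lambda>S. (h S - bexp p A h)\<^sup>2) + (bexp p A h - m)\<^sup>2" for h :: "'a set \<Rightarrow> real" and m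
  proof -
    have "bexp p A (\<lambda>S. (h S - m)\<^sup>2) =
      bexp p A (\<lambda>S. (h S - bexp p A h)\<^sup>2 + (2 * (bexp p A h - m) * (h S - bexp p A h) + (bexp p A h - m)\<^sup>2))"
      by (intro bexp_cong refl) (simp add: power2_eq_square algebra_simps)
    then show ?thesis using A by (simp add: bexp_add bexp_cmult bexp_diff)
  qed
  let ?D = "\<lambda>h x S. (h (insert x S) - h S)\<^sup>2 :: real"
  have "bexp p (insert e A) (\<lambda>S. (f S - bexp p (insert e A) f)\<^sup>2) =
      p * bexp p A (\<lambda>S. (g S - a)\<^sup>2) + q * bexp p A (\<lambda>S. (f S - b)\<^sup>2) + (p * (a - (p * a + q * b))\<^sup>2 + q * (b - (p * a + q * b))\<^sup>2)"
    unfolding bexp_insert[OF A] m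
    using sq[of g "p * a + q * b"] sq[of f "p * a + q * b"]
    by (simp add: g_def[symmetric] a_def[symmetric] b_def[symmetric] q_def[symmetric]) (simp add: g_def algebra_simps)
  also have "p * (a - (p * a + q * b))\<^sup>2 + q * (b - (p * a + q * b))\<^sup>2 = p * q * (a - b)\<^sup>2"
  proof -
    have q1: "q = 1 - p" using q by simp
    show ?thesis unfolding q1 by (simp add: power2_eq_square algebra_simps)
  qed
  also have "(a - b)\<^sup>2 \<le> bexp p A (?D f e)"
    using bexp_square_le[OF A(1), of "\<lambda>S. g S - f S"] by (simp add: bexp_diff a_def b_def g_def)
  also have "bexp p A (\<lambda>S. (g S - a)\<^sup>2) \<le> (\<Sum>x\<in>A. p * q * bexp p (A - {x}) (?D g x))"
    unfolding a_def q_def by (rule insert.IH)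
  also have "bexp p A (\<lambda>S. (f S - b)\<^sup>2) \<le> (\<Sum>x\<in>A. p * q * bexp p (A - {x}) (?D f x))"
    unfolding b_def q_def by (rule insert.IH)
  also have "p * (\<Sum>x\<in>A. p * q * bexp p (A - {x}) (?D g x)) + q * (\<Sum>x\<in>A. p * q * bexp p (A - {x}) (?D f x))
     = (\<Sum>x\<in>A. p * q * bexp p (insert e A - {x}) (?D f x))"
  proof -
    have "bexp p (insert e A - {x}) (?D f x) = p * bexp p (A - {x}) (?D g x) + q * bexp p (A - {x}) (?D f x)"
      if "x \<in> A" for x
    proof -
      have "insert e A - {x} = insert e (A - {x})" using that A by auto
      then show ?thesis using A by (simp add: bexp_insert g_def q_def insert_commute)
    qed
    then show ?thesis by (simp add: sum_distrib_left sum.distrib algebra_simps)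
  qed
  finally show ?case using A p q
    by (simp add: mult_left_mono add_mono q_def)
qed simp

end

section \<open>Functions of a binomial variable\<close>

primrec binexp :: "nat \<Rightarrow> real \<Rightarrow> (nat \<Rightarrow> real) \<Rightarrow> real" where
  "binexp 0 p g = g 0"
| "binexp (Suc n) p g = p * binexp n p (\<lambda>x. g (Suc x)) + (1 - p) * binexp n p g"

text \<open>\<open>binexp\<close> is the recursion of \<open>bexp_insert\<close> with only the
  number of successes remembered, so one induction over \<open>A\<close> suffices: an element of
  \<open>B\<close> is a trial, any other coordinate averages out.\<close>

lemma bexp_card_Int:
  assumes "finite A" "B \<subseteq> A"
  shows "bexp p A (\<lambda>S. g (card (S \<inter> B))) = binexp (card B) p g"
  using assms
proof (induction A arbitrary: B g rule: finite_induct)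
  case (insert e A)
  have A: "finite A" "e \<notin> A" by fact+
  show ?case
  proof (cases "e \<in> B")
    case True
    define C where "C = B - {e}"
    have C: "B = insert e C" "e \<notin> C" "C \<subseteq> A" "finite C"
      using True insert.prems A finite_subset[of C A] by (auto simp: C_def)
    have "bexp p A (\<lambda>S. g (card (insert e S \<inter> B))) = bexp p A (\<lambda>S. g (Suc (card (S \<inter> C))))"
      using C A by (intro bexp_cong refl arg_cong[of _ _ g]) (auto simp: card_insert_if)
    moreover have "bexp p A (\<lambda>S. g (card (S \<inter> B))) = bexp p A (\<lambda>S. g (card (S \<inter> C)))"
      using C A by (intro bexp_cong refl arg_cong[of _ _ g] arg_cong[of _ _ card]) auto
    ultimately show ?thesis
      using insert.IH[OF C(3), of "\<lambda>x. g (Suc x)"] insert.IH[OF C(3), of g] C A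
      by (simp add: bexp_insert)
  next
    case False
    then have "B \<subseteq> A" using insert.prems by auto
    with False insert.IH[of B g] A show ?thesis
      by (simp add: bexp_insert algebra_simps)
  qed
qed simp

lemma bexp_card: "finite A \<Longrightarrow> bexp p A (\<lambda>S. g (card S)) = binexp (card A) p g"
  using bexp_card_Int[of A A p g] by (simp add: bexp_def Int_absorb2)

text \<open>The probability generating function. Real \<open>z\<close> gives the exponential moments
  behind the error bounds, complex \<open>z\<close> of modulus 1 the characteristic function of the
  number of edges.\<close>

lemma bexp_pow: "finite A \<Longrightarrow> bexp p A (\<lambda>S. z ^ card S) = (1 + p *\<^sub>R (z - 1) :: 'b::real_normed_field) ^ card A"
proof (induction A rule: finite_induct)
  case (insert e A)
  have "bexp p A (\<lambda>S. z ^ card (insert e S)) = bexp p A (\<lambda>S. z * z ^ card S)"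
  proof (intro bexp_cong refl)
    fix S assume "S \<subseteq> A"
    then have "finite S" "e \<notin> S" using insert.hyps finite_subset by auto
    then show "z ^ card (insert e S) = z * z ^ card S" by simp
  qed
  then show ?case
    using insert by (simp add: bexp_insert bexp_cmult algebra_simps scaleR_conv_of_real)
qed simp

lemma expectation_erdos_renyi:
  fixes f :: "nat set set \<Rightarrow> 'b::{banach, second_countable_topology}"
  assumes p: "0 \<le> p" "p \<le> 1"
  shows "measure_pmf.expectation (erdos_renyi n p) f = bexp p (all_edges n) f"
proof -
  let ?A = "all_edges n"
  have A: "finite ?A" by (rule finite_subset[of _ "Pow {1..n}"]) (auto simp: all_edges_def)
  let ?G = "\<lambda>S e. e \<in> (S :: nat set set)"
  let ?M = "Pi_pmf ?A False (\<lambda>_. bernoulli_pmf p)"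
  have inj: "inj_on ?G (Pow ?A)"
    by (auto simp: inj_on_def fun_eq_iff)
  have "measure_pmf.expectation (erdos_renyi n p) f
      = measure_pmf.expectation ?M (\<lambda>pr. f {e \<in> ?A. pr e})"
    by (simp add: erdos_renyi_def)
  \<comment> \<open>Off \<open>all_edges n\<close> the product law takes the default value
    \<open>False\<close>, so its support consists of indicator functions of edge sets.\<close>
  also have "\<dots> = (\<Sum>pr\<in>?G ` Pow ?A. pmf ?M pr *\<^sub>R f {e \<in> ?A. pr e})"
  proof (rule integral_measure_pmf)
    fix pr assume "pr \<in> set_pmf ?M"
    then have "\<forall>x. x \<notin> ?A \<longrightarrow> \<not> pr x" using set_Pi_pmf_subset[OF A, of False] by auto
    then have "pr = ?G {e \<in> ?A. pr e}" by auto
    then show "pr \<in> ?G ` Pow ?A" by blast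
  qed (use A in auto)
  also have "\<dots> = (\<Sum>S\<in>Pow ?A. pmf ?M (?G S) *\<^sub>R f {e \<in> ?A. e \<in> S})"
    by (simp add: sum.reindex[OF inj])
  also have "\<dots> = bexp p ?A f"
    unfolding bexp_def
  proof (intro sum.cong refl)
    fix S assume S: "S \<in> Pow ?A"
    have "pmf ?M (?G S) = (\<Prod>e\<in>?A. if e \<in> S then p else 1 - p)"
      using S A p by (subst pmf_Pi') (auto intro!: prod.cong)
    also have "\<dots> = p ^ card S * (1 - p) ^ card (?A - S)"
      using S A by (subst prod.If_cases) (auto simp: Int_absorb1 Diff_eq Int_absorb2 Collect_mem_eq Int_commute[of S])
    finally show "pmf ?M (?G S) *\<^sub>R f {e \<in> ?A. e \<in> S} = (p ^ card S * (1 - p) ^ card (?A - S)) *\<^sub>R f S"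
      using S by (auto intro!: arg_cong2[of _ _ _ _ "(*\<^sub>R)"] arg_cong[of _ _ f])
  qed
  finally show ?thesis .
qed

lemma binexp_eq_bexp: "binexp n p g = bexp p {..<n} (\<lambda>S. g (card S))"
  using bexp_card[of "{..<n}" p g] by simp

lemma binexp_add: "binexp n p (\<lambda>x. f x + g x) = binexp n p f + binexp n p g"
  by (simp add: binexp_eq_bexp bexp_add)

lemma binexp_diff: "binexp n p (\<lambda>x. f x - g x) = binexp n p f - binexp n p g"
  by (simp add: binexp_eq_bexp bexp_diff)

lemma binexp_cmult: "binexp n p (\<lambda>x. c * f x) = c * binexp n p f"
  by (simp add: binexp_eq_bexp bexp_cmult)

lemma binexp_sum: "binexp n p (\<lambda>x. \<Sum>i\<in>I. f i x) = (\<Sum>i\<in>I. binexp n p (f i))"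
  by (simp add: binexp_eq_bexp bexp_sum)

lemma binexp_const [simp]: "binexp n p (\<lambda>x. c) = c"
  by (simp add: binexp_eq_bexp)

lemma binexp_mono: "0 \<le> p \<Longrightarrow> p \<le> 1 \<Longrightarrow> (\<And>x. f x \<le> g x) \<Longrightarrow> binexp n p f \<le> binexp n p g"
  by (simp add: binexp_eq_bexp bexp_mono)

lemma binexp_nonneg: "0 \<le> p \<Longrightarrow> p \<le> 1 \<Longrightarrow> (\<And>x. 0 \<le> f x) \<Longrightarrow> 0 \<le> binexp n p f"
  by (simp add: binexp_eq_bexp bexp_nonneg)

lemma abs_binexp_le: "0 \<le> p \<Longrightarrow> p \<le> 1 \<Longrightarrow> \<bar>binexp n p f\<bar> \<le> binexp n p (\<lambda>x. \<bar>f x\<bar>)"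
  using norm_bexp_le[of p "{..<n}" "\<lambda>S. f (card S)"] by (simp add: binexp_eq_bexp)

lemma binexp_power_base: "binexp n p (\<lambda>x. z ^ x) = (1 + p * (z - 1)) ^ n"
  by (simp add: binexp_eq_bexp bexp_pow)

text \<open>By \<open>1 + x \<le> exp x\<close> the exponential moment is bounded through
  \<open>n * p\<close> alone, hence uniformly in the sparse regime.\<close>

lemma binexp_power_base_le:
  assumes "0 \<le> p" "1 \<le> z" "real n * p \<le> c"
  shows "binexp n p (\<lambda>x. z ^ x) \<le> exp ((z - 1) * c)"
proof -
  have "(1 + p * (z - 1)) ^ n \<le> exp (p * (z - 1)) ^ n"
    using assms by (intro power_mono) auto
  also have "\<dots> = exp ((z - 1) * (real n * p))"
    by (simp add: exp_of_nat_mult[symmetric] algebra_simps)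
  also have "\<dots> \<le> exp ((z - 1) * c)"
    using assms by (simp add: mult_left_mono)
  finally show ?thesis by (simp add: binexp_power_base)
qed

section \<open>Falling factorials and binomial moments\<close>

text \<open>The falling factorial \<open>x (x - 1) ... (x - i + 1)\<close>. Written with the
  binomial coefficient it vanishes for \<open>i > x\<close>, and the identities of Pascal and
  Vandermonde apply.\<close>

definition ffact :: "nat \<Rightarrow> nat \<Rightarrow> real" where
  "ffact x i = fact i * real (x choose i)"

lemma ffact_0 [simp]: "ffact x 0 = 1"
  by (simp add: ffact_def)

lemma ffact_Suc_left: "ffact (Suc x) (Suc i) = ffact x (Suc i) + real (Suc i) * ffact x i"
  by (simp add: ffact_def algebra_simps)

lemma ffact_Suc: "ffact x (Suc i) = (real x - real i) * ffact x i"
proof (cases "i \<le> x")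
  case True
  have "Suc i * (x choose Suc i) = (x choose i) * (x - i)"
    using binomial_absorb_comp[of x i] binomial_absorption[of i "x"] by (metis binomial_absorption binomial_absorb_comp mult.commute)
  then have "real (Suc i) * real (x choose Suc i) = real (x choose i) * (real x - real i)"
    using True by (metis of_nat_diff of_nat_mult)
  then have "fact i * (real (Suc i) * real (x choose Suc i)) = fact i * (real (x choose i) * (real x - real i))"
    by simp
  then show ?thesis by (simp add: ffact_def algebra_simps)
qed (simp add: ffact_def binomial_eq_0)

text \<open>Multiplication by \<open>x\<close> turns the \<open>i\<close>-th falling factorial into
  the next one plus \<open>i\<close> times itself, which is the recursion of the Stirling numbers of
  the second kind.\<close>

lemma power_eq_sum_ffact: "real x ^ m = (\<Sum>i\<le>m. real (Stirling m i) * ffact x i)"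
proof (induction m)
  case (Suc m)
  have "real x ^ Suc m = (\<Sum>i\<le>m. real (Stirling m i) * (real x * ffact x i))"
    unfolding power_Suc Suc.IH by (simp add: sum_distrib_left mult_ac)
  also have "\<dots> = (\<Sum>i\<le>m. real (Stirling m i) * (ffact x (Suc i) + real i * ffact x i))"
    by (simp add: ffact_Suc algebra_simps)
  also have "\<dots> = (\<Sum>i\<le>m. real (Stirling m i) * ffact x (Suc i)) + (\<Sum>i\<le>m. real i * real (Stirling m i) * ffact x i)"
    by (simp add: algebra_simps sum.distrib)
  also have "(\<Sum>i\<le>m. real i * real (Stirling m i) * ffact x i) = (\<Sum>i\<le>Suc m. real i * real (Stirling m i) * ffact x i)"
    by simp
  also have "\<dots> = (\<Sum>i\<le>m. real (Suc i) * real (Stirling m (Suc i)) * ffact x (Suc i))"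
    by (subst sum.atMost_Suc_shift) simp
  also have "(\<Sum>i\<le>m. real (Stirling m i) * ffact x (Suc i)) + \<dots> = (\<Sum>i\<le>m. real (Stirling (Suc m) (Suc i)) * ffact x (Suc i))"
    by (simp add: algebra_simps sum.distrib)
  also have "\<dots> = (\<Sum>i\<le>Suc m. real (Stirling (Suc m) i) * ffact x i)"
    by (subst sum.atMost_Suc_shift) simp
  finally show ?case .
qed simp

lemma power_eq_sum_ffact': "m \<ge> 1 \<Longrightarrow> real x ^ m = (\<Sum>i=1..m. real (Stirling m i) * ffact x i)"
  unfolding power_eq_sum_ffact
  by (cases m) (simp_all add: sum.atMost_Suc_shift sum.atLeast_Suc_atMost_Suc_shift atLeast0AtMost
    One_nat_def del: sum.cl_ivl_Suc sum.atMost_Suc Stirling.simps(4))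

text \<open>Pairs of injections of an \<open>i\<close>-set and a \<open>j\<close>-set into an
  \<open>x\<close>-set, sorted by the size \<open>s\<close> of the overlap of their images; in the
  proof Vandermonde's identity splits \<open>x choose j\<close> along a fixed
  \<open>i\<close>-subset. The coefficients are those of \<open>zagreb_cov\<close>, which is where
  that formula originates.\<close>

lemma ffact_mult:
  "ffact x i * ffact x j =
    (\<Sum>s\<le>min i j. fact i * fact j / (fact s * fact (i - s) * fact (j - s)) * ffact x (i + j - s))"
proof (cases "i \<le> x")
  case True
  have "ffact x i * ffact x j = (\<Sum>s\<le>j. ffact x i * fact j * real ((i choose s) * (x - i choose (j - s))))"
    using vandermonde[of i "x - i" j] True
    by (simp add: ffact_def flip: sum_distrib_left of_nat_sum of_nat_mult)
  also have "\<dots> = (\<Sum>s\<le>min i j. ffact x i * fact j * real ((i choose s) * (x - i choose (j - s))))"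
    by (intro sum.mono_neutral_right) auto
  also have "\<dots> = (\<Sum>s\<le>min i j. fact i * fact j / (fact s * fact (i - s) * fact (j - s)) * ffact x (i + j - s))"
  proof (intro sum.cong refl)
    fix s assume "s \<in> {..min i j}"
    then have s: "s \<le> i" "s \<le> j" by auto
    have e: "i + j - s - i = j - s" using s by simp
    have "(x choose i) * (x - i choose (j - s)) = (x choose (i + j - s)) * (i + j - s choose i)"
    proof (cases "i + j - s \<le> x")
      case le: True
      show ?thesis using choose_mult[of i "i + j - s" x] s le e by simp
    next
      case False
      then have "x - i < j - s" using s \<open>i \<le> x\<close> by linarith
      with False show ?thesis by (simp add: binomial_eq_0)
    qed
    then have c: "real (x choose i) * real (x - i choose (j - s)) = real (x choose (i + j - s)) * real (i + j - s choose i)"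
      by (metis of_nat_mult)
    have d: "real (i + j - s choose i) = fact (i + j - s) / (fact i * fact (j - s))"
      using s e by (subst binomial_fact) auto
    have f: "real (i choose s) = fact i / (fact s * fact (i - s))"
      using s by (subst binomial_fact) auto
    have "ffact x i * fact j * real ((i choose s) * (x - i choose (j - s))) =
        fact i * fact j * real (i choose s) * (real (x choose i) * real (x - i choose (j - s)))"
      by (simp add: ffact_def)
    also have "\<dots> = fact i * fact j / (fact s * fact (i - s) * fact (j - s)) * ffact x (i + j - s)"
      unfolding c d f by (simp add: ffact_def mult_ac)
    finally show "ffact x i * fact j * real ((i choose s) * (x - i choose (j - s))) =
        fact i * fact j / (fact s * fact (i - s) * fact (j - s)) * ffact x (i + j - s)" .
  qed
  finally show ?thesis .
next
  case False
  \<comment> \<open>Since \<open>i + j - s\<close> is at least \<open>i\<close>, every falling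
    factorial on the right vanishes as well.\<close>
  then have "\<And>s. s \<le> min i j \<Longrightarrow> x < i + j - s" by auto
  with False show ?thesis by (simp add: ffact_def binomial_eq_0)
qed

lemma binexp_ffact: "binexp n p (\<lambda>x. ffact x i) = ffact n i * p ^ i"
proof (induction n arbitrary: i)
  case 0
  show ?case by (cases i) (simp_all add: ffact_def)
next
  case (Suc n)
  show ?case
  proof (cases i)
    case (Suc j)
    have "binexp (Suc n) p (\<lambda>x. ffact x i) = ffact n (Suc j) * p ^ Suc j + p * (real (Suc j) * (ffact n j * p ^ j))"
      unfolding binexp.simps Suc ffact_Suc_left binexp_add binexp_cmult Suc.IH by (simp add: algebra_simps)
    then show ?thesis by (simp add: Suc ffact_Suc_left algebra_simps)
  qed simp
qed

text \<open>For \<open>n > j\<close> the ratio is a product of \<open>i\<close> factors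
  \<open>1 - (j + a) / n\<close>, so its distance from 1 is of order \<open>1 / n\<close>. The rate,
  and not just the limit, matters when the indices are centred by powers of \<open>n\<close> in
  place of falling factorials.\<close>

lemma ffact_ratio_rate: "\<exists>L. (\<lambda>n. real n * (1 - ffact (n - j) i / real n ^ i)) \<longlonglongrightarrow> L"
proof (induction i)
  case (Suc i)
  define r where "r = (\<lambda>n. ffact (n - j) i / real n ^ i)"
  from Suc obtain L where L: "(\<lambda>n. real n * (1 - r n)) \<longlonglongrightarrow> L"
    by (auto simp: r_def)
  have "(\<lambda>n. real n * (1 - r n) / real n) \<longlonglongrightarrow> 0"
    by (rule real_tendsto_divide_at_top[OF L filterlim_real_sequentially])
  moreover have "\<forall>\<^sub>F n in sequentially. 1 - real n * (1 - r n) / real n = r n"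
    using eventually_gt_at_top[of 0] by eventually_elim simp
  ultimately have r: "r \<longlonglongrightarrow> 1"
    using tendsto_cong[of "\<lambda>n. 1 - real n * (1 - r n) / real n" r sequentially 1]
      tendsto_diff[OF tendsto_const[of 1]] by force
  have "(\<lambda>n. real n * (1 - r n) + r n * real (j + i)) \<longlonglongrightarrow> L + 1 * real (j + i)"
    by (intro tendsto_intros L r)
  moreover have "\<forall>\<^sub>F n in sequentially. real n * (1 - r n) + r n * real (j + i) =
      real n * (1 - ffact (n - j) (Suc i) / real n ^ Suc i)"
    using eventually_gt_at_top[of "j"]
  proof eventually_elim
    case (elim n)
    then show ?case by (simp add: r_def ffact_Suc field_simps of_nat_diff)
  qed
  ultimately show ?case by (blast intro: Lim_transform_eventually)
qed auto

lemma ffact_ratio_tendsto: "(\<lambda>n. ffact (n - j) i / real n ^ i) \<longlonglongrightarrow> 1"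
proof -
  define r where "r = (\<lambda>n. ffact (n - j) i / real n ^ i)"
  obtain L where L: "(\<lambda>n. real n * (1 - r n)) \<longlonglongrightarrow> L"
    using ffact_ratio_rate[of j i] by (auto simp: r_def)
  have "(\<lambda>n. real n * (1 - r n) / real n) \<longlonglongrightarrow> 0"
    by (rule real_tendsto_divide_at_top[OF L filterlim_real_sequentially])
  moreover have "\<forall>\<^sub>F n in sequentially. 1 - real n * (1 - r n) / real n = r n"
    using eventually_gt_at_top[of 0] by eventually_elim simp
  ultimately show ?thesis
    using tendsto_cong[of "\<lambda>n. 1 - real n * (1 - r n) / real n" r sequentially 1]
      tendsto_diff[OF tendsto_const[of 1]] unfolding r_def[symmetric] by force
qed

lemma ffact_moment_eq:
  "n > 0 \<Longrightarrow> ffact (n - j) i * q ^ i = ffact (n - j) i / real n ^ i * (real n * q) ^ i"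
  by (simp add: power_mult_distrib)

section \<open>Degrees in a random graph\<close>

text \<open>An arbitrary vertex set is allowed because Stein's method works with the graph from
  which one vertex is deleted.\<close>

definition edges :: "'a set \<Rightarrow> 'a set set" where
  "edges V = {e. e \<subseteq> V \<and> card e = 2}"

definition deg :: "'a set set \<Rightarrow> 'a \<Rightarrow> nat" where
  "deg S v = card {e \<in> S. v \<in> e}"

text \<open>A power \<open>Q\<close> gives a Zagreb index, a linear combination of powers a
  one-dimensional projection of the whole vector, and the identity twice the number of
  edges.\<close>

definition degsum :: "(nat \<Rightarrow> real) \<Rightarrow> 'a set \<Rightarrow> 'a set set \<Rightarrow> real" where
  "degsum Q V S = (\<Sum>v\<in>V. Q (deg S v))"

lemma finite_edges [simp]: "finite V \<Longrightarrow> finite (edges V)"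
  by (rule finite_subset[of _ "Pow V"]) (auto simp: edges_def)

lemma star_eq_image: "v \<in> V \<Longrightarrow> {e \<in> edges V. v \<in> e} = (\<lambda>u. {v, u}) ` (V - {v})"
  by (auto simp: edges_def card_2_iff doubleton_eq_iff)

lemma inj_on_doubleton: "inj_on (\<lambda>u. {v, u}) A"
  by (auto simp: inj_on_def doubleton_eq_iff)

lemma card_star: "v \<in> V \<Longrightarrow> card {e \<in> edges V. v \<in> e} = card V - 1"
  by (simp add: star_eq_image card_image inj_on_doubleton)

lemma bexp_deg:
  assumes "finite V" "v \<in> V"
  shows "bexp p (edges V) (\<lambda>S. g (deg S v)) = binexp (card V - 1) p g"
proof -
  have "bexp p (edges V) (\<lambda>S. g (deg S v)) = bexp p (edges V) (\<lambda>S. g (card (S \<inter> {e \<in> edges V. v \<in> e})))"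
    unfolding deg_def by (intro bexp_cong refl arg_cong[of _ _ g] arg_cong[of _ _ card]) auto
  then show ?thesis
    using bexp_card_Int[of "edges V" "{e \<in> edges V. v \<in> e}" p g] assms by (simp add: card_star)
qed

text \<open>With \<open>e\<close> withheld, \<open>card V - 2\<close> possible edges at
  \<open>v\<close> are left; this is the average that the Efron-Stein inequality calls for.\<close>

lemma bexp_deg_remove:
  assumes "finite V" "e \<in> edges V" "v \<in> e"
  shows "bexp p (edges V - {e}) (\<lambda>S. g (deg S v)) = binexp (card V - 2) p g"
proof -
  let ?B = "{x \<in> edges V. v \<in> x} - {e}"
  have v: "v \<in> V" using assms by (auto simp: edges_def)
  have "bexp p (edges V - {e}) (\<lambda>S. g (deg S v)) = bexp p (edges V - {e}) (\<lambda>S. g (card (S \<inter> ?B)))"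
    unfolding deg_def by (intro bexp_cong refl arg_cong[of _ _ g] arg_cong[of _ _ card]) auto
  also have "\<dots> = binexp (card ?B) p g"
    using assms by (intro bexp_card_Int) auto
  also have "card ?B = card V - 2"
    using assms v by (simp add: card_star)
  finally show ?thesis .
qed

lemma bexp_degsum:
  assumes "finite V"
  shows "bexp p (edges V) (degsum Q V) = real (card V) * binexp (card V - 1) p Q"
  using assms unfolding degsum_def by (simp add: bexp_sum bexp_deg)

lemma deg_insert:
  "finite S \<Longrightarrow> e \<notin> S \<Longrightarrow> deg (insert e S) v = (if v \<in> e then Suc (deg S v) else deg S v)"
proof -
  assume "finite S" "e \<notin> S"
  moreover have "{x \<in> insert e S. v \<in> x} = (if v \<in> e then insert e {x \<in> S. v \<in> x} else {x \<in> S. v \<in> x})"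
    by auto
  ultimately show ?thesis by (simp add: deg_def)
qed

lemma degsum_insert:
  assumes "finite V" "e \<in> edges V" "finite S" "e \<notin> S"
  shows "degsum Q V (insert e S) - degsum Q V S = (\<Sum>v\<in>e. Q (Suc (deg S v)) - Q (deg S v))"
proof -
  have "degsum Q V (insert e S) - degsum Q V S = (\<Sum>v\<in>V. if v \<in> e then Q (Suc (deg S v)) - Q (deg S v) else 0)"
    unfolding degsum_def sum_subtractf[symmetric] using assms
    by (intro sum.cong) (auto simp: deg_insert)
  also have "\<dots> = (\<Sum>v\<in>e. Q (Suc (deg S v)) - Q (deg S v))"
  proof -
    have "V \<inter> e = e" using assms by (auto simp: edges_def)
    then show ?thesis by (simp only: sum.inter_restrict[OF assms(1), symmetric])
  qed
  finally show ?thesis .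
qed

text \<open>Toggling an edge changes the functional by one increment of \<open>Q\<close> at each of
  its two ends. The two ends cost a factor 4, and there are at most \<open>n ^ 2 / 2\<close> edges.
  For the identity the bound is sharp to leading order. It serves all three regimes.\<close>

lemma degsum_variance_le:
  assumes "finite V" "0 \<le> p" "p \<le> 1"
  shows "bexp p (edges V) (\<lambda>S. (degsum Q V S - real (card V) * binexp (card V - 1) p Q)\<^sup>2) \<le>
    2 * (real (card V))\<^sup>2 * p * (1 - p) * binexp (card V - 2) p (\<lambda>x. (Q (Suc x) - Q x)\<^sup>2)"
proof -
  let ?b = "binexp (card V - 2) p (\<lambda>x. (Q (Suc x) - Q x)\<^sup>2)"
  have b: "?b \<ge> 0" using assms by (intro binexp_nonneg) auto
  have "bexp p (edges V) (\<lambda>S. (degsum Q V S - bexp p (edges V) (degsum Q V))\<^sup>2) \<le>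
     (\<Sum>e\<in>edges V. p * (1 - p) * bexp p (edges V - {e}) (\<lambda>S. (degsum Q V (insert e S) - degsum Q V S)\<^sup>2))"
    using assms by (intro efron_stein) auto
  also have "\<dots> \<le> (\<Sum>e\<in>edges V. p * (1 - p) * (4 * ?b))"
  proof (intro sum_mono mult_left_mono)
    fix e assume e: "e \<in> edges V"
    then obtain u w where uw: "e = {u, w}" "u \<noteq> w" by (auto simp: edges_def card_2_iff)
    let ?D = "\<lambda>S v. Q (Suc (deg S v)) - Q (deg S v)"
    have "bexp p (edges V - {e}) (\<lambda>S. (degsum Q V (insert e S) - degsum Q V S)\<^sup>2) \<le>
       bexp p (edges V - {e}) (\<lambda>S. 2 * (?D S u)\<^sup>2 + 2 * (?D S w)\<^sup>2)"
    proof (intro bexp_mono assms)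
      fix S assume S: "S \<subseteq> edges V - {e}"
      then have "finite S" using assms finite_subset by (metis finite_Diff finite_edges)
      then have "degsum Q V (insert e S) - degsum Q V S = ?D S u + ?D S w"
        using degsum_insert[of V e S Q] S e assms uw by auto
      moreover have "(a + b)\<^sup>2 \<le> 2 * a\<^sup>2 + 2 * b\<^sup>2" for a b :: real
        using sum_squares_bound[of a b] by (simp add: power2_sum)
      ultimately show "(degsum Q V (insert e S) - degsum Q V S)\<^sup>2 \<le> 2 * (?D S u)\<^sup>2 + 2 * (?D S w)\<^sup>2"
        by metis
    qed
    also have "\<dots> = 2 * ?b + 2 * ?b"
      using bexp_deg_remove[OF assms(1) e, of u p "\<lambda>x. (Q (Suc x) - Q x)\<^sup>2"]
        bexp_deg_remove[OF assms(1) e, of w p "\<lambda>x. (Q (Suc x) - Q x)\<^sup>2"] uw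
      by (simp add: bexp_add bexp_cmult)
    finally show "bexp p (edges V - {e}) (\<lambda>S. (degsum Q V (insert e S) - degsum Q V S)\<^sup>2) \<le> 4 * ?b" by simp
  qed (use assms in auto)
  also have "\<dots> = real (4 * (card V choose 2)) * (p * (1 - p) * ?b)"
    using n_subsets[OF assms(1), of 2] by (simp add: edges_def)
  also have "\<dots> \<le> (2 * (real (card V))\<^sup>2) * (p * (1 - p) * ?b)"
  proof (rule mult_right_mono)
    have "4 * (card V choose 2) \<le> 2 * (card V)\<^sup>2"
      using mult_le_mono2[of "card V - 1" "card V" "card V"] unfolding choose_two power2_eq_square by linarith
    from of_nat_mono[OF this, where 'a = real] show "real (4 * (card V choose 2)) \<le> 2 * (real (card V))\<^sup>2"
      by simp
  qed (use assms b in auto)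
  finally show ?thesis using assms by (simp add: bexp_degsum mult_ac)
qed

section \<open>Weak convergence from characteristic functions\<close>

text \<open>Linear combinations of real and imaginary parts of characters: their integrals are
  determined by the characteristic function, and the product formulas make them an algebra, as
  Stone-Weierstrass requires.\<close>

inductive trig_poly :: "('a::real_inner \<Rightarrow> real) \<Rightarrow> bool" where
  cos: "trig_poly (\<lambda>x. c * cos (t \<bullet> x))"
| sin: "trig_poly (\<lambda>x. c * sin (t \<bullet> x))"
| add: "trig_poly f \<Longrightarrow> trig_poly g \<Longrightarrow> trig_poly (\<lambda>x. f x + g x)"

lemma trig_poly_const: "trig_poly (\<lambda>x. c)"
  using trig_poly.cos[of c 0] by simp

lemma trig_poly_bounded: "trig_poly f \<Longrightarrow> \<exists>B. \<forall>x. \<bar>f x\<bar> \<le> B"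
proof (induction rule: trig_poly.induct)
  case (cos c t)
  have "\<bar>c * cos (t \<bullet> x)\<bar> \<le> \<bar>c\<bar>" for x :: 'a by (simp add: abs_mult mult_left_le)
  then show ?case by blast
next
  case (sin c t)
  have "\<bar>c * sin (t \<bullet> x)\<bar> \<le> \<bar>c\<bar>" for x :: 'a by (simp add: abs_mult mult_left_le)
  then show ?case by blast
next
  case (add f g)
  then obtain B C where "\<And>x. \<bar>f x\<bar> \<le> B" "\<And>x. \<bar>g x\<bar> \<le> C" by blast
  then have "\<bar>f x + g x\<bar> \<le> B + C" for x using abs_triangle_ineq[of "f x" "g x"] by (smt (verit))
  then show ?case by blast
qed

lemma trig_poly_continuous: "trig_poly f \<Longrightarrow> continuous_on UNIV f"
  by (induction rule: trig_poly.induct) (auto intro!: continuous_intros)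

lemma trig_poly_mult:
  assumes "trig_poly f" "trig_poly g"
  shows "trig_poly (\<lambda>x. f x * g x)"
  using assms
proof (induction arbitrary: g rule: trig_poly.induct)
  case (cos c t)
  from cos show ?case
  proof (induction rule: trig_poly.induct)
    case (cos d s)
    have "trig_poly (\<lambda>x. c * d / 2 * cos ((t - s) \<bullet> x) + c * d / 2 * cos ((t + s) \<bullet> x))"
      by (intro trig_poly.intros)
    then show ?case by (simp add: inner_left_distrib inner_diff_left cos_add cos_diff algebra_simps)
  next
    case (sin d s)
    have "trig_poly (\<lambda>x. c * d / 2 * sin ((t + s) \<bullet> x) + (- c * d / 2) * sin ((t - s) \<bullet> x))"
      by (intro trig_poly.intros)
    then show ?case by (simp add: inner_left_distrib inner_diff_left sin_add sin_diff algebra_simps)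
  qed (simp add: trig_poly.add distrib_left)
next
  case (sin c t)
  from sin show ?case
  proof (induction rule: trig_poly.induct)
    case (cos d s)
    have "trig_poly (\<lambda>x. c * d / 2 * sin ((t + s) \<bullet> x) + (c * d / 2) * sin ((t - s) \<bullet> x))"
      by (intro trig_poly.intros)
    then show ?case by (simp add: inner_left_distrib inner_diff_left sin_add sin_diff algebra_simps)
  next
    case (sin d s)
    have "trig_poly (\<lambda>x. c * d / 2 * cos ((t - s) \<bullet> x) + (- c * d / 2) * cos ((t + s) \<bullet> x))"
      by (intro trig_poly.intros)
    then show ?case by (simp add: inner_left_distrib inner_diff_left cos_add cos_diff algebra_simps)
  qed (simp add: trig_poly.add distrib_left)
qed (simp add: trig_poly.add distrib_right)

lemma trig_poly_compose:
  assumes "real_polynomial_function q" "trig_poly f"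
  shows "trig_poly (\<lambda>x. q (f x))"
  using assms(1)
proof (induction rule: real_polynomial_function.induct)
  case (linear h)
  have h: "h y = h 1 * y" for y
    using linear_scale[OF bounded_linear.linear[OF linear], of y 1] by simp
  show ?case
    unfolding h[of "f _"] by (rule trig_poly_mult[OF trig_poly_const assms(2)])
qed (simp_all add: trig_poly_const trig_poly.add trig_poly_mult)

text \<open>
  Stone-Weierstrass gives an approximation on \<open>K\<close> only; composing it with a polynomial close to a
  truncation function keeps the approximation bounded by \<open>B + e\<close> outside \<open>K\<close> as well.
\<close>

lemma trig_poly_dense:
  fixes f :: "'a::euclidean_space \<Rightarrow> real"
  assumes "compact K" "continuous_on UNIV f" "\<And>x. \<bar>f x\<bar> \<le> B" "e > 0"
  obtains g where "trig_poly g" "\<And>x. x \<in> K \<Longrightarrow> \<bar>f x - g x\<bar> \<le> e" "\<And>x. \<bar>g x\<bar> \<le> B + e"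
proof -
  interpret T: function_ring_on "Collect trig_poly" K
  proof unfold_locales
    show "f \<in> Collect trig_poly \<Longrightarrow> continuous_on K f" for f
      using trig_poly_continuous continuous_on_subset by blast
    show "\<exists>f\<in>Collect trig_poly. f x \<noteq> f y" if "x \<noteq> y" for x y :: 'a
    proof -
      \<comment> \<open>With this scaling \<open>z \<mapsto> cos (t \<bullet> (z - y))\<close> takes
        the value 1 at \<open>y\<close> and \<open>cos 1\<close> at \<open>x\<close>.\<close>
      define t where "t = (1 / (norm (x - y))\<^sup>2) *\<^sub>R (x - y)"
      have "t \<bullet> (x - y) = 1"
        using that by (simp add: t_def power2_norm_eq_inner)
      then have "cos (t \<bullet> (x - y)) = cos 1" by simp
      moreover have "cos (1 :: real) \<noteq> 1"
        using cos_monotone_0_pi[of 0 1] pi_gt3 by auto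
      moreover have "trig_poly (\<lambda>z. cos (t \<bullet> y) * cos (t \<bullet> z) + sin (t \<bullet> y) * sin (t \<bullet> z))"
        by (intro trig_poly.intros)
      moreover have "cos (t \<bullet> y) * cos (t \<bullet> x) + sin (t \<bullet> y) * sin (t \<bullet> x) = cos (t \<bullet> (x - y))"
        by (simp add: inner_diff_right cos_diff)
      moreover have "cos (t \<bullet> y) * cos (t \<bullet> y) + sin (t \<bullet> y) * sin (t \<bullet> y) = 1"
        by (metis power2_eq_square sin_cos_squared_add2)
      ultimately show ?thesis by (intro bexI) auto
    qed
  qed (use assms trig_poly_const trig_poly.add trig_poly_mult in auto)
  have B: "0 \<le> B" using assms(3) abs_ge_zero order_trans by blast
  from T.Stone_Weierstrass_basic[OF continuous_on_subset[OF assms(2)], of "e / 2"] assms(4)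
  obtain h where h: "trig_poly h" "\<And>x. x \<in> K \<Longrightarrow> \<bar>f x - h x\<bar> < e / 2"
    by auto
  obtain C where C: "\<And>x. \<bar>h x\<bar> \<le> C" using trig_poly_bounded[OF h(1)] by blast
  define clip where "clip y = max (- B) (min B y)" for y :: real
  have "continuous_on {-C..C} clip" unfolding clip_def by (intro continuous_intros)
  then obtain q where q: "real_polynomial_function q" "\<And>y. y \<in> {-C..C} \<Longrightarrow> \<bar>clip y - q y\<bar> < e / 2"
    using Stone_Weierstrass_real_polynomial_function[of "{-C..C}" clip "e / 2"] assms(4) by auto
  have hC: "h x \<in> {-C..C}" for x using C[of x] by (auto simp: abs_le_iff)
  show ?thesis
  proof
    show "trig_poly (\<lambda>x. q (h x))" by (rule trig_poly_compose[OF q(1) h(1)])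
    fix x
    have "\<bar>clip (h x)\<bar> \<le> B" using B by (auto simp: clip_def)
    then show "\<bar>q (h x)\<bar> \<le> B + e" using q(2)[OF hC[of x]] assms(4) by linarith
    assume "x \<in> K"
    then have "\<bar>f x - clip (h x)\<bar> < e / 2"
      using h(2)[OF \<open>x \<in> K\<close>] assms(3)[of x] unfolding clip_def by linarith
    then show "\<bar>f x - q (h x)\<bar> \<le> e" using q(2)[OF hC[of x]] by linarith
  qed
qed

lemma borel_measure_tight:
  fixes N :: "'a::euclidean_space measure"
  assumes "prob_space N" "sets N = sets borel" "e > 0"
  obtains r where "r > 0" "measure N {x. r < norm x} \<le> e"
proof -
  interpret N: prob_space N by fact
  have "(\<lambda>i. measure N {x. real i < norm x}) \<longlonglongrightarrow> measure N (\<Inter>i. {x. real i < norm x})"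
  proof (rule N.finite_Lim_measure_decseq)
    have "{x::'a. real i < norm x} \<in> sets borel" for i by measurable
    then show "range (\<lambda>i. {x::'a. real i < norm x}) \<subseteq> sets N" unfolding assms(2) by blast
    show "decseq (\<lambda>i. {x::'a. real i < norm x})"
      unfolding decseq_def using of_nat_mono order.strict_trans1 by blast
  qed
  moreover have "(\<Inter>i. {x::'a. real i < norm x}) = {}"
  proof (intro equals0I)
    fix x :: 'a assume x: "x \<in> (\<Inter>i. {x. real i < norm x})"
    obtain i :: nat where "norm x \<le> real i" using real_arch_simple by blast
    with x show False by (auto dest: spec[of _ i])
  qed
  ultimately have "(\<lambda>i. measure N {x. real i < norm x}) \<longlonglongrightarrow> 0" by simp
  then have "\<forall>\<^sub>F i in sequentially. measure N {x. real i < norm x} < e"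
    using assms(3) by (rule order_tendstoD(2))
  with eventually_gt_at_top[of 0] have "\<forall>\<^sub>F i in sequentially. 0 < i \<and> measure N {x. real i < norm x} < e"
    by eventually_elim auto
  then obtain i where "0 < i" "measure N {x. real i < norm x} < e"
    by (auto simp: eventually_at_top_linorder)
  then show ?thesis using that[of "real i"] by auto
qed

lemma abs_integral_diff_le:
  fixes f g :: "'a::euclidean_space \<Rightarrow> real"
  assumes "prob_space M" and sets: "sets M = sets borel"
    and f: "continuous_on UNIV f" "\<And>x. \<bar>f x\<bar> \<le> B"
    and g: "continuous_on UNIV g" "\<And>x. \<bar>g x\<bar> \<le> C"
    and close: "\<And>x. norm x \<le> r \<Longrightarrow> \<bar>f x - g x\<bar> \<le> e" and "0 \<le> e"
  shows "\<bar>integral\<^sup>L M f - integral\<^sup>L M g\<bar> \<le> e + (B + C) * measure M {x. r < norm x}"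
proof -
  interpret M: prob_space M by fact
  have mf: "f \<in> borel_measurable M" and mg: "g \<in> borel_measurable M"
    using borel_measurable_continuous_onI[OF f(1)] borel_measurable_continuous_onI[OF g(1)]
    by (simp_all add: measurable_cong_sets[OF sets refl])
  have int: "integrable M f" "integrable M g"
    by (rule M.integrable_const_bound[where B = B], use f(2) mf in simp_all)
      (rule M.integrable_const_bound[where B = C], use g(2) mg in simp_all)
  have A: "{x. r < norm x} \<in> sets M" unfolding sets by measurable
  have BC: "0 \<le> B + C" using f(2)[of 0] g(2)[of 0] by linarith
  have "\<bar>integral\<^sup>L M f - integral\<^sup>L M g\<bar> = \<bar>\<integral>x. f x - g x \<partial>M\<bar>"
    using int by simp
  also have "\<dots> \<le> (\<integral>x. \<bar>f x - g x\<bar> \<partial>M)" by (rule integral_abs_bound)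
  also have "\<dots> \<le> (\<integral>x. e + (B + C) * indicator {x. r < norm x} x \<partial>M)"
  proof (rule integral_mono)
    show "integrable M (\<lambda>x. e + (B + C) * indicator {x. r < norm x} x :: real)"
      using A by (simp add: integrable_indicator_iff M.emeasure_eq_measure)
    fix x
    show "\<bar>f x - g x\<bar> \<le> e + (B + C) * indicator {x. r < norm x} x"
    proof (cases "r < norm x")
      case True
      then show ?thesis using f(2)[of x] g(2)[of x] \<open>0 \<le> e\<close> by simp
    qed (use close[of x] in simp)
  qed (use int in simp)
  also have "\<dots> = e + (B + C) * measure M {x. r < norm x}"
    using A by (subst Bochner_Integration.integral_add)
      (auto simp: integrable_indicator_iff M.emeasure_eq_measure M.prob_space)
  finally show ?thesis .
qed

text \<open>Levy's continuity theorem with tightness as a hypothesis: \<open>f\<close> is replaced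
  by a trigonometric polynomial close to it on a large ball; outside that ball both are bounded and
  the laws have little mass.\<close>

lemma weak_convergence_char_fun:
  fixes M :: "nat \<Rightarrow> 'a::euclidean_space measure"
  assumes M: "\<And>n. prob_space (M n)" "\<And>n. sets (M n) = sets borel"
    and N: "prob_space N" "sets N = sets borel"
    and tight: "\<And>e. e > 0 \<Longrightarrow> \<exists>r. \<forall>\<^sub>F n in sequentially. measure (M n) {x. r < norm x} \<le> e"
    and char: "\<And>t. (\<lambda>n. CLINT x|M n. iexp (t \<bullet> x)) \<longlonglongrightarrow> (CLINT x|N. iexp (t \<bullet> x))"
    and f: "continuous_on UNIV f" "bounded (range f)"
  shows "(\<lambda>n. \<integral>x. f x \<partial>M n) \<longlonglongrightarrow> (\<integral>x. (f x :: real) \<partial>N)"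
proof -
  have int: "integrable L (\<lambda>x. iexp (t \<bullet> x))" if "prob_space L" "sets L = sets borel" for L and t :: 'a
  proof -
    interpret L: prob_space L by fact
    have "(\<lambda>x. iexp (t \<bullet> x)) \<in> borel_measurable L"
      unfolding measurable_cong_sets[OF that(2) refl] by measurable
    then show ?thesis by (intro L.integrable_const_bound[where B = 1]) auto
  qed
  have cs: "integrable L (\<lambda>x. cos (t \<bullet> x)) \<and> integrable L (\<lambda>x. sin (t \<bullet> x)) \<and>
       (LINT x|L. cos (t \<bullet> x)) = Re (CLINT x|L. iexp (t \<bullet> x)) \<and>
       (LINT x|L. sin (t \<bullet> x)) = Im (CLINT x|L. iexp (t \<bullet> x))"
    if "prob_space L" "sets L = sets borel" for L and t :: 'a
    using integrable_Re[OF int[OF that, of t]] integrable_Im[OF int[OF that, of t]]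
      integral_Re[OF int[OF that, of t]] integral_Im[OF int[OF that, of t]]
    by (simp add: Re_exp Im_exp)
  have trig: "(\<forall>L. prob_space L \<longrightarrow> sets L = sets borel \<longrightarrow> integrable L g) \<and>
      (\<lambda>n. integral\<^sup>L (M n) g) \<longlonglongrightarrow> integral\<^sup>L N g" if "trig_poly g" for g :: "'a \<Rightarrow> real"
    using that
  proof (induction rule: trig_poly.induct)
    case (cos c t)
    have "(\<lambda>n. c * Re (CLINT x|M n. iexp (t \<bullet> x))) \<longlonglongrightarrow> c * Re (CLINT x|N. iexp (t \<bullet> x))"
      by (intro tendsto_intros char)
    then show ?case using cs cs[OF M] cs[OF N] by simp
  next
    case (sin c t)
    have "(\<lambda>n. c * Im (CLINT x|M n. iexp (t \<bullet> x))) \<longlonglongrightarrow> c * Im (CLINT x|N. iexp (t \<bullet> x))"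
      by (intro tendsto_intros char)
    then show ?case using cs cs[OF M] cs[OF N] by simp
  next
    case (add f g)
    then show ?case using M N by (simp add: tendsto_add)
  qed
  obtain B where B: "\<And>x. \<bar>f x\<bar> \<le> B" using f(2) by (auto simp: bounded_iff)
  have B0: "0 \<le> B" using B abs_ge_zero order_trans by blast
  show ?thesis
  proof (rule LIMSEQ_I)
    fix e :: real assume e: "e > 0"
    \<comment> \<open>Passing from \<open>f\<close> to \<open>g\<close> costs
      \<open>(2 * B + 2) * d\<close> under each of the two laws and the convergence for
      \<open>g\<close> another \<open>d\<close>; the total stays below
      \<open>4 * (2 * B + 3) * d\<close>. Capping \<open>d\<close> at 1 bounds \<open>B + d\<close>
      by \<open>B + 1\<close>.\<close>
    define d where "d = min 1 (e / (4 * (2 * B + 3)))"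
    have d: "0 < d" "d \<le> 1" using e B0 by (auto simp: d_def)
    have d4: "4 * ((2 * B + 3) * d) \<le> e"
    proof -
      have "d \<le> e / (4 * (2 * B + 3))" by (simp add: d_def)
      then show ?thesis using B0 by (simp add: pos_le_divide_eq mult_ac)
    qed
    obtain r1 where r1: "\<forall>\<^sub>F n in sequentially. measure (M n) {x. r1 < norm x} \<le> d"
      using tight d by blast
    obtain r2 where r2: "measure N {x. r2 < norm x} \<le> d"
      using borel_measure_tight[OF N] d by metis
    define r where "r = max r1 r2"
    have mono: "measure L {x. r < norm x} \<le> measure L {x. s < norm x}"
      if "prob_space L" "sets L = sets borel" "s \<le> r" for L :: "'a measure" and s
    proof -
      interpret L: prob_space L by fact
      have "{x. s < norm x} \<in> sets L" unfolding that(2) by measurable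
      then show ?thesis using that(3) by (intro L.finite_measure_mono) auto
    qed
    obtain g where g: "trig_poly g" "\<And>x. norm x \<le> r \<Longrightarrow> \<bar>f x - g x\<bar> \<le> d" "\<And>x. \<bar>g x\<bar> \<le> B + d"
      using trig_poly_dense[OF compact_cball[of 0 r] f(1) B d(1)] by auto
    have close: "\<bar>integral\<^sup>L L f - integral\<^sup>L L g\<bar> \<le> (2 * B + 2) * d"
      if "prob_space L" "sets L = sets borel" "measure L {x. r < norm x} \<le> d" for L
    proof -
      have "\<bar>integral\<^sup>L L f - integral\<^sup>L L g\<bar> \<le> d + (B + (B + d)) * measure L {x. r < norm x}"
        using that(1,2) d g trig_poly_continuous[OF g(1)] f B by (intro abs_integral_diff_le) auto
      also have "\<dots> \<le> d + (2 * B + 1) * d"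
        using that(3) B0 d by (intro add_left_mono mult_mono) auto
      finally show ?thesis by (simp add: algebra_simps)
    qed
    have "\<forall>\<^sub>F n in sequentially. \<bar>integral\<^sup>L (M n) g - integral\<^sup>L N g\<bar> < d"
      using trig[OF g(1)] d(1) by (auto simp: tendsto_iff dist_real_def)
    with r1 have "\<forall>\<^sub>F n in sequentially. norm (integral\<^sup>L (M n) f - integral\<^sup>L N f) < e"
    proof eventually_elim
      case (elim n)
      have "\<bar>integral\<^sup>L (M n) f - integral\<^sup>L (M n) g\<bar> \<le> (2 * B + 2) * d"
        using mono[OF M(1,2), of r1 n] elim(1) by (intro close M) (auto simp: r_def)
      moreover have "\<bar>integral\<^sup>L N f - integral\<^sup>L N g\<bar> \<le> (2 * B + 2) * d"
        using mono[OF N, of r2] r2 by (intro close N) (auto simp: r_def)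
      moreover have "0 < (2 * B + 3) * d" using d B0 by simp
      ultimately show ?case using elim(2) d4 by (simp add: algebra_simps)
    qed
    then show "\<exists>no. \<forall>n\<ge>no. norm (integral\<^sup>L (M n) f - integral\<^sup>L N f) < e"
      by (simp add: eventually_at_top_linorder)
  qed
qed

section \<open>Central limit theorem for degree functionals of sparse graphs\<close>

text \<open>The bound is uniform in \<open>m\<close> and \<open>p\<close>. The growth hypothesis on
  \<open>P\<close> alone yields all moments used below: the bases 2, 4 and 8 belong to expressions
  of first, second and third order in \<open>P\<close>.\<close>

lemma abs_binexp_le_power:
  assumes "0 \<le> p" "p \<le> 1" "1 \<le> z" "real m * p \<le> c" "\<And>x. \<bar>g x\<bar> \<le> M * z ^ x"
  shows "\<bar>binexp m p g\<bar> \<le> M * exp ((z - 1) * c)"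
proof -
  have M: "0 \<le> M" using assms(5)[of 0] by simp
  have "\<bar>binexp m p g\<bar> \<le> binexp m p (\<lambda>x. \<bar>g x\<bar>)" using assms by (intro abs_binexp_le) auto
  also have "\<dots> \<le> binexp m p (\<lambda>x. M * z ^ x)" using assms by (intro binexp_mono) auto
  also have "\<dots> \<le> M * exp ((z - 1) * c)"
    unfolding binexp_cmult using assms M by (intro mult_left_mono binexp_power_base_le) auto
  finally show ?thesis .
qed

lemma two_power_square: "((2::real) ^ m)\<^sup>2 = 4 ^ m"
  by (simp add: power2_eq_square flip: power_mult_distrib)

text \<open>Given that \<open>e\<close> is present, the other \<open>card B - 1\<close> trials stay
  independent and the count shifts by one; this yields the correlation between the degree of a
  vertex and one of its edges.\<close>

lemma bexp_card_mem:
  assumes "finite B" "e \<in> B"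
  shows "bexp p B (\<lambda>T. g (card T) * of_bool (e \<in> T)) = p * binexp (card B - 1) p (\<lambda>x. g (Suc x))"
proof -
  have "bexp p (B - {e}) (\<lambda>T. g (card (insert e T)) * of_bool (e \<in> insert e T)) = bexp p (B - {e}) (\<lambda>T. g (Suc (card T)))"
  proof (intro bexp_cong refl)
    fix T assume "T \<subseteq> B - {e}"
    then have "finite T" "e \<notin> T" using assms finite_subset by (auto dest: finite_subset)
    then show "g (card (insert e T)) * of_bool (e \<in> insert e T) = g (Suc (card T))" by simp
  qed
  moreover have "bexp p (B - {e}) (\<lambda>T. g (card T) * of_bool (e \<in> T)) = bexp p (B - {e}) (\<lambda>T. 0)"
    by (intro bexp_cong refl) auto
  ultimately show ?thesis
    using assms bexp_card[of "B - {e}" p "\<lambda>x. g (Suc x)"] by (subst bexp_remove[of B e]) auto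
qed

lemma edges_remove_vertex:
  assumes "v \<in> V"
  shows "edges V = edges (V - {v}) \<union> {e \<in> edges V. v \<in> e}"
  using assms by (auto simp: edges_def)

text \<open>Each neighbour of \<open>v\<close> gains one degree and no other vertex of
  \<open>V - {v}\<close> is affected. In this form the increments depend on the graph without
  \<open>v\<close>, and \<open>T\<close> enters through its size and the indicators.\<close>

lemma degsum_remove_vertex:
  assumes "finite V" "v \<in> V" "S \<subseteq> edges (V - {v})" "T \<subseteq> {e \<in> edges V. v \<in> e}"
  shows "degsum P V (S \<union> T) = degsum P (V - {v}) S + (P (card T) +
    (\<Sum>u\<in>V - {v}. of_bool ({v, u} \<in> T) * (P (Suc (deg S u)) - P (deg S u))))"
proof -
  have "{e \<in> S \<union> T. v \<in> e} = T" using assms by (auto simp: edges_def)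
  then have dv: "deg (S \<union> T) v = card T" by (simp add: deg_def)
  have fin: "finite S" "finite T"
    using assms finite_subset[OF assms(3)] finite_subset[OF assms(4)] by auto
  have du: "P (deg (S \<union> T) u) = P (deg S u) + of_bool ({v, u} \<in> T) * (P (Suc (deg S u)) - P (deg S u))"
    if u: "u \<in> V - {v}" for u
  proof -
    have "{e \<in> T. u \<in> e} = (if {v, u} \<in> T then {{v, u}} else {})"
    proof -
      have eq: "e = {v, u}" if "e \<in> T" "u \<in> e" for e
      proof -
        have "card e = 2" "v \<in> e" using assms(4) that(1) by (auto simp: edges_def)
        then show ?thesis
          using card_subset_eq[of e "{v, u}"] u that(2) card_ge_0_finite[of e] by auto
      qed
      show ?thesis
      proof (rule set_eqI)
        fix e
        show "e \<in> {e \<in> T. u \<in> e} \<longleftrightarrow> e \<in> (if {v, u} \<in> T then {{v, u}} else {})"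
          using eq[of e] by (cases "e = {v, u}") auto
      qed
    qed
    then have "{e \<in> S \<union> T. u \<in> e} = {e \<in> S. u \<in> e} \<union> (if {v, u} \<in> T then {{v, u}} else {})"
      by blast
    moreover have "{v, u} \<notin> S" using assms(3) by (auto simp: edges_def)
    ultimately have "deg (S \<union> T) u = deg S u + of_bool ({v, u} \<in> T)"
      using fin by (simp add: deg_def)
    then show ?thesis by simp
  qed
  show ?thesis
    unfolding degsum_def using assms(1,2) dv
    by (subst sum.remove[of V v]) (simp_all add: du sum.distrib del: sum_of_bool_mult_eq)
qed

lemma cmod_iexp_minus_1_le: "cmod (iexp x - 1) \<le> \<bar>x\<bar>"
  using iexp_approx1[of x 0] by simp

lemma cmod_iexp_minus_linear_le: "cmod (iexp x - (1 + \<i> * x)) \<le> x\<^sup>2 / 2"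
  using iexp_approx1[of x 1] by (simp add: power2_eq_square)

section \<open>Stein's identity at a single vertex\<close>

locale pointed_graph =
  fixes V :: "'a set" and v :: 'a and p c K :: real and P :: "nat \<Rightarrow> real"
  assumes V: "finite V" "v \<in> V" and p: "0 \<le> p" "p \<le> 1" and np: "real (card V) * p \<le> c"
    and P: "\<And>x. \<bar>P x\<bar> \<le> K * 2 ^ x"
begin

definition "n = card V"
definition "\<mu> = binexp (n - 1) p P"
definition "V\<^sub>0 = binexp (n - 1) p (\<lambda>x. (P x - \<mu>)\<^sup>2)"
text \<open>Shift of the mean of \<open>P\<close> at \<open>v\<close> once one edge at
  \<open>v\<close> is known to be present, which leaves \<open>n - 2\<close> free trials.\<close>

definition "\<kappa> = binexp (n - 2) p (\<lambda>x. P (Suc x)) - \<mu>"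
text \<open>Mean increment at a vertex other than \<open>v\<close> in the graph without
  \<open>v\<close>, where the degree has \<open>n - 2\<close> trials.\<close>

definition "\<delta> = binexp (n - 2) p (\<lambda>x. P (Suc x) - P x)"
definition "rest = V - {v}"
definition "star = {e \<in> edges V. v \<in> e}"
definition "dP x = P (Suc x) - P x"
text \<open>
  With \<open>S\<close> the edges avoiding \<open>v\<close> and \<open>T\<close> those at \<open>v\<close>, this is the change of the degree functional when
  \<open>v\<close> is added back to the graph.
\<close>

definition "loc S T = P (card T) + (\<Sum>u\<in>rest. of_bool ({v, u} \<in> T) * dP (deg S u))"

lemma n_pred_p: "real (n - i) * p \<le> c"
proof -
  have "real (n - i) * p \<le> real n * p" using p by (intro mult_right_mono) auto
  then show ?thesis using np by (simp add: n_def)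
qed

lemma c_nonneg: "0 \<le> c"
  using n_pred_p[of n] by simp

lemma K_nonneg: "0 \<le> K" using P[of 0] by simp

lemma finites: "finite rest" "finite star" "finite (edges rest)"
  using V by (auto simp: rest_def star_def)

lemma cards: "card rest = n - 1" "card star = n - 1"
  using V by (auto simp: rest_def star_def n_def card_star)

lemma diff_two: "m - Suc 0 - Suc 0 = m - 2" "m - Suc (Suc 0) = m - 2"
  by auto

lemma star_mem: "u \<in> rest \<Longrightarrow> {v, u} \<in> star"
  using V by (auto simp: rest_def star_def edges_def card_2_iff)

lemma dP_bound: "\<bar>dP x\<bar> \<le> 3 * K * 2 ^ x"
  using P[of x] P[of "Suc x"] by (simp add: dP_def)

lemma dP_square: "(dP x)\<^sup>2 \<le> 9 * K\<^sup>2 * 4 ^ x"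
proof -
  have "\<bar>dP x\<bar>\<^sup>2 \<le> (3 * K * 2 ^ x)\<^sup>2" using dP_bound by (intro power_mono) auto
  then show ?thesis by (simp add: power_mult_distrib two_power_square)
qed

lemma mu_bound: "\<bar>\<mu>\<bar> \<le> K * exp c"
  unfolding \<mu>_def using abs_binexp_le_power[OF p _ n_pred_p P, of 1] by simp

lemma centred_bound: "\<bar>P x - \<mu>\<bar> \<le> 2 * K * exp c * 2 ^ x"
proof -
  have 1: "1 \<le> exp c" "(1::real) \<le> 2 ^ x" using c_nonneg by auto
  have "K * 2 ^ x * 1 \<le> K * 2 ^ x * exp c" using 1 K_nonneg by (intro mult_left_mono) auto
  moreover have "K * exp c * 1 \<le> K * exp c * 2 ^ x" using 1 K_nonneg by (intro mult_left_mono) auto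
  ultimately show ?thesis using P[of x] mu_bound by (simp add: mult_ac)
qed

lemma V0_bound: "\<bar>V\<^sub>0\<bar> \<le> 4 * K\<^sup>2 * exp (5 * c)"
proof -
  have "\<bar>(P x - \<mu>)\<^sup>2\<bar> \<le> (4 * K\<^sup>2 * exp (2 * c)) * 4 ^ x" for x
  proof -
    have "\<bar>P x - \<mu>\<bar>\<^sup>2 \<le> (2 * K * exp c * 2 ^ x)\<^sup>2" using centred_bound by (intro power_mono) auto
    also have "(2 * K * exp c * 2 ^ x)\<^sup>2 = (4 * K\<^sup>2 * exp (2 * c)) * 4 ^ x"
      by (simp add: power_mult_distrib exp_double two_power_square)
    finally show ?thesis by simp
  qed
  then have "\<bar>V\<^sub>0\<bar> \<le> 4 * K\<^sup>2 * exp (2 * c) * exp ((4 - 1) * c)"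
    unfolding V\<^sub>0_def by (intro abs_binexp_le_power[OF p _ n_pred_p]) auto
  moreover have "exp (2 * c) * exp ((4 - 1) * c) = exp (5 * c)" by (simp flip: exp_add)
  ultimately show ?thesis by (simp add: mult.assoc)
qed

lemma kappa_bound: "\<bar>\<kappa>\<bar> \<le> 3 * K * exp c"
proof -
  have "\<bar>binexp (n - 2) p (\<lambda>x. P (Suc x))\<bar> \<le> 2 * K * exp ((2 - 1) * c)"
    by (intro abs_binexp_le_power[OF p _ n_pred_p]) (use P[of "Suc _"] in \<open>auto simp: mult_ac\<close>)
  with mu_bound show ?thesis by (simp add: \<kappa>_def)
qed

lemma delta_bound: "\<bar>\<delta>\<bar> \<le> 3 * K * exp c"
  unfolding \<delta>_def dP_def[symmetric]
  using abs_binexp_le_power[OF p _ n_pred_p dP_bound, of 2] by simp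

lemma bexp_split: "bexp p (edges V) f = bexp p (edges rest) (\<lambda>S. bexp p star (\<lambda>T. f (S \<union> T)))"
proof -
  have "edges rest \<inter> star = {}" by (auto simp: rest_def star_def edges_def)
  moreover have "edges V = edges rest \<union> star"
    using edges_remove_vertex[OF V(2)] by (simp add: rest_def star_def)
  ultimately show ?thesis using finites by (simp add: bexp_union)
qed

lemma degsum_split:
  "S \<subseteq> edges rest \<Longrightarrow> T \<subseteq> star \<Longrightarrow> degsum P V (S \<union> T) = degsum P rest S + loc S T"
  unfolding rest_def star_def loc_def dP_def by (rule degsum_remove_vertex[OF V])

lemma deg_split: "S \<subseteq> edges rest \<Longrightarrow> T \<subseteq> star \<Longrightarrow> deg (S \<union> T) v = card T"
proof -
  assume "S \<subseteq> edges rest" "T \<subseteq> star"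
  then have "{e \<in> S \<union> T. v \<in> e} = T" by (auto simp: edges_def rest_def star_def)
  then show ?thesis by (simp add: deg_def)
qed

lemma bexp_centred: "bexp p star (\<lambda>T. P (card T) - \<mu>) = 0"
  using bexp_card[OF finites(2), of p "\<lambda>x. P x - \<mu>"] by (simp add: cards binexp_diff \<mu>_def)

text \<open>Origin of \<open>degree_var\<close>. The vertex \<open>v\<close> contributes its own
  variance; a vertex \<open>u\<close> contributes through the edge \<open>{v, u}\<close>, whose
  covariance with \<open>P (card T)\<close> is \<open>p * \<kappa>\<close>. The increments are not
  averaged yet, since \<open>S\<close> is fixed here.\<close>

lemma bexp_centred_loc:
  "bexp p star (\<lambda>T. (P (card T) - \<mu>) * loc S T) = V\<^sub>0 + p * \<kappa> * (\<Sum>u\<in>rest. dP (deg S u))"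
proof -
  have "bexp p star (\<lambda>T. (P (card T) - \<mu>) * loc S T) =
     bexp p star (\<lambda>T. (P (card T) - \<mu>)\<^sup>2 + \<mu> * (P (card T) - \<mu>)
      + (\<Sum>u\<in>rest. (P (card T) - \<mu>) * of_bool ({v, u} \<in> T) * dP (deg S u)))"
    unfolding loc_def by (intro bexp_cong refl) (simp add: power2_eq_square algebra_simps sum_distrib_left sum_subtractf)
  also have "\<dots> = V\<^sub>0 + (\<Sum>u\<in>rest. p * \<kappa> * dP (deg S u))"
    unfolding bexp_add bexp_sum bexp_cmult bexp_centred bexp_multc
  proof -
    have "bexp p star (\<lambda>T. (P (card T) - \<mu>)\<^sup>2) = V\<^sub>0"
      using bexp_card[OF finites(2), of p "\<lambda>x. (P x - \<mu>)\<^sup>2"] by (simp add: cards V\<^sub>0_def)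
    moreover have "bexp p star (\<lambda>T. (P (card T) - \<mu>) * of_bool ({v, u} \<in> T)) = p * \<kappa>" if "u \<in> rest" for u
      using bexp_card_mem[OF finites(2) star_mem[OF that], of p "\<lambda>x. P x - \<mu>"]
      by (simp add: cards binexp_diff \<kappa>_def diff_two)
    ultimately show "bexp p star (\<lambda>T. (P (card T) - \<mu>)\<^sup>2) + \<mu> * 0 +
        (\<Sum>u\<in>rest. bexp p star (\<lambda>T. (P (card T) - \<mu>) * of_bool ({v, u} \<in> T)) * dP (deg S u)) =
        V\<^sub>0 + (\<Sum>u\<in>rest. p * \<kappa> * dP (deg S u))" by simp
  qed
  finally show ?thesis by (simp add: sum_distrib_left)
qed

lemma bexp_mem_star: "u \<in> rest \<Longrightarrow> bexp p star (\<lambda>T. of_bool ({v, u} \<in> T)) = p"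
  using bexp_card_mem[OF finites(2) star_mem, of u p "\<lambda>x. 1"] by simp

lemma bexp_abs_dP: "u \<in> rest \<Longrightarrow> bexp p (edges rest) (\<lambda>S. \<bar>dP (deg S u)\<bar>) \<le> 3 * K * exp c"
  using bexp_deg[OF finites(1), of u p "\<lambda>x. \<bar>dP x\<bar>"]
    abs_binexp_le_power[OF p _ n_pred_p, of 2 "\<lambda>x. \<bar>dP x\<bar>" "3 * K" 2] dP_bound
  by (simp add: cards diff_two)

lemma bexp_dP_square: "u \<in> rest \<Longrightarrow> bexp p (edges rest) (\<lambda>S. (dP (deg S u))\<^sup>2) \<le> 9 * K\<^sup>2 * exp (3 * c)"
  using bexp_deg[OF finites(1), of u p "\<lambda>x. (dP x)\<^sup>2"]
    abs_binexp_le_power[OF p _ n_pred_p, of 4 "\<lambda>x. (dP x)\<^sup>2" "9 * K\<^sup>2" 2] dP_square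
  by (simp add: cards diff_two)

lemma bexp_abs_loc:
  "bexp p (edges rest) (\<lambda>S. bexp p star (\<lambda>T. \<bar>loc S T\<bar>)) \<le> K * exp c + 3 * K * exp c * c"
proof -
  have "bexp p (edges rest) (\<lambda>S. bexp p star (\<lambda>T. \<bar>loc S T\<bar>)) \<le>
     bexp p (edges rest) (\<lambda>S. bexp p star (\<lambda>T. \<bar>P (card T)\<bar> + (\<Sum>u\<in>rest. of_bool ({v, u} \<in> T) * \<bar>dP (deg S u)\<bar>)))"
  proof (intro bexp_mono p)
    fix S T
    have "\<bar>\<Sum>u\<in>rest. of_bool ({v, u} \<in> T) * dP (deg S u)\<bar> \<le> (\<Sum>u\<in>rest. of_bool ({v, u} \<in> T) * \<bar>dP (deg S u)\<bar>)"
      by (intro order.trans[OF sum_abs] sum_mono) (simp add: abs_mult)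
    then show "\<bar>loc S T\<bar> \<le> \<bar>P (card T)\<bar> + (\<Sum>u\<in>rest. of_bool ({v, u} \<in> T) * \<bar>dP (deg S u)\<bar>)"
      unfolding loc_def by linarith
  qed
  also have "\<dots> = binexp (n - 1) p (\<lambda>x. \<bar>P x\<bar>) + (\<Sum>u\<in>rest. p * bexp p (edges rest) (\<lambda>S. \<bar>dP (deg S u)\<bar>))"
    using bexp_card[OF finites(2), of p "\<lambda>x. \<bar>P x\<bar>"] finites
    by (simp add: bexp_add bexp_sum bexp_multc bexp_mem_star bexp_cmult cards del: sum_of_bool_mult_eq)
  also have "\<dots> \<le> K * exp c + (\<Sum>u\<in>rest. p * (3 * K * exp c))"
    using abs_binexp_le_power[OF p _ n_pred_p, of 2 "\<lambda>x. \<bar>P x\<bar>" K 1] P p bexp_abs_dP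
    by (intro add_mono sum_mono mult_left_mono) auto
  also have "(\<Sum>u\<in>rest. p * (3 * K * exp c)) = 3 * K * exp c * (real (n - 1) * p)"
    by (simp add: cards)
  also have "\<dots> \<le> 3 * K * exp c * c"
    using n_pred_p[of 1] K_nonneg by (intro mult_left_mono) auto
  finally show ?thesis by simp
qed

lemma square_le_4_power: "(real m)\<^sup>2 \<le> 4 ^ m"
proof -
  have "real m \<le> 2 ^ m" using less_exp[of m] by (metis less_imp_le of_nat_le_numeral_power_cancel_iff)
  then have "(real m)\<^sup>2 \<le> (2 ^ m)\<^sup>2" by (intro power_mono) auto
  then show ?thesis by (simp add: two_power_square)
qed

text \<open>\<open>T\<close> stays fixed because the bound is later averaged against a function of
  \<open>card T\<close>. Cauchy-Schwarz over the \<open>card T\<close> neighbours produces the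
  square of \<open>card T\<close>, which is absorbed into \<open>4 ^ card T\<close>; the constant 20
  is 2 from the vertex plus 18 from its neighbours.\<close>

lemma bexp_loc_square:
  assumes T: "T \<subseteq> star"
  shows "bexp p (edges rest) (\<lambda>S. (loc S T)\<^sup>2) \<le> 20 * K\<^sup>2 * exp (3 * c) * 4 ^ card T"
proof -
  define U where "U = {u \<in> rest. {v, u} \<in> T}"
  have U: "finite U" "U \<subseteq> rest" using finites by (auto simp: U_def)
  have "T = (\<lambda>u. {v, u}) ` U"
    using T star_eq_image[OF V(2)] by (auto simp: U_def star_def rest_def)
  then have cU: "card U = card T" by (simp add: card_image inj_on_doubleton)
  have "bexp p (edges rest) (\<lambda>S. (loc S T)\<^sup>2) \<le> bexp p (edges rest) (\<lambda>S. 2 * (P (card T))\<^sup>2 + 2 * (real (card T) * (\<Sum>u\<in>U. (dP (deg S u))\<^sup>2)))"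
  proof (intro bexp_mono p)
    fix S
    have "loc S T = P (card T) + (\<Sum>u\<in>U. dP (deg S u))"
      unfolding loc_def U_def using finites by (simp add: Int_def)
    then have "(loc S T)\<^sup>2 \<le> 2 * (P (card T))\<^sup>2 + 2 * (\<Sum>u\<in>U. dP (deg S u))\<^sup>2"
      using sum_squares_bound[of "P (card T)" "\<Sum>u\<in>U. dP (deg S u)"] by (simp add: power2_sum)
    also have "(\<Sum>u\<in>U. dP (deg S u))\<^sup>2 \<le> real (card U) * (\<Sum>u\<in>U. (dP (deg S u))\<^sup>2)"
      using Cauchy_Schwarz_ineq_sum[of "\<lambda>_. 1" "\<lambda>u. dP (deg S u)" U] by simp
    finally show "(loc S T)\<^sup>2 \<le> 2 * (P (card T))\<^sup>2 + 2 * (real (card T) * (\<Sum>u\<in>U. (dP (deg S u))\<^sup>2))"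
      by (simp add: cU)
  qed
  also have "\<dots> = 2 * (P (card T))\<^sup>2 + 2 * (real (card T) * (\<Sum>u\<in>U. bexp p (edges rest) (\<lambda>S. (dP (deg S u))\<^sup>2)))"
    using finites by (simp add: bexp_add bexp_cmult bexp_sum)
  also have "\<dots> \<le> 2 * (P (card T))\<^sup>2 + 2 * (real (card T) * (\<Sum>u\<in>U. 9 * K\<^sup>2 * exp (3 * c)))"
    using U bexp_dP_square by (intro add_left_mono mult_left_mono sum_mono) auto
  also have "\<dots> = 2 * (P (card T))\<^sup>2 + 18 * K\<^sup>2 * exp (3 * c) * (real (card T))\<^sup>2"
    by (simp add: cU power2_eq_square)
  also have "(P (card T))\<^sup>2 \<le> K\<^sup>2 * exp (3 * c) * 4 ^ card T"
  proof -
    have "\<bar>P (card T)\<bar>\<^sup>2 \<le> (K * 2 ^ card T)\<^sup>2" using P by (intro power_mono) auto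
    also have "\<dots> = K\<^sup>2 * 4 ^ card T * 1"
      by (simp add: power_mult_distrib two_power_square)
    also have "\<dots> \<le> K\<^sup>2 * 4 ^ card T * exp (3 * c)"
      using c_nonneg by (intro mult_left_mono) auto
    finally show ?thesis by (simp add: mult_ac)
  qed
  also have "18 * K\<^sup>2 * exp (3 * c) * (real (card T))\<^sup>2 \<le> 18 * K\<^sup>2 * exp (3 * c) * 4 ^ card T"
    using square_le_4_power by (intro mult_left_mono) auto
  finally show ?thesis by simp
qed

text \<open>Controls the second order remainder of the exponential. Averaging over \<open>S\<close>
  first leaves \<open>2 ^ x * 4 ^ x = 8 ^ x\<close> at \<open>x = card T\<close>, whose mean is at
  most \<open>exp (7 * c)\<close>; together with the factor \<open>exp (4 * c)\<close> this gives
  \<open>exp (11 * c)\<close>.\<close>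

lemma bexp_centred_loc_square:
  "bexp p (edges rest) (\<lambda>S. bexp p star (\<lambda>T. \<bar>P (card T) - \<mu>\<bar> * (loc S T)\<^sup>2)) \<le> 40 * K ^ 3 * exp (11 * c)"
proof -
  have "bexp p (edges rest) (\<lambda>S. bexp p star (\<lambda>T. \<bar>P (card T) - \<mu>\<bar> * (loc S T)\<^sup>2))
     = bexp p star (\<lambda>T. \<bar>P (card T) - \<mu>\<bar> * bexp p (edges rest) (\<lambda>S. (loc S T)\<^sup>2))"
    by (subst bexp_swap) (simp add: bexp_cmult)
  also have "\<dots> \<le> bexp p star (\<lambda>T. 2 * K * exp c * 2 ^ card T * (20 * K\<^sup>2 * exp (3 * c) * 4 ^ card T))"
    using centred_bound bexp_loc_square K_nonneg p by (intro bexp_mono mult_mono bexp_nonneg) auto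
  also have "\<dots> = bexp p star (\<lambda>T. 40 * K ^ 3 * exp (4 * c) * 8 ^ card T)"
  proof -
    have "(2::real) ^ m * 4 ^ m = 8 ^ m" for m by (simp flip: power_mult_distrib)
    moreover have "exp c * exp (3 * c) = exp (4 * c)" by (simp flip: exp_add)
    ultimately have "2 * K * exp c * 2 ^ m * (20 * K\<^sup>2 * exp (3 * c) * 4 ^ m) = 40 * K ^ 3 * exp (4 * c) * 8 ^ m" for m
      by (simp add: power2_eq_square power3_eq_cube) (metis mult.assoc mult.commute mult.left_commute)
    then show ?thesis by (simp only:)
  qed
  also have "\<dots> = binexp (n - 1) p (\<lambda>x. 40 * K ^ 3 * exp (4 * c) * 8 ^ x)"
    using bexp_card[OF finites(2), of p "\<lambda>x. 40 * K ^ 3 * exp (4 * c) * 8 ^ x"] by (simp add: cards)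
  also have "\<dots> \<le> 40 * K ^ 3 * exp (4 * c) * exp ((8 - 1) * c)"
    unfolding binexp_cmult using K_nonneg p n_pred_p
    by (intro mult_left_mono binexp_power_base_le) auto
  finally have "bexp p (edges rest) (\<lambda>S. bexp p star (\<lambda>T. \<bar>P (card T) - \<mu>\<bar> * (loc S T)\<^sup>2)) \<le>
    40 * K ^ 3 * exp (4 * c) * exp ((8 - 1) * c)" .
  moreover have "exp (4 * c) * exp ((8 - 1) * c) = exp (11 * c)" by (simp flip: exp_add)
  ultimately show ?thesis by (simp add: mult.assoc)
qed

text \<open>The sum of increments is itself a degree functional of the graph without
  \<open>v\<close>, so its deviation from the mean is of order \<open>sqrt n\<close>. The constant
  is \<open>162 = 2 * 9 ^ 2\<close>, where \<open>9 * K * 2 ^ x\<close> bounds the second difference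
  of \<open>P\<close>.\<close>

lemma bexp_dP_fluctuation:
  "bexp p (edges rest) (\<lambda>S. \<bar>(\<Sum>u\<in>rest. dP (deg S u)) - real (n - 1) * \<delta>\<bar>) \<le>
     sqrt (162 * real n * c * K\<^sup>2 * exp (3 * c))"
proof -
  let ?D = "\<lambda>S. (\<Sum>u\<in>rest. dP (deg S u)) - real (n - 1) * \<delta>"
  have d: "binexp (n - 1 - 1) p dP = \<delta>"
    by (simp add: \<delta>_def dP_def[abs_def] diff_two)
  have "n - 1 - 2 = n - 3" by simp
  then have "bexp p (edges rest) (\<lambda>S. (?D S)\<^sup>2) \<le>
     2 * (real (n - 1))\<^sup>2 * p * (1 - p) * binexp (n - 3) p (\<lambda>x. (dP (Suc x) - dP x)\<^sup>2)"
    using degsum_variance_le[OF finites(1) p, of dP] by (simp only: degsum_def cards d)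
  also have "\<dots> \<le> 2 * (real (n - 1))\<^sup>2 * p * (1 - p) * (81 * K\<^sup>2 * exp (3 * c))"
  proof (rule mult_left_mono)
    have "\<bar>(dP (Suc x) - dP x)\<^sup>2\<bar> \<le> 81 * K\<^sup>2 * 4 ^ x" for x
    proof -
      have "\<bar>dP (Suc x) - dP x\<bar> \<le> 9 * K * 2 ^ x" using dP_bound[of x] dP_bound[of "Suc x"] by simp
      then have "\<bar>dP (Suc x) - dP x\<bar>\<^sup>2 \<le> (9 * K * 2 ^ x)\<^sup>2" by (intro power_mono) auto
      then show ?thesis by (simp add: power_mult_distrib two_power_square)
    qed
    then show "binexp (n - 3) p (\<lambda>x. (dP (Suc x) - dP x)\<^sup>2) \<le> 81 * K\<^sup>2 * exp (3 * c)"
      using abs_binexp_le_power[OF p _ n_pred_p, of 4 "\<lambda>x. (dP (Suc x) - dP x)\<^sup>2" "81 * K\<^sup>2" 3] by simp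
  qed (use p in auto)
  also have "\<dots> \<le> 2 * (real n * c) * (81 * K\<^sup>2 * exp (3 * c))"
  proof (rule mult_right_mono)
    have "(real (n - 1))\<^sup>2 * p * (1 - p) \<le> (real (n - 1))\<^sup>2 * p * 1"
      using p by (intro mult_left_mono) auto
    also have "\<dots> = real (n - 1) * (real (n - 1) * p)" by (simp add: power2_eq_square)
    also have "\<dots> \<le> real n * c" using n_pred_p[of 1] p by (intro mult_mono) auto
    finally show "2 * (real (n - 1))\<^sup>2 * p * (1 - p) \<le> 2 * (real n * c)" by simp
  qed auto
  finally have "bexp p (edges rest) (\<lambda>S. (?D S)\<^sup>2) \<le> 162 * real n * c * K\<^sup>2 * exp (3 * c)" by simp
  then show ?thesis
    using bexp_abs_le_sqrt[OF p finites(3), of ?D] real_sqrt_le_mono order.trans by blast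
qed

text \<open>The three errors are, in this order, the Taylor remainder in the contribution of
  \<open>v\<close>, the replacement of the random covariance by its mean \<open>\<sigma>\<close>,
  and the return from the graph without \<open>v\<close> to the full graph.\<close>

lemma stein_vertex_aux:
  fixes b l :: real
  defines "\<sigma> \<equiv> V\<^sub>0 + real (n - 1) * p * \<kappa> * \<delta>"
  shows "cmod (bexp p (edges V) (\<lambda>S. (P (deg S v) - \<mu>) * iexp (l * (degsum P V S - b)))
      - \<i> * l * \<sigma> * bexp p (edges V) (\<lambda>S. iexp (l * (degsum P V S - b)))) \<le>
    l\<^sup>2 * (20 * K ^ 3 * exp (11 * c))
    + \<bar>l\<bar> * p * \<bar>\<kappa>\<bar> * sqrt (162 * real n * c * K\<^sup>2 * exp (3 * c))
    + l\<^sup>2 * \<bar>\<sigma>\<bar> * (K * exp c + 3 * K * exp c * c)"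
proof -
  define E where "E f = bexp p (edges rest) f" for f :: "'a set set \<Rightarrow> complex"
  define X where "X S = l * (degsum P rest S - b)" for S
  define h where "h T = P (card T) - \<mu>" for T :: "'a set set"
  define D where "D S = (\<Sum>u\<in>rest. dP (deg S u))" for S
  define A where "A = bexp p (edges V) (\<lambda>S. (P (deg S v) - \<mu>) * iexp (l * (degsum P V S - b)))"
  define B where "B = bexp p (edges V) (\<lambda>S. iexp (l * (degsum P V S - b)))"
  have split: "iexp (l * (degsum P V (S \<union> T) - b)) = iexp (X S) * iexp (l * loc S T)"
    if "S \<subseteq> edges rest" "T \<subseteq> star" for S T
  proof -
    have "l * (degsum P V (S \<union> T) - b) = X S + l * loc S T"
      using degsum_split[OF that] by (simp add: X_def algebra_simps)
    then show ?thesis by (simp add: distrib_left exp_add)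
  qed
  have A: "A = E (\<lambda>S. bexp p star (\<lambda>T. of_real (h T) * (iexp (X S) * iexp (l * loc S T))))"
    unfolding A_def bexp_split E_def
    by (intro bexp_cong refl) (simp only: split deg_split h_def of_real_diff)
  have B: "B = E (\<lambda>S. bexp p star (\<lambda>T. iexp (X S) * iexp (l * loc S T)))"
    unfolding B_def bexp_split E_def
    by (intro bexp_cong refl) (simp only: split)
  \<comment> \<open>\<open>A1\<close> linearises the exponential of the change caused by
    \<open>v\<close>; \<open>A2\<close> moreover puts \<open>\<sigma>\<close> in place of the
    covariance, which depends on \<open>S\<close>.\<close>
  define A1 where "A1 = E (\<lambda>S. bexp p star (\<lambda>T. of_real (h T) * (iexp (X S) * (1 + \<i> * of_real (l * loc S T)))))"
  define A2 where "A2 = E (\<lambda>S. \<i> * l * \<sigma> * iexp (X S))"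
  have 1: "cmod (A - A1) \<le> l\<^sup>2 * (20 * K ^ 3 * exp (11 * c))"
  proof -
    have eq: "A - A1 = E (\<lambda>S. bexp p star (\<lambda>T. of_real (h T) * (iexp (X S) * (iexp (l * loc S T) - (1 + \<i> * of_real (l * loc S T))))))"
      unfolding A A1_def E_def by (simp add: bexp_diff[symmetric] algebra_simps)
    have "cmod (A - A1) \<le> bexp p (edges rest) (\<lambda>S. bexp p star (\<lambda>T. l\<^sup>2 / 2 * (\<bar>h T\<bar> * (loc S T)\<^sup>2)))"
      unfolding eq unfolding E_def
    proof (intro order.trans[OF norm_bexp_le[OF p]] bexp_mono[OF p])
      fix S T
      have "cmod (of_real (h T) * (iexp (X S) * (iexp (l * loc S T) - (1 + \<i> * of_real (l * loc S T)))))
         = \<bar>h T\<bar> * cmod (iexp (l * loc S T) - (1 + \<i> * of_real (l * loc S T)))"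
        by (simp add: norm_mult del: of_real_mult)
      also have "\<dots> \<le> \<bar>h T\<bar> * ((l * loc S T)\<^sup>2 / 2)"
        by (intro mult_left_mono cmod_iexp_minus_linear_le) auto
      finally show "cmod (of_real (h T) * (iexp (X S) * (iexp (l * loc S T) - (1 + \<i> * of_real (l * loc S T)))))
         \<le> l\<^sup>2 / 2 * (\<bar>h T\<bar> * (loc S T)\<^sup>2)" by (simp add: power_mult_distrib mult_ac)
    qed
    also have "\<dots> = l\<^sup>2 / 2 * bexp p (edges rest) (\<lambda>S. bexp p star (\<lambda>T. \<bar>h T\<bar> * (loc S T)\<^sup>2))"
      by (simp only: bexp_cmult)
    also have "\<dots> \<le> l\<^sup>2 / 2 * (40 * K ^ 3 * exp (11 * c))"
      unfolding h_def by (intro mult_left_mono bexp_centred_loc_square) auto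
    finally show ?thesis by (simp add: mult_ac)
  qed
  have A1: "A1 = E (\<lambda>S. \<i> * l * of_real (V\<^sub>0 + p * \<kappa> * D S) * iexp (X S))"
    unfolding A1_def E_def
  proof (intro bexp_cong refl)
    fix S
    have "bexp p star (\<lambda>T. of_real (h T) * (iexp (X S) * (1 + \<i> * of_real (l * loc S T))))
      = bexp p star (\<lambda>T. iexp (X S) * of_real (h T) + iexp (X S) * \<i> * l * of_real (h T * loc S T))"
      by (intro bexp_cong refl) (simp add: algebra_simps)
    also have "\<dots> = iexp (X S) * of_real (bexp p star h) + iexp (X S) * \<i> * l * of_real (bexp p star (\<lambda>T. h T * loc S T))"
      by (simp only: bexp_add bexp_cmult bexp_of_real)
    \<comment> \<open>The zeroth order term vanishes: given the graph without \<open>v\<close>, the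
      summand at \<open>v\<close> is centred.\<close>
    also have "bexp p star h = 0" unfolding h_def by (rule bexp_centred)
    also have "bexp p star (\<lambda>T. h T * loc S T) = V\<^sub>0 + p * \<kappa> * D S"
      unfolding h_def D_def by (rule bexp_centred_loc)
    finally show "bexp p star (\<lambda>T. of_real (h T) * (iexp (X S) * (1 + \<i> * of_real (l * loc S T))))
      = \<i> * l * of_real (V\<^sub>0 + p * \<kappa> * D S) * iexp (X S)" by (simp add: mult_ac)
  qed
  have 2: "cmod (A1 - A2) \<le> \<bar>l\<bar> * p * \<bar>\<kappa>\<bar> * sqrt (162 * real n * c * K\<^sup>2 * exp (3 * c))"
  proof -
    have eq: "A1 - A2 = E (\<lambda>S. \<i> * of_real (l * (p * \<kappa> * (D S - real (n - 1) * \<delta>))) * iexp (X S))"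
      unfolding A1 A2_def E_def \<sigma>_def by (simp add: bexp_diff[symmetric] algebra_simps)
    have "cmod (A1 - A2) \<le> bexp p (edges rest) (\<lambda>S. \<bar>l\<bar> * p * \<bar>\<kappa>\<bar> * \<bar>D S - real (n - 1) * \<delta>\<bar>)"
      unfolding eq unfolding E_def using p
      by (intro order.trans[OF norm_bexp_le[OF p]] bexp_mono[OF p]) (simp add: norm_mult abs_mult del: of_real_mult)
    also have "\<dots> \<le> \<bar>l\<bar> * p * \<bar>\<kappa>\<bar> * sqrt (162 * real n * c * K\<^sup>2 * exp (3 * c))"
      unfolding bexp_cmult D_def using p by (intro mult_left_mono bexp_dP_fluctuation) auto
    finally show ?thesis .
  qed
  have 3: "cmod (A2 - \<i> * l * \<sigma> * B) \<le> l\<^sup>2 * \<bar>\<sigma>\<bar> * (K * exp c + 3 * K * exp c * c)"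
  proof -
    have eq: "B - E (\<lambda>S. iexp (X S)) = E (\<lambda>S. bexp p star (\<lambda>T. iexp (X S) * (iexp (l * loc S T) - 1)))"
    proof -
      have "E (\<lambda>S. iexp (X S)) = E (\<lambda>S. bexp p star (\<lambda>T. iexp (X S)))"
        using finites by simp
      then show ?thesis unfolding B E_def by (simp add: bexp_diff[symmetric] algebra_simps)
    qed
    have "cmod (B - E (\<lambda>S. iexp (X S))) \<le> bexp p (edges rest) (\<lambda>S. bexp p star (\<lambda>T. \<bar>l\<bar> * \<bar>loc S T\<bar>))"
      unfolding eq unfolding E_def
    proof (intro order.trans[OF norm_bexp_le[OF p]] bexp_mono[OF p])
      fix S T
      show "cmod (iexp (X S) * (iexp (l * loc S T) - 1)) \<le> \<bar>l\<bar> * \<bar>loc S T\<bar>"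
        using cmod_iexp_minus_1_le[of "l * loc S T"] by (simp add: norm_mult abs_mult del: of_real_mult)
    qed
    also have "\<dots> = \<bar>l\<bar> * bexp p (edges rest) (\<lambda>S. bexp p star (\<lambda>T. \<bar>loc S T\<bar>))"
      by (simp only: bexp_cmult)
    also have "\<dots> \<le> \<bar>l\<bar> * (K * exp c + 3 * K * exp c * c)"
      by (intro mult_left_mono bexp_abs_loc) auto
    finally have "cmod (B - E (\<lambda>S. iexp (X S))) \<le> \<bar>l\<bar> * (K * exp c + 3 * K * exp c * c)" .
    then have "\<bar>l\<bar> * \<bar>\<sigma>\<bar> * cmod (B - E (\<lambda>S. iexp (X S))) \<le> \<bar>l\<bar> * \<bar>\<sigma>\<bar> * (\<bar>l\<bar> * (K * exp c + 3 * K * exp c * c))"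
      by (intro mult_left_mono) auto
    moreover have "cmod (A2 - \<i> * l * \<sigma> * B) = \<bar>l\<bar> * \<bar>\<sigma>\<bar> * cmod (B - E (\<lambda>S. iexp (X S)))"
    proof -
      have "A2 - \<i> * l * \<sigma> * B = - (\<i> * l * \<sigma> * (B - E (\<lambda>S. iexp (X S))))"
        unfolding A2_def E_def bexp_cmult by (simp add: algebra_simps)
      then show ?thesis by (simp add: norm_mult)
    qed
    moreover have "l\<^sup>2 = \<bar>l\<bar> * \<bar>l\<bar>" by (simp add: power2_eq_square)
    ultimately show ?thesis by (simp only: mult_ac)
  qed
  have "A - \<i> * l * \<sigma> * B = (A - A1) + (A1 - A2) + (A2 - \<i> * l * \<sigma> * B)" by simp
  then have "cmod (A - \<i> * l * \<sigma> * B) \<le> cmod (A - A1) + cmod (A1 - A2) + cmod (A2 - \<i> * l * \<sigma> * B)"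
    by (metis norm_triangle_ineq norm_add_rule_thm norm_triangle_mono order_refl)
  with 1 2 3 show ?thesis unfolding A_def B_def by linarith
qed

lemma sigma_bound:
  "\<bar>V\<^sub>0 + real (n - 1) * p * \<kappa> * \<delta>\<bar> \<le> 4 * K\<^sup>2 * exp (5 * c) + 9 * K\<^sup>2 * exp (2 * c) * c"
proof -
  have "\<bar>real (n - 1) * p * \<kappa> * \<delta>\<bar> = (real (n - 1) * p) * (\<bar>\<kappa>\<bar> * \<bar>\<delta>\<bar>)"
    using p by (simp add: abs_mult)
  also have "\<dots> \<le> c * ((3 * K * exp c) * (3 * K * exp c))"
    using n_pred_p[of 1] kappa_bound delta_bound c_nonneg K_nonneg by (intro mult_mono) auto
  also have "\<dots> = 9 * K\<^sup>2 * exp (2 * c) * c"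
    by (simp add: power2_eq_square exp_double)
  finally show ?thesis using V0_bound by linarith
qed

end

text \<open>One summand for each error of \<open>stein_vertex_aux\<close>, after inserting the
  bounds for \<open>\<kappa>\<close> and \<open>\<sigma>\<close>; what matters is that neither
  \<open>n\<close> nor \<open>p\<close> occurs.\<close>

definition stein_const :: "real \<Rightarrow> real \<Rightarrow> real" where
  "stein_const K c = 20 * K ^ 3 * exp (11 * c) + 3 * c * K * exp c * sqrt (162 * c * K\<^sup>2 * exp (3 * c))
    + (4 * K\<^sup>2 * exp (5 * c) + 9 * K\<^sup>2 * exp (2 * c) * c) * (K * exp c + 3 * K * exp c * c)"

text \<open>
  The first summand is the variance of \<open>P\<close> at a single vertex; the second one comes from pairs of
  vertices, whose degrees are correlated only through the possible edge between them.
\<close>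

definition degree_var :: "nat \<Rightarrow> real \<Rightarrow> (nat \<Rightarrow> real) \<Rightarrow> real" where
  "degree_var n p P = binexp (n - 1) p (\<lambda>x. (P x - binexp (n - 1) p P)\<^sup>2)
    + real (n - 1) * p * (binexp (n - 2) p (\<lambda>x. P (Suc x)) - binexp (n - 1) p P)
        * binexp (n - 2) p (\<lambda>x. P (Suc x) - P x)"

lemma stein_vertex:
  assumes "finite V" "v \<in> V" "0 \<le> p" "p \<le> 1" "real (card V) * p \<le> c" "\<And>x. \<bar>P x\<bar> \<le> K * 2 ^ x"
  shows "cmod (bexp p (edges V) (\<lambda>S. of_real (P (deg S v) - binexp (card V - 1) p P) * iexp (l * (degsum P V S - b)))
      - \<i> * l * degree_var (card V) p P * bexp p (edges V) (\<lambda>S. iexp (l * (degsum P V S - b))))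
    \<le> stein_const K c * (l\<^sup>2 + \<bar>l\<bar> / sqrt (card V))"
proof -
  interpret G: pointed_graph V v p c K P
    using assms by unfold_locales
  note defs = G.V\<^sub>0_def G.\<kappa>_def G.\<delta>_def G.\<mu>_def G.n_def
  note A = G.stein_vertex_aux[of l b, unfolded defs, folded degree_var_def]
  note s = G.sigma_bound[unfolded defs, folded degree_var_def]
  let ?n = "real (card V)" and ?k = "binexp (card V - 2) p (\<lambda>x. P (Suc x)) - binexp (card V - 1) p P"
  have K: "0 \<le> K" using assms(6)[of 0] by simp
  have n: "?n > 0" using assms by (auto simp: card_gt_0_iff)
  have c: "0 \<le> c" using order.trans[OF _ assms(5), of 0] assms(3) by simp
  have k: "\<bar>?k\<bar> \<le> 3 * K * exp c" by (rule G.kappa_bound[unfolded defs])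
  \<comment> \<open>This turns \<open>p * sqrt n\<close> in the fluctuation error into
    \<open>c / sqrt n\<close>, the origin of the term \<open>\<bar>l\<bar> / sqrt n\<close>.\<close>
  have pn: "p \<le> c / ?n" using assms(5) n by (simp add: field_simps)
  define r where "r = sqrt (162 * c * K\<^sup>2 * exp (3 * c))"
  have r: "0 \<le> r" by (simp add: r_def c)
  have "\<bar>l\<bar> * p * \<bar>?k\<bar> * sqrt (162 * ?n * c * K\<^sup>2 * exp (3 * c)) = \<bar>l\<bar> * (p * (\<bar>?k\<bar> * (sqrt ?n * r)))"
    by (simp add: r_def real_sqrt_mult[symmetric] mult_ac)
  also have "\<dots> \<le> \<bar>l\<bar> * (c / ?n * (3 * K * exp c * (sqrt ?n * r)))"
    by (rule mult_left_mono[OF mult_mono[OF pn mult_right_mono[OF k]]]) (use c n r in auto)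
  also have "\<dots> = 3 * c * K * exp c * r * (\<bar>l\<bar> / sqrt ?n)"
    using n by (simp add: field_simps)
  finally have 1: "\<bar>l\<bar> * p * \<bar>?k\<bar> * sqrt (162 * ?n * c * K\<^sup>2 * exp (3 * c)) \<le> 3 * c * K * exp c * r * (\<bar>l\<bar> / sqrt ?n)" .
  have 2: "l\<^sup>2 * \<bar>degree_var (card V) p P\<bar> * (K * exp c + 3 * K * exp c * c) \<le>
      l\<^sup>2 * (4 * K\<^sup>2 * exp (5 * c) + 9 * K\<^sup>2 * exp (2 * c) * c) * (K * exp c + 3 * K * exp c * c)"
    using s K c by (intro mult_right_mono mult_left_mono) auto
  define x where "x = 20 * K ^ 3 * exp (11 * c)"
  define y where "y = 3 * c * K * exp c * r"
  define z where "z = (4 * K\<^sup>2 * exp (5 * c) + 9 * K\<^sup>2 * exp (2 * c) * c) * (K * exp c + 3 * K * exp c * c)"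
  have xyz: "0 \<le> x" "0 \<le> y" "0 \<le> z" using K c r by (auto simp: x_def y_def z_def)
  have "l\<^sup>2 * x + y * (\<bar>l\<bar> / sqrt ?n) + l\<^sup>2 * z \<le> (x + y + z) * (l\<^sup>2 + \<bar>l\<bar> / sqrt ?n)"
  proof -
    define w where "w = \<bar>l\<bar> / sqrt ?n"
    have "0 \<le> (x + z) * w" "0 \<le> y * l\<^sup>2" using xyz by (auto simp: w_def)
    then show ?thesis unfolding w_def[symmetric] by (simp add: algebra_simps)
  qed
  moreover have "stein_const K c = x + y + z" by (simp add: stein_const_def x_def y_def z_def r_def)
  ultimately show ?thesis
    using A 1 2 unfolding x_def[symmetric] y_def[symmetric] z_def[symmetric] mult.assoc[of "l\<^sup>2"] z_def[symmetric] by simp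
qed

section \<open>The differential equation of the characteristic function\<close>

lemma stein_graph:
  assumes "finite V" "0 \<le> p" "p \<le> 1" "real (card V) * p \<le> c" "\<And>x. \<bar>P x\<bar> \<le> K * 2 ^ x"
  defines "b \<equiv> real (card V) * binexp (card V - 1) p P"
  shows "cmod (bexp p (edges V) (\<lambda>S. of_real (degsum P V S - b) * iexp (l * (degsum P V S - b)))
      - card V * (\<i> * l * degree_var (card V) p P * bexp p (edges V) (\<lambda>S. iexp (l * (degsum P V S - b)))))
    \<le> card V * (stein_const K c * (l\<^sup>2 + \<bar>l\<bar> / sqrt (card V)))"
proof -
  let ?F = "\<lambda>v. bexp p (edges V) (\<lambda>S. of_real (P (deg S v) - binexp (card V - 1) p P) * iexp (l * (degsum P V S - b)))"
  let ?G = "\<i> * l * degree_var (card V) p P * bexp p (edges V) (\<lambda>S. iexp (l * (degsum P V S - b)))"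
  have "bexp p (edges V) (\<lambda>S. of_real (degsum P V S - b) * iexp (l * (degsum P V S - b))) = (\<Sum>v\<in>V. ?F v)"
    unfolding bexp_sum[symmetric] sum_distrib_right[symmetric] of_real_sum[symmetric] sum_subtractf
    by (simp add: b_def degsum_def)
  then have "cmod (bexp p (edges V) (\<lambda>S. of_real (degsum P V S - b) * iexp (l * (degsum P V S - b))) - card V * ?G)
    = cmod (\<Sum>v\<in>V. ?F v - ?G)" by (simp add: sum_subtractf)
  also have "\<dots> \<le> (\<Sum>v\<in>V. stein_const K c * (l\<^sup>2 + \<bar>l\<bar> / sqrt (card V)))"
    using assms by (intro order.trans[OF norm_sum] sum_mono stein_vertex) auto
  finally show ?thesis by simp
qed

text \<open>Integrating factor: \<open>exp (\<sigma> * s ^ 2 / 2)\<close> times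
  \<open>\<psi>\<close> has a small derivative, and the mean value inequality compares it with its
  value 1 at 0. One factor \<open>exp (\<bar>\<sigma>\<bar> * t ^ 2 / 2)\<close> bounds the
  integrating factor, a second one undoes it; the absolute value covers either sign of
  \<open>\<sigma>\<close>.\<close>

lemma gaussian_ode_stability:
  fixes \<psi> :: "real \<Rightarrow> complex"
  assumes der: "\<And>s. (\<psi> has_vector_derivative \<psi>' s) (at s)" and "\<psi> 0 = 1"
    and bound: "\<And>s. \<bar>s\<bar> \<le> \<bar>t\<bar> \<Longrightarrow> cmod (\<psi>' s + complex_of_real (s * \<sigma>) * \<psi> s) \<le> e"
  shows "cmod (\<psi> t - complex_of_real (exp (- \<sigma> * t\<^sup>2 / 2))) \<le> exp (\<bar>\<sigma>\<bar> * t\<^sup>2) * e * \<bar>t\<bar>"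
proof -
  define g where "g s = exp (\<sigma> * s\<^sup>2 / 2) *\<^sub>R \<psi> s" for s
  define g' where "g' s = exp (\<sigma> * s\<^sup>2 / 2) *\<^sub>R (\<psi>' s + complex_of_real (s * \<sigma>) * \<psi> s)" for s
  have e: "0 \<le> e" by (rule order.trans[OF norm_ge_zero bound[of 0]]) simp
  have "(g has_vector_derivative g' s) (at s)" for s
  proof -
    have "((\<lambda>s. exp (\<sigma> * s\<^sup>2 / 2)) has_field_derivative exp (\<sigma> * s\<^sup>2 / 2) * (\<sigma> * s)) (at s)"
      by (auto intro!: derivative_eq_intros)
    from has_vector_derivative_scaleR[OF this der[of s]] show ?thesis
      unfolding g_def g'_def by (simp add: scaleR_conv_of_real algebra_simps)
  qed
  then have d: "(g has_derivative (\<lambda>h. h *\<^sub>R g' s)) (at s within S)" for s S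
    unfolding has_vector_derivative_def by (rule has_derivative_at_withinI)
  let ?a = "\<bar>\<sigma>\<bar> * t\<^sup>2 / 2"
  have "norm (g t - g 0) \<le> (exp ?a * e) * norm (t - 0)"
  proof (rule differentiable_bound[where S = "cball 0 \<bar>t\<bar>" and f' = "\<lambda>s h. h *\<^sub>R g' s"])
    fix s :: real assume "s \<in> cball 0 \<bar>t\<bar>"
    then have s: "\<bar>s\<bar> \<le> \<bar>t\<bar>" by simp
    have "s\<^sup>2 \<le> t\<^sup>2" using s by (simp add: abs_le_square_iff)
    then have "\<sigma> * s\<^sup>2 \<le> \<bar>\<sigma>\<bar> * t\<^sup>2" by (intro mult_mono) auto
    then have "norm (g' s) \<le> exp ?a * e"
      unfolding g'_def using bound[OF s] by (auto intro!: mult_mono)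
    then show "onorm (\<lambda>h. h *\<^sub>R g' s) \<le> exp ?a * e"
      by (simp add: onorm_scaleR_left[OF bounded_linear_ident] onorm_id)
  qed (use d in auto)
  then have gb: "norm (g t - g 0) \<le> (exp ?a * e) * \<bar>t\<bar>" by simp
  have "exp (- \<sigma> * t\<^sup>2 / 2) * norm (g t - g 0) \<le> exp ?a * ((exp ?a * e) * \<bar>t\<bar>)"
  proof (rule mult_mono)
    have "- \<sigma> * t\<^sup>2 \<le> \<bar>\<sigma>\<bar> * t\<^sup>2" by (intro mult_right_mono) auto
    then show "exp (- \<sigma> * t\<^sup>2 / 2) \<le> exp ?a" by simp
  qed (use e gb in auto)
  also have "exp ?a * ((exp ?a * e) * \<bar>t\<bar>) = exp (\<bar>\<sigma>\<bar> * t\<^sup>2) * e * \<bar>t\<bar>"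
    by (simp add: exp_add[symmetric] mult.assoc[symmetric])
  also have "exp (- \<sigma> * t\<^sup>2 / 2) * norm (g t - g 0) = cmod (\<psi> t - complex_of_real (exp (- \<sigma> * t\<^sup>2 / 2)))"
  proof -
    have "\<psi> t - complex_of_real (exp (- \<sigma> * t\<^sup>2 / 2)) = exp (- \<sigma> * t\<^sup>2 / 2) *\<^sub>R (g t - g 0)"
    proof -
      have "complex_of_real (exp (- \<sigma> * t\<^sup>2 / 2)) * complex_of_real (exp (\<sigma> * t\<^sup>2 / 2)) = 1"
        by (simp flip: of_real_mult exp_add)
      then show ?thesis
        using assms(2) unfolding g_def scaleR_conv_of_real right_diff_distrib mult.assoc[symmetric] by simp
    qed
    then show ?thesis by (simp only: norm_scaleR) simp
  qed
  finally show ?thesis .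
qed

lemma has_vector_derivative_bexp_iexp:
  assumes "finite A"
  shows "((\<lambda>t. bexp p A (\<lambda>S. iexp (t * X S))) has_vector_derivative bexp p A (\<lambda>S. \<i> * X S * iexp (t * X S))) (at t)"
proof -
  have "((\<lambda>t. iexp (t * x)) has_vector_derivative \<i> * x * iexp (t * x)) (at t)" for x
  proof -
    have "((\<lambda>t. t * x) has_vector_derivative x) (at t)"
      by (auto intro!: derivative_eq_intros simp: has_real_derivative_iff_has_vector_derivative[symmetric])
    from vector_diff_chain_at[OF this has_vector_derivative_iexp] show ?thesis
      by (simp add: o_def scaleR_conv_of_real mult_ac)
  qed
  then show ?thesis
    unfolding bexp_def
    by (intro has_vector_derivative_sum bounded_linear.has_vector_derivative[OF bounded_linear_scaleR_right])
qed

lemma degsum_char_bound: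
  assumes "finite V" "0 \<le> p" "p \<le> 1" "real (card V) * p \<le> c" "\<And>x. \<bar>P x\<bar> \<le> K * 2 ^ x" "V \<noteq> {}"
  defines "W \<equiv> \<lambda>S. (degsum P V S - real (card V) * binexp (card V - 1) p P) / sqrt (card V)"
  shows "cmod (bexp p (edges V) (\<lambda>S. iexp (t * W S)) - complex_of_real (exp (- degree_var (card V) p P * t\<^sup>2 / 2))) \<le>
    exp (\<bar>degree_var (card V) p P\<bar> * t\<^sup>2) * (stein_const K c * (t\<^sup>2 + \<bar>t\<bar>) / sqrt (card V)) * \<bar>t\<bar>"
proof (rule gaussian_ode_stability[where \<psi>' = "\<lambda>s. bexp p (edges V) (\<lambda>S. \<i> * W S * iexp (s * W S))"])
  show "((\<lambda>s. bexp p (edges V) (\<lambda>S. iexp (s * W S))) has_vector_derivative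
     bexp p (edges V) (\<lambda>S. \<i> * W S * iexp (s * W S))) (at s)" for s
    using assms by (intro has_vector_derivative_bexp_iexp) auto
  show "bexp p (edges V) (\<lambda>S. iexp (0 * W S)) = 1" using assms by simp
next
  fix s :: real assume s: "\<bar>s\<bar> \<le> \<bar>t\<bar>"
  define n where "n = card V"
  have n: "n > 0" using assms by (auto simp: n_def card_gt_0_iff)
  \<comment> \<open>The natural scale: \<open>n * l / sqrt n = s\<close> turns the Stein identity
    into the differential equation, while the error
    \<open>n * (l ^ 2 + \<bar>l\<bar> / sqrt n) / sqrt n\<close> equals
    \<open>(s ^ 2 + \<bar>s\<bar>) / sqrt n\<close>.\<close>
  define l where "l = s / sqrt n"
  define b where "b = real n * binexp (n - 1) p P"
  define v where "v = degree_var n p P"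
  define C where "C = stein_const K c"
  have l: "s * W S = l * (degsum P V S - b)" for S by (simp add: W_def l_def b_def n_def)
  let ?B = "bexp p (edges V) (\<lambda>S. iexp (l * (degsum P V S - b)))"
  let ?A = "bexp p (edges V) (\<lambda>S. of_real (degsum P V S - b) * iexp (l * (degsum P V S - b)))"
  have rt: "complex_of_real (sqrt n) * complex_of_real (sqrt n) = of_nat n"
    by (metis of_real_mult of_real_of_nat_eq real_sqrt_mult_self abs_of_nat)
  have "bexp p (edges V) (\<lambda>S. \<i> * W S * iexp (s * W S)) = \<i> / sqrt n * ?A"
    unfolding l bexp_cmult[symmetric] by (intro bexp_cong refl) (simp add: W_def b_def n_def)
  moreover have "\<i> / sqrt n * (real n * (\<i> * l * v * ?B)) = - (s * v * ?B)"
    using n rt by (simp add: l_def field_simps)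
  ultimately have "bexp p (edges V) (\<lambda>S. \<i> * W S * iexp (s * W S)) + s * v * bexp p (edges V) (\<lambda>S. iexp (s * W S))
      = \<i> / sqrt n * (?A - real n * (\<i> * l * v * ?B))"
    unfolding l right_diff_distrib by simp
  also have "cmod \<dots> \<le> 1 / sqrt n * (n * (C * (l\<^sup>2 + \<bar>l\<bar> / sqrt n)))"
    unfolding norm_mult b_def v_def n_def C_def using stein_graph[OF assms(1-5), of l]
    by (intro mult_mono) (auto simp: norm_divide)
  also have "\<dots> = C * (s\<^sup>2 + \<bar>s\<bar>) / sqrt n"
    using n by (simp add: l_def power_divide field_simps abs_divide)
  also have "\<dots> \<le> C * (t\<^sup>2 + \<bar>t\<bar>) / sqrt n"
  proof -
    have "0 \<le> c" using order.trans[OF _ assms(4), of 0] assms(2) by simp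
    moreover have "0 \<le> K" using assms(5)[of 0] by simp
    ultimately have "0 \<le> C" by (simp add: C_def stein_const_def)
    moreover have "s\<^sup>2 \<le> t\<^sup>2" using s by (simp add: abs_le_square_iff)
    ultimately show ?thesis using s by (intro divide_right_mono mult_left_mono add_mono) auto
  qed
  finally show "cmod (bexp p (edges V) (\<lambda>S. \<i> * W S * iexp (s * W S)) + complex_of_real (s * degree_var (card V) p P) * bexp p (edges V) (\<lambda>S. iexp (s * W S)))
     \<le> stein_const K c * (t\<^sup>2 + \<bar>t\<bar>) / sqrt (card V)"
    by (simp add: v_def n_def C_def)
qed

theorem degsum_clt:
  fixes p :: "nat \<Rightarrow> real"
  assumes p: "\<And>n. n \<ge> 1 \<Longrightarrow> 0 \<le> p n \<and> p n \<le> 1" and np: "(\<lambda>n. real n * p n) \<longlonglongrightarrow> c"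
    and P: "\<And>x. \<bar>P x\<bar> \<le> K * 2 ^ x"
    and var: "(\<lambda>n. degree_var n (p n) P) \<longlonglongrightarrow> \<sigma>"
  shows "(\<lambda>n. bexp (p n) (edges {1..n})
      (\<lambda>S. iexp (t * ((degsum P {1..n} S - real n * binexp (n - 1) (p n) P) / sqrt n))))
    \<longlonglongrightarrow> complex_of_real (exp (- \<sigma> * t\<^sup>2 / 2))"
proof -
  define v where "v n = degree_var n (p n) P" for n
  define f where "f n = bexp (p n) (edges {1..n})
      (\<lambda>S. iexp (t * ((degsum P {1..n} S - real n * binexp (n - 1) (p n) P) / sqrt n)))" for n
  \<comment> \<open>The bound \<open>n * p n \<le> c + 1\<close> holds eventually, whereas
    \<open>n * p n\<close> may exceed its limit \<open>c\<close>.\<close>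
  define C where "C = stein_const K (c + 1) * (t\<^sup>2 + \<bar>t\<bar>)"
  have vl: "v \<longlonglongrightarrow> \<sigma>" using var by (simp add: v_def[abs_def])
  have lim: "(\<lambda>n. exp (\<bar>v n\<bar> * t\<^sup>2) * (C / sqrt (real n)) * \<bar>t\<bar>) \<longlonglongrightarrow> exp (\<bar>\<sigma>\<bar> * t\<^sup>2) * 0 * \<bar>t\<bar>"
    by (intro tendsto_intros vl real_tendsto_divide_at_top[OF tendsto_const]
          filterlim_compose[OF sqrt_at_top filterlim_real_sequentially])
  have "\<forall>\<^sub>F n in sequentially. real n * p n < c + 1"
    using np by (rule order_tendstoD(2)) simp
  then have ev: "\<forall>\<^sub>F n in sequentially. norm (f n - complex_of_real (exp (- v n * t\<^sup>2 / 2))) \<le> exp (\<bar>v n\<bar> * t\<^sup>2) * (C / sqrt (real n)) * \<bar>t\<bar>"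
    using eventually_ge_at_top[of 1]
  proof eventually_elim
    case (elim n)
    then show ?case
      using degsum_char_bound[of "{1..n}" "p n" "c + 1" P K t] p[of n] P
      by (simp add: f_def v_def C_def)
  qed
  have "(\<lambda>n. f n - complex_of_real (exp (- v n * t\<^sup>2 / 2))) \<longlonglongrightarrow> 0"
    using Lim_null_comparison[OF ev] lim by simp
  moreover have "(\<lambda>n. complex_of_real (exp (- v n * t\<^sup>2 / 2))) \<longlonglongrightarrow> exp (- \<sigma> * t\<^sup>2 / 2)"
    by (intro tendsto_intros vl) auto
  ultimately show ?thesis
    unfolding f_def[symmetric] using tendsto_add[of "\<lambda>n. f n - complex_of_real (exp (- v n * t\<^sup>2 / 2))" 0] by force
qed

section \<open>Gaussian laws and the reduction to characteristic functions\<close>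

text \<open>The law of \<open>B\<close> applied to independent standard normal coordinates. Starting
  from a factor of the covariance matrix makes singular matrices no special case; each application
  has to supply such a factor.\<close>

lemma exists_multivariate_normal:
  fixes B :: "'k::finite \<Rightarrow> 'j \<Rightarrow> real"
  assumes J: "finite J"
  obtains N :: "(real ^ 'k) measure" where "multivariate_normal N 0 (\<chi> a b. \<Sum>j\<in>J. B a j * B b j)"
proof -
  interpret std: prob_space std_normal_distribution
    using prob_space_normal_density[of 1 0] by simp
  interpret P: product_prob_space "\<lambda>_. std_normal_distribution" J
    by unfold_locales
  let ?P = "PiM J (\<lambda>_. std_normal_distribution)"
  define X where "X = (\<lambda>\<omega>. (\<chi> a. \<Sum>j\<in>J. B a j * \<omega> j) :: real ^ 'k)"
  have X[measurable]: "X \<in> measurable ?P borel"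
  proof -
    have "(\<lambda>\<omega>. \<omega> j) \<in> borel_measurable ?P" if "j \<in> J" for j
    proof -
      have "(\<lambda>\<omega>. \<omega> j) \<in> measurable ?P std_normal_distribution" by (rule measurable_component_singleton[OF that])
      moreover have "sets std_normal_distribution = sets borel" by simp
      ultimately show ?thesis using measurable_cong_sets[OF refl, of std_normal_distribution borel ?P] by blast
    qed
    then have "(\<lambda>\<omega>. \<Sum>j\<in>J. B a j * \<omega> j) \<in> borel_measurable ?P" for a
      by (intro borel_measurable_sum borel_measurable_times) auto
    moreover have "X = (\<lambda>\<omega>. \<Sum>a\<in>UNIV. (\<Sum>j\<in>J. B a j * \<omega> j) *\<^sub>R axis a 1)"
      unfolding X_def by (auto simp: vec_eq_iff axis_def if_distrib cong: if_cong)
    ultimately show ?thesis by simp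
  qed
  define N where "N = distr ?P borel X"
  have "(CLINT x|N. iexp (t \<bullet> x)) =
     exp (\<i> * complex_of_real (t \<bullet> 0) - complex_of_real (t \<bullet> ((\<chi> a b. \<Sum>j\<in>J. B a j * B b j) *v t)) / 2)" for t :: "real ^ 'k"
  proof -
    define \<tau> where "\<tau> j = (\<Sum>a\<in>UNIV. t $ a * B a j)" for j
    have tX: "t \<bullet> X \<omega> = (\<Sum>j\<in>J. \<tau> j * \<omega> j)" for \<omega>
      unfolding X_def \<tau>_def inner_vec_def
      by (simp add: sum_distrib_left sum_distrib_right mult.assoc) (rule sum.swap)
    have "(CLINT x|N. iexp (t \<bullet> x)) = (CLINT \<omega>|?P. iexp (t \<bullet> X \<omega>))"
      unfolding N_def by (rule integral_distr) measurable
    also have "\<dots> = (CLINT \<omega>|?P. (\<Prod>j\<in>J. iexp (\<tau> j * \<omega> j)))"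
      using J by (simp add: tX exp_sum sum_distrib_left)
    also have "\<dots> = (\<Prod>j\<in>J. CLINT x|std_normal_distribution. iexp (\<tau> j * x))"
      by (intro P.product_integral_prod J std.integrable_const_bound[where B = 1]) auto
    also have "\<dots> = (\<Prod>j\<in>J. complex_of_real (exp (- (\<tau> j)\<^sup>2 / 2)))"
      using char_std_normal_distribution by (simp add: char_def fun_eq_iff)
    also have "\<dots> = complex_of_real (exp (- (\<Sum>j\<in>J. (\<tau> j)\<^sup>2) / 2))"
      using J by (simp add: exp_sum sum_negf[symmetric] sum_divide_distrib flip: of_real_prod)
    also have "(\<Sum>j\<in>J. (\<tau> j)\<^sup>2) = t \<bullet> ((\<chi> a b. \<Sum>j\<in>J. B a j * B b j) *v t)"
    proof -
      have "(\<Sum>j\<in>J. (\<tau> j)\<^sup>2) = (\<Sum>j\<in>J. \<Sum>a\<in>UNIV. \<Sum>b\<in>UNIV. t $ a * (B a j * B b j * t $ b))"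
        unfolding \<tau>_def power2_eq_square sum_product by (simp add: mult_ac)
      also have "\<dots> = (\<Sum>a\<in>UNIV. \<Sum>j\<in>J. \<Sum>b\<in>UNIV. t $ a * (B a j * B b j * t $ b))"
        by (rule sum.swap)
      also have "\<dots> = (\<Sum>a\<in>UNIV. \<Sum>b\<in>UNIV. \<Sum>j\<in>J. t $ a * (B a j * B b j * t $ b))"
        by (intro sum.cong refl sum.swap)
      finally show ?thesis
        unfolding inner_vec_def matrix_vector_mult_def by (simp add: sum_distrib_left sum_distrib_right)
    qed
    finally show ?thesis by (simp add: exp_of_real[symmetric])
  qed
  moreover have "prob_space N" unfolding N_def by (rule P.prob_space_distr) measurable
  moreover have "transpose (\<chi> a b. \<Sum>j\<in>J. B a j * B b j) = (\<chi> a b. \<Sum>j\<in>J. B a j * B b j)"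
    by (simp add: transpose_def vec_eq_iff mult.commute)
  ultimately have "multivariate_normal N 0 (\<chi> a b. \<Sum>j\<in>J. B a j * B b j)"
    by (simp add: multivariate_normal_def N_def)
  then show ?thesis by (rule that)
qed

lemma all_edges_eq: "all_edges n = edges {1..n}"
  by (simp add: all_edges_def edges_def)

text \<open>Bounded second moments give tightness through Markov's inequality, so the limits of the
  characteristic functions in every direction \<open>t\<close> suffice.\<close>

lemma weak_conv_vec_erdos_renyi:
  fixes X :: "nat \<Rightarrow> nat set set \<Rightarrow> real ^ 'k"
  assumes p: "\<And>n. n \<ge> 1 \<Longrightarrow> 0 \<le> p n \<and> p n \<le> 1"
    and N: "multivariate_normal N 0 \<Sigma>"
    and char: "\<And>t. (\<lambda>n. bexp (p n) (edges {1..n}) (\<lambda>S. iexp (t \<bullet> X n S)))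
      \<longlonglongrightarrow> complex_of_real (exp (- (t \<bullet> (\<Sigma> *v t)) / 2))"
    and moment: "\<And>a. \<exists>C. \<forall>\<^sub>F n in sequentially. bexp (p n) (edges {1..n}) (\<lambda>S. (X n S $ a)\<^sup>2) \<le> C"
  shows "weak_conv_vec (\<lambda>n. distr (erdos_renyi n (p n)) borel (X n)) N"
  unfolding weak_conv_vec_def
proof (intro allI impI)
  fix f :: "real ^ 'k \<Rightarrow> real"
  assume f: "continuous_on UNIV f" "bounded (range f)"
  let ?M = "\<lambda>n. distr (erdos_renyi n (p n)) borel (X n)"
  have ev: "\<forall>\<^sub>F n in sequentially. 0 \<le> p n \<and> p n \<le> 1"
    using eventually_ge_at_top[of 1] by eventually_elim (rule p)
  obtain C where C: "\<And>a. \<forall>\<^sub>F n in sequentially. bexp (p n) (edges {1..n}) (\<lambda>S. (X n S $ a)\<^sup>2) \<le> C a"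
    using moment unfolding choice_iff[symmetric] by meson
  define D where "D = 1 + (\<Sum>a\<in>UNIV. \<bar>C a\<bar>)"
  have D: "D > 0" by (simp add: D_def add_pos_nonneg sum_nonneg)
  have norm2: "\<forall>\<^sub>F n in sequentially. bexp (p n) (edges {1..n}) (\<lambda>S. (norm (X n S))\<^sup>2) \<le> D"
  proof -
    have "\<forall>\<^sub>F n in sequentially. \<forall>a. bexp (p n) (edges {1..n}) (\<lambda>S. (X n S $ a)\<^sup>2) \<le> C a"
      by (rule eventually_all_finite) (rule C)
    then show ?thesis
    proof eventually_elim
      case (elim n)
      have "bexp (p n) (edges {1..n}) (\<lambda>S. (norm (X n S))\<^sup>2) = (\<Sum>a\<in>UNIV. bexp (p n) (edges {1..n}) (\<lambda>S. (X n S $ a)\<^sup>2))"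
        unfolding bexp_sum[symmetric] power2_norm_eq_inner inner_vec_def by (simp add: power2_eq_square)
      also have "\<dots> \<le> (\<Sum>a\<in>UNIV. \<bar>C a\<bar>)"
        using elim by (intro sum_mono) (meson abs_ge_self order_trans)
      finally show ?case by (simp add: D_def)
    qed
  qed
  show "(\<lambda>n. \<integral>x. f x \<partial>?M n) \<longlonglongrightarrow> (\<integral>x. f x \<partial>N)"
  proof (rule weak_convergence_char_fun)
    show "prob_space (?M n)" for n
      by (intro prob_space.prob_space_distr measure_pmf.prob_space_axioms) simp
    show "prob_space N" "sets N = sets borel" using N by (auto simp: multivariate_normal_def)
    show "(\<lambda>n. CLINT x|?M n. iexp (t \<bullet> x)) \<longlonglongrightarrow> (CLINT x|N. iexp (t \<bullet> x))" for t
    proof -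
      have lim: "(CLINT x|N. iexp (t \<bullet> x)) = complex_of_real (exp (- (t \<bullet> (\<Sigma> *v t)) / 2))"
        using N by (simp add: multivariate_normal_def exp_of_real[symmetric])
      have "\<forall>\<^sub>F n in sequentially. bexp (p n) (edges {1..n}) (\<lambda>S. iexp (t \<bullet> X n S)) = (CLINT x|?M n. iexp (t \<bullet> x))"
        using ev
      proof eventually_elim
        case (elim n)
        have "(CLINT x|?M n. iexp (t \<bullet> x)) = (CLINT S|erdos_renyi n (p n). iexp (t \<bullet> X n S))"
          by (rule integral_distr) simp_all
        then show ?case using elim by (simp add: expectation_erdos_renyi all_edges_eq)
      qed
      then show ?thesis unfolding lim by (rule Lim_transform_eventually[OF char[of t]])
    qed
    show "\<exists>r. \<forall>\<^sub>F n in sequentially. measure (?M n) {x. r < norm x} \<le> e" if e: "e > 0" for e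
    proof (intro exI)
      \<comment> \<open>Chosen so that the Markov bound \<open>D / r ^ 2\<close> equals
        \<open>e\<close>.\<close>
      define r where "r = sqrt (D / e)"
      have r: "r > 0" "r\<^sup>2 = D / e" using D e by (auto simp: r_def)
      show "\<forall>\<^sub>F n in sequentially. measure (?M n) {x. r < norm x} \<le> e"
        using ev norm2
      proof eventually_elim
        case (elim n)
        have "{x :: real ^ 'k. r < norm x} \<in> sets borel" by measurable
        then have "measure (?M n) {x. r < norm x} = measure_pmf.expectation (erdos_renyi n (p n)) (indicator {S. r < norm (X n S)})"
          by (simp add: measure_distr vimage_def)
        also have "\<dots> = bexp (p n) (edges {1..n}) (indicator {S. r < norm (X n S)})"
          unfolding all_edges_eq[symmetric] by (rule expectation_erdos_renyi) (use elim in auto)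
        also have "\<dots> \<le> bexp (p n) (edges {1..n}) (\<lambda>S. (norm (X n S))\<^sup>2 / r\<^sup>2)"
        proof (intro bexp_mono)
          fix S
          have "r\<^sup>2 \<le> (norm (X n S))\<^sup>2" if "r < norm (X n S)"
            using that r by (intro power_mono) auto
          then show "indicator {S. r < norm (X n S)} S \<le> (norm (X n S))\<^sup>2 / r\<^sup>2"
            using r(1) by (simp add: indicator_def)
        qed (use elim in auto)
        also have "\<dots> \<le> D / r\<^sup>2" unfolding bexp_divc using elim by (intro divide_right_mono) auto
        finally show ?case using D e by (simp add: r(2))
      qed
    qed
  qed (use f in auto)
qed

section \<open>Zagreb indices as degree functionals\<close>

lemma sum_edges_degree:
  assumes "finite V" "S \<subseteq> edges V"
  shows "degsum real V S = 2 * real (card S)"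
proof -
  have S: "finite S" using assms finite_subset by (metis finite_edges)
  have "degsum real V S = (\<Sum>v\<in>V. \<Sum>e\<in>S. of_bool (v \<in> e))"
    unfolding degsum_def deg_def using S by (simp add: Int_def)
  also have "\<dots> = (\<Sum>e\<in>S. \<Sum>v\<in>V. of_bool (v \<in> e))" by (rule sum.swap)
  also have "\<dots> = (\<Sum>e\<in>S. 2)"
  proof (intro sum.cong refl)
    fix e assume "e \<in> S"
    then have "e \<subseteq> V" "card e = 2" using assms by (auto simp: edges_def)
    then show "(\<Sum>v\<in>V. of_bool (v \<in> e) :: real) = 2"
      using assms(1) by (simp add: Int_absorb1)
  qed
  finally show ?thesis by simp
qed

lemma deg_eq_sum_edge_ind:
  assumes "S \<subseteq> edges {1..n}" "i \<in> {1..n}"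
  shows "(\<Sum>j = 1..n. edge_ind S i j) = real (deg S i)"
proof -
  have "{e \<in> S. i \<in> e} = (\<lambda>j. {i, j}) ` {j \<in> {1..n}. {i, j} \<in> S}"
  proof (intro equalityI subsetI)
    fix e assume e: "e \<in> {e \<in> S. i \<in> e}"
    then have "e \<in> (\<lambda>u. {i, u}) ` ({1..n} - {i})"
      using assms(1) star_eq_image[OF assms(2)] by blast
    with e show "e \<in> (\<lambda>j. {i, j}) ` {j \<in> {1..n}. {i, j} \<in> S}" by blast
  qed blast
  then have "deg S i = card {j \<in> {1..n}. {i, j} \<in> S}"
    by (simp add: deg_def card_image inj_on_doubleton)
  moreover have "(\<Sum>j = 1..n. edge_ind S i j) = real (card {j \<in> {1..n}. {i, j} \<in> S})"
    by (simp add: edge_ind_def sum.If_cases Int_def)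
  ultimately show ?thesis by simp
qed

lemma zagreb_eq_degsum: "S \<subseteq> edges {1..n} \<Longrightarrow> zagreb n m S = degsum (\<lambda>x. real x ^ m) {1..n} S"
  unfolding zagreb_def degsum_def by (intro sum.cong refl) (simp only: deg_eq_sum_edge_ind)

lemma zagreb_mean_eq:
  assumes "0 \<le> p" "p \<le> 1"
  shows "zagreb_mean n p m = real n * binexp (n - 1) p (\<lambda>x. real x ^ m)"
proof -
  have "zagreb_mean n p m = bexp p (edges {1..n}) (degsum (\<lambda>x. real x ^ m) {1..n})"
    unfolding zagreb_mean_def expectation_erdos_renyi[OF assms] all_edges_eq
    by (intro bexp_cong refl zagreb_eq_degsum)
  then show ?thesis by (simp add: bexp_degsum)
qed

section \<open>The number of edges\<close>

text \<open>The upper bound on \<open>exp (- y)\<close> follows from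
  \<open>exp y \<ge> 1 + y + y ^ 2 / 2\<close>, because the product of this polynomial with
  \<open>1 - y + y ^ 2\<close> is 1 plus nonnegative terms.\<close>

lemma abs_exp_minus_linear_le:
  fixes y :: real
  assumes "0 \<le> y"
  shows "\<bar>1 - y - exp (- y)\<bar> \<le> y\<^sup>2"
proof -
  have "1 \<le> (1 - y + y\<^sup>2) * (1 + y + y\<^sup>2 / 2)"
  proof -
    have "(1 - y + y\<^sup>2) * (1 + y + y\<^sup>2 / 2) = 1 + (y\<^sup>2 / 2 + y ^ 3 / 2 + y ^ 4 / 2)"
      by (simp add: field_simps power2_eq_square power3_eq_cube power4_eq_xxxx)
    then show ?thesis using assms by simp
  qed
  also have "\<dots> \<le> (1 - y + y\<^sup>2) * exp y"
  proof (rule mult_left_mono[OF exp_lower_Taylor_quadratic[OF assms]])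
    have "0 \<le> (1 - y / 2)\<^sup>2 + 3 / 4 * y\<^sup>2" by simp
    also have "\<dots> = 1 - y + y\<^sup>2" by (simp add: power2_eq_square algebra_simps)
    finally show "0 \<le> 1 - y + y\<^sup>2" .
  qed
  finally have "exp (- y) \<le> 1 - y + y\<^sup>2"
    by (simp add: exp_minus field_simps)
  moreover have "1 - y \<le> exp (- y)" using exp_ge_add_one_self[of "- y"] by simp
  ultimately show ?thesis by simp
qed

text \<open>Second order expansion at the two values \<open>1 - p\<close> and \<open>- p\<close> of
  a centred Bernoulli variable: the linear terms cancel and the quadratic ones give the variance.
  The factor \<open>p * (1 - p)\<close> in the cubic error matters, since after summation over all
  edges it has to be compared with the variance even when \<open>p\<close> tends to 0 or 1.\<close>

lemma bernoulli_char_bound: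
  fixes p s :: real
  assumes p: "0 \<le> p" "p \<le> 1"
  shows "cmod (p * iexp (s * (1 - p)) + (1 - p) * iexp (- s * p) - exp (- (p * (1 - p) * s\<^sup>2 / 2)))
    \<le> p * (1 - p) * \<bar>s\<bar> ^ 3 + (p * (1 - p) * s\<^sup>2)\<^sup>2"
proof -
  define q where "q = 1 - p"
  have q: "0 \<le> q" "q \<le> 1" "p = 1 - q" using p by (auto simp: q_def)
  define y where "y = p * q * s\<^sup>2 / 2"
  have y: "0 \<le> y" using p q by (simp add: y_def)
  have T: "cmod (iexp x - (1 + \<i> * x - x\<^sup>2 / 2)) \<le> \<bar>x\<bar> ^ 3 / 6" for x :: real
    using iexp_approx1[of x 2] by (simp add: numeral_2_eq_2 fact_numeral power2_eq_square algebra_simps power3_eq_cube)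
  have "complex_of_real p * iexp (s * q) + complex_of_real q * iexp (- s * p) - (1 - y)
     = p * (iexp (s * q) - (1 + \<i> * (s * q) - (s * q)\<^sup>2 / 2)) + q * (iexp (- s * p) - (1 + \<i> * (- s * p) - (- s * p)\<^sup>2 / 2))"
  proof -
    have "p * (1 + \<i> * (s * q) - (s * q)\<^sup>2 / 2) + q * (1 + \<i> * (- s * p) - (- s * p)\<^sup>2 / 2) = 1 - complex_of_real y"
      unfolding y_def q(3) by (simp add: power2_eq_square field_simps)
    then show ?thesis by (simp add: algebra_simps)
  qed
  also have "cmod \<dots> \<le> p * (\<bar>s * q\<bar> ^ 3 / 6) + q * (\<bar>- s * p\<bar> ^ 3 / 6)"
  proof (rule order.trans[OF norm_triangle_ineq])
    have m: "cmod (complex_of_real r * z) \<le> r * b" if "0 \<le> r" "cmod z \<le> b" for r z b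
      using that by (simp add: norm_mult mult_left_mono)
    show "cmod (p * (iexp (s * q) - (1 + \<i> * (s * q) - (s * q)\<^sup>2 / 2))) +
      cmod (q * (iexp (- s * p) - (1 + \<i> * (- s * p) - (- s * p)\<^sup>2 / 2)))
      \<le> p * (\<bar>s * q\<bar> ^ 3 / 6) + q * (\<bar>- s * p\<bar> ^ 3 / 6)"
      using T[of "s * q"] T[of "- s * p"] by (intro add_mono m p q) simp_all
  qed
  also have "\<dots> \<le> p * (q * \<bar>s\<bar> ^ 3 / 6) + q * (p * \<bar>s\<bar> ^ 3 / 6)"
  proof -
    have "\<bar>s * r\<bar> ^ 3 \<le> r * \<bar>s\<bar> ^ 3" if "0 \<le> r" "r \<le> 1" for r
    proof -
      have "r ^ 3 * \<bar>s\<bar> ^ 3 \<le> r * \<bar>s\<bar> ^ 3"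
        using power_decreasing[of 1 3 r] that by (intro mult_right_mono) auto
      then show ?thesis using that by (simp add: abs_mult power_mult_distrib mult.commute)
    qed
    from this[OF q(1,2)] this[OF p] show ?thesis
      using p q by (intro add_mono mult_left_mono divide_right_mono) auto
  qed
  also have "\<dots> \<le> p * q * \<bar>s\<bar> ^ 3"
    using p q by (simp add: field_simps)
  finally have 1: "cmod (complex_of_real p * iexp (s * q) + complex_of_real q * iexp (- s * p) - complex_of_real (1 - y)) \<le> p * q * \<bar>s\<bar> ^ 3" .
  have 2: "cmod (complex_of_real (1 - y) - complex_of_real (exp (- y))) \<le> (p * q * s\<^sup>2)\<^sup>2"
  proof -
    have "cmod (complex_of_real (1 - y - exp (- y))) \<le> y\<^sup>2"
      unfolding norm_of_real by (rule abs_exp_minus_linear_le[OF y])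
    also have "y\<^sup>2 \<le> (p * q * s\<^sup>2)\<^sup>2" using p q by (intro power_mono) (auto simp: y_def)
    finally show ?thesis by simp
  qed
  have "cmod (A - D) \<le> cmod (A - B) + cmod (B - D)" for A B D :: complex
    using norm_triangle_ineq[of "A - B" "B - D"] by simp
  from order.trans[OF this add_mono[OF 1 2]] show ?thesis
    by (simp only: q_def y_def)
qed

text \<open>Both bases lie in the unit disc, so the distance of the \<open>N\<close>-th powers is at
  most \<open>N\<close> times the distance of the bases.\<close>

lemma binomial_char_bound:
  fixes p s :: real
  assumes "finite A" and p: "0 \<le> p" "p \<le> 1"
  shows "cmod (bexp p A (\<lambda>S. iexp (s * (card S - card A * p))) - exp (- (card A * p * (1 - p) * s\<^sup>2 / 2)))
    \<le> card A * (p * (1 - p) * \<bar>s\<bar> ^ 3 + (p * (1 - p) * s\<^sup>2)\<^sup>2)"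
proof -
  define N where "N = card A"
  define z where "z = p * iexp (s * (1 - p)) + (1 - p) * iexp (- s * p)"
  define w where "w = complex_of_real (exp (- (p * (1 - p) * s\<^sup>2 / 2)))"
  have "bexp p A (\<lambda>S. iexp (s * (card S - N * p))) = bexp p A (\<lambda>S. (iexp (- s * p)) ^ N * iexp s ^ card S)"
  proof (intro bexp_cong refl)
    fix S
    have "\<i> * complex_of_real (s * (real (card S) - real N * p)) = of_nat N * (\<i> * complex_of_real (- s * p)) + of_nat (card S) * (\<i> * complex_of_real s)"
      by (simp add: algebra_simps)
    then show "iexp (s * (card S - N * p)) = (iexp (- s * p)) ^ N * iexp s ^ card S"
      by (simp only: exp_add exp_of_nat_mult)
  qed
  also have "\<dots> = (iexp (- s * p) * (1 + p *\<^sub>R (iexp s - 1))) ^ N"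
    unfolding bexp_cmult bexp_pow[OF assms(1)] N_def power_mult_distrib ..
  also have "iexp (- s * p) * (1 + p *\<^sub>R (iexp s - 1)) = z"
  proof -
    have "iexp (s * (1 - p)) = iexp (- s * p) * iexp s"
      by (simp add: exp_add[symmetric] algebra_simps)
    then show ?thesis by (simp add: z_def scaleR_conv_of_real algebra_simps)
  qed
  finally have eq: "bexp p A (\<lambda>S. iexp (s * (card S - N * p))) = z ^ N" .
  have ew: "complex_of_real (exp (- (N * p * (1 - p) * s\<^sup>2 / 2))) = w ^ N"
    by (simp add: w_def exp_of_nat_mult[symmetric] algebra_simps flip: of_real_power)
  have "cmod z \<le> p * 1 + (1 - p) * 1"
    unfolding z_def using p by (intro order.trans[OF norm_triangle_ineq]) (simp add: norm_mult flip: of_real_diff)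
  then have z: "cmod z \<le> 1" by simp
  have w: "cmod w \<le> 1" using p by (simp add: w_def)
  have "cmod (z ^ N - w ^ N) \<le> N * cmod (z - w)" by (rule norm_power_diff[OF z w])
  also have "\<dots> \<le> N * (p * (1 - p) * \<bar>s\<bar> ^ 3 + (p * (1 - p) * s\<^sup>2)\<^sup>2)"
    unfolding z_def w_def using bernoulli_char_bound[OF p, of s] by (intro mult_left_mono) auto
  finally show ?thesis using eq ew by (simp add: N_def)
qed

text \<open>The normalisation \<open>s\<close> is left open up to asymptotic equivalence because the
  two regimes use different ones. The edges form a triangular array, as \<open>p\<close> varies with
  \<open>n\<close>; the error \<open>v n * \<bar>l n\<bar> + v n * (l n) ^ 2\<close> vanishes
  because \<open>s\<close> tends to infinity.\<close>

lemma edge_count_clt: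
  fixes p s :: "nat \<Rightarrow> real"
  assumes p: "\<And>n. n \<ge> 1 \<Longrightarrow> 0 \<le> p n \<and> p n \<le> 1"
    and s: "filterlim s at_top sequentially"
    and ratio: "(\<lambda>n. 2 * (real n)\<^sup>2 * p n * (1 - p n) / (s n)\<^sup>2) \<longlonglongrightarrow> 1"
  shows "(\<lambda>n. bexp (p n) (edges {1..n})
      (\<lambda>S. iexp (u * ((degsum real {1..n} S - real n * binexp (n - 1) (p n) real) / s n))))
    \<longlonglongrightarrow> complex_of_real (exp (- u\<^sup>2 / 2))"
proof -
  define f where "f n = bexp (p n) (edges {1..n})
      (\<lambda>S. iexp (u * ((degsum real {1..n} S - real n * binexp (n - 1) (p n) real) / s n)))" for n
  \<comment> \<open>The degree sum counts every edge twice, hence the factor 2.\<close>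
  define l where "l n = 2 * u / s n" for n
  define v where "v n = real (n choose 2) * p n * (1 - p n) * (l n)\<^sup>2" for n
  have l: "l \<longlonglongrightarrow> 0"
    unfolding l_def[abs_def] by (rule real_tendsto_divide_at_top[OF tendsto_const s])
  have "(\<lambda>n. u\<^sup>2 * ((2 * (real n)\<^sup>2 * p n * (1 - p n) / (s n)\<^sup>2) * (1 - 1 / real n))) \<longlonglongrightarrow> u\<^sup>2 * (1 * (1 - 0))"
    by (intro tendsto_intros ratio real_tendsto_divide_at_top[OF tendsto_const filterlim_real_sequentially])
  moreover have "\<forall>\<^sub>F n in sequentially. u\<^sup>2 * ((2 * (real n)\<^sup>2 * p n * (1 - p n) / (s n)\<^sup>2) * (1 - 1 / real n)) = v n"
    using eventually_ge_at_top[of 1]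
  proof eventually_elim
    case (elim n)
    have c: "real (n choose 2) = real n * real (n - 1) / 2"
      unfolding choose_two by (subst real_of_nat_div) auto
    \<comment> \<open>If \<open>s n\<close> is 0, both sides are 0 by the convention for division by
      zero.\<close>
    show ?case using elim unfolding v_def l_def c
      by (cases "s n = 0") (simp_all add: of_nat_diff power2_eq_square field_simps)
  qed
  ultimately have v: "v \<longlonglongrightarrow> u\<^sup>2" using Lim_transform_eventually by fastforce
  have lim: "(\<lambda>n. v n * \<bar>l n\<bar> + v n * (l n)\<^sup>2) \<longlonglongrightarrow> u\<^sup>2 * \<bar>0\<bar> + u\<^sup>2 * 0\<^sup>2"
    by (intro tendsto_intros v l)
  have ev: "\<forall>\<^sub>F n in sequentially. norm (f n - complex_of_real (exp (- v n / 2))) \<le> v n * \<bar>l n\<bar> + v n * (l n)\<^sup>2"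
    using eventually_ge_at_top[of 1] filterlim_at_top_dense[THEN iffD1, OF s, rule_format, of 0]
  proof eventually_elim
    case (elim n)
    note pn = p[OF elim(1)]
    let ?A = "edges {1..n}"
    have cA: "card ?A = n choose 2"
      using n_subsets[of "{1..n}" 2] by (simp add: edges_def)
    have mean: "real n * binexp (n - 1) (p n) real = 2 * (real (n choose 2) * p n)"
    proof -
      have "binexp (n - 1) (p n) real = real (n - 1) * p n"
        using binexp_ffact[of "n - 1" "p n" 1] by (simp add: ffact_def)
      moreover have "real (n choose 2) = real n * real (n - 1) / 2"
        unfolding choose_two by (subst real_of_nat_div) auto
      ultimately show ?thesis by simp
    qed
    have "f n = bexp (p n) ?A (\<lambda>S. iexp (l n * (card S - card ?A * p n)))"
      unfolding f_def mean cA
    proof (intro bexp_cong refl)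
      fix S assume "S \<subseteq> ?A"
      then have "degsum real {1..n} S = 2 * real (card S)" by (intro sum_edges_degree) auto
      then have "u * ((degsum real {1..n} S - 2 * (real (n choose 2) * p n)) / s n) = l n * (real (card S) - real (n choose 2) * p n)"
        by (simp add: l_def field_simps)
      then show "iexp (u * ((degsum real {1..n} S - 2 * (real (n choose 2) * p n)) / s n)) = iexp (l n * (real (card S) - real (n choose 2) * p n))"
        by simp
    qed
    then have "norm (f n - complex_of_real (exp (- v n / 2))) \<le>
        real (n choose 2) * (p n * (1 - p n) * \<bar>l n\<bar> ^ 3 + (p n * (1 - p n) * (l n)\<^sup>2)\<^sup>2)"
      using binomial_char_bound[of ?A "p n" "l n"] pn unfolding cA v_def by simp
    also have "\<dots> = v n * \<bar>l n\<bar> + v n * (l n)\<^sup>2 * (p n * (1 - p n))"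
      by (simp add: v_def algebra_simps power2_eq_square power3_eq_cube)
    also have "\<dots> \<le> v n * \<bar>l n\<bar> + v n * (l n)\<^sup>2 * 1"
      using pn by (intro add_left_mono mult_left_mono) (auto simp: v_def mult_le_one)
    finally show ?case by simp
  qed
  have "(\<lambda>n. f n - complex_of_real (exp (- v n / 2))) \<longlonglongrightarrow> 0"
    using Lim_null_comparison[OF ev] lim by simp
  moreover have "(\<lambda>n. complex_of_real (exp (- v n / 2))) \<longlonglongrightarrow> exp (- u\<^sup>2 / 2)"
    by (intro tendsto_intros v) auto
  ultimately show ?thesis
    unfolding f_def[symmetric] using tendsto_add[of "\<lambda>n. f n - complex_of_real (exp (- v n / 2))" 0] by force
qed

text \<open>If all coordinates are close in mean square to one scalar \<open>Y\<close>, then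
  \<open>t \<bullet> X\<close> is close to \<open>Y\<close> times the sum of the coordinates of
  \<open>t\<close>, and the square of that sum is the quadratic form of the all-ones matrix.\<close>

lemma weak_conv_vec_rank_one:
  fixes X :: "nat \<Rightarrow> nat set set \<Rightarrow> real ^ 'k" and p s :: "nat \<Rightarrow> real"
  assumes p: "\<And>n. n \<ge> 1 \<Longrightarrow> 0 \<le> p n \<and> p n \<le> 1"
    and s: "filterlim s at_top sequentially"
    and ratio: "(\<lambda>n. 2 * (real n)\<^sup>2 * p n * (1 - p n) / (s n)\<^sup>2) \<longlonglongrightarrow> 1"
    and close: "\<And>a. (\<lambda>n. bexp (p n) (edges {1..n}) (\<lambda>S. (X n S $ a -
        (degsum real {1..n} S - real n * binexp (n - 1) (p n) real) / s n)\<^sup>2)) \<longlonglongrightarrow> 0"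
    and N: "multivariate_normal N 0 (\<chi> a b. 1)"
  shows "weak_conv_vec (\<lambda>n. distr (erdos_renyi n (p n)) borel (X n)) N"
proof (rule weak_conv_vec_erdos_renyi[OF p N])
  define Y where "Y n S = (degsum real {1..n} S - real n * binexp (n - 1) (p n) real) / s n" for n S
  define d where "d a n = bexp (p n) (edges {1..n}) (\<lambda>S. (X n S $ a - Y n S)\<^sup>2)" for a n
  have d: "d a \<longlonglongrightarrow> 0" for a using close by (simp add: d_def[abs_def] Y_def)
  fix t :: "real ^ 'k"
  define u where "u = (\<Sum>a\<in>UNIV. t $ a)"
  have "t \<bullet> ((\<chi> a b. 1) *v t) = u\<^sup>2"
    by (simp add: inner_vec_def matrix_vector_mult_def u_def power2_eq_square sum_distrib_right)
  moreover have "(\<lambda>n. bexp (p n) (edges {1..n}) (\<lambda>S. iexp (t \<bullet> X n S)) - bexp (p n) (edges {1..n}) (\<lambda>S. iexp (u * Y n S))) \<longlonglongrightarrow> 0"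
  proof (rule Lim_null_comparison)
    show "\<forall>\<^sub>F n in sequentially. norm (bexp (p n) (edges {1..n}) (\<lambda>S. iexp (t \<bullet> X n S)) - bexp (p n) (edges {1..n}) (\<lambda>S. iexp (u * Y n S)))
       \<le> (\<Sum>a\<in>UNIV. \<bar>t $ a\<bar> * sqrt (d a n))"
      using eventually_ge_at_top[of 1]
    proof eventually_elim
      case (elim n)
      note pn = conjunct1[OF p[OF elim]] conjunct2[OF p[OF elim]]
      have "norm (bexp (p n) (edges {1..n}) (\<lambda>S. iexp (t \<bullet> X n S)) - bexp (p n) (edges {1..n}) (\<lambda>S. iexp (u * Y n S)))
        \<le> bexp (p n) (edges {1..n}) (\<lambda>S. cmod (iexp (t \<bullet> X n S) - iexp (u * Y n S)))"
        unfolding bexp_diff[symmetric] by (rule norm_bexp_le[OF pn])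
      also have "\<dots> \<le> bexp (p n) (edges {1..n}) (\<lambda>S. \<Sum>a\<in>UNIV. \<bar>t $ a\<bar> * \<bar>X n S $ a - Y n S\<bar>)"
      proof (intro bexp_mono pn)
        fix S
        have "iexp (t \<bullet> X n S) - iexp (u * Y n S) = iexp (u * Y n S) * (iexp (t \<bullet> X n S - u * Y n S) - 1)"
          by (simp add: right_diff_distrib exp_add[symmetric])
        then have "cmod (iexp (t \<bullet> X n S) - iexp (u * Y n S)) = cmod (iexp (t \<bullet> X n S - u * Y n S) - 1)"
          by (simp only: norm_mult norm_exp_i_times mult_1)
        also have "\<dots> \<le> \<bar>t \<bullet> X n S - u * Y n S\<bar>" by (rule cmod_iexp_minus_1_le)
        also have "t \<bullet> X n S - u * Y n S = (\<Sum>a\<in>UNIV. t $ a * (X n S $ a - Y n S))"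
          by (simp add: inner_vec_def u_def sum_distrib_right sum_subtractf right_diff_distrib)
        also have "\<bar>\<dots>\<bar> \<le> (\<Sum>a\<in>UNIV. \<bar>t $ a\<bar> * \<bar>X n S $ a - Y n S\<bar>)"
          by (intro order.trans[OF sum_abs] sum_mono) (simp add: abs_mult)
        finally show "cmod (iexp (t \<bullet> X n S) - iexp (u * Y n S)) \<le> (\<Sum>a\<in>UNIV. \<bar>t $ a\<bar> * \<bar>X n S $ a - Y n S\<bar>)" .
      qed
      also have "\<dots> = (\<Sum>a\<in>UNIV. \<bar>t $ a\<bar> * bexp (p n) (edges {1..n}) (\<lambda>S. \<bar>X n S $ a - Y n S\<bar>))"
        by (simp only: bexp_sum bexp_cmult)
      also have "\<dots> \<le> (\<Sum>a\<in>UNIV. \<bar>t $ a\<bar> * sqrt (d a n))"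
        unfolding d_def by (intro sum_mono mult_left_mono bexp_abs_le_sqrt pn) auto
      finally show ?case .
    qed
    have "(\<lambda>n. \<Sum>a\<in>UNIV. \<bar>t $ a\<bar> * sqrt (d a n)) \<longlonglongrightarrow> (\<Sum>a\<in>UNIV. \<bar>t $ a\<bar> * sqrt 0)"
      by (intro tendsto_intros d)
    then show "(\<lambda>n. \<Sum>a\<in>UNIV. \<bar>t $ a\<bar> * sqrt (d a n)) \<longlonglongrightarrow> 0" by simp
  qed
  moreover have "(\<lambda>n. bexp (p n) (edges {1..n}) (\<lambda>S. iexp (u * Y n S))) \<longlonglongrightarrow> complex_of_real (exp (- u\<^sup>2 / 2))"
    unfolding Y_def by (rule edge_count_clt[OF p s ratio])
  ultimately show "(\<lambda>n. bexp (p n) (edges {1..n}) (\<lambda>S. iexp (t \<bullet> X n S)))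
      \<longlonglongrightarrow> complex_of_real (exp (- (t \<bullet> ((\<chi> a b. 1) *v t)) / 2))"
    using tendsto_add[of "\<lambda>n. bexp (p n) (edges {1..n}) (\<lambda>S. iexp (t \<bullet> X n S)) - bexp (p n) (edges {1..n}) (\<lambda>S. iexp (u * Y n S))" 0 sequentially
      "\<lambda>n. bexp (p n) (edges {1..n}) (\<lambda>S. iexp (u * Y n S))"] by simp
next
  define Y where "Y n S = (degsum real {1..n} S - real n * binexp (n - 1) (p n) real) / s n" for n S
  fix a
  have "\<forall>\<^sub>F n in sequentially. bexp (p n) (edges {1..n}) (\<lambda>S. (X n S $ a - Y n S)\<^sup>2) < 1"
    using close[of a] by (intro order_tendstoD(2)[of _ 0]) (auto simp: Y_def)
  moreover have "\<forall>\<^sub>F n in sequentially. 2 * (real n)\<^sup>2 * p n * (1 - p n) / (s n)\<^sup>2 < 2"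
    using ratio by (rule order_tendstoD(2)) simp
  \<comment> \<open>The constant is \<open>6 = 2 * 1 + 2 * 2\<close>, from the eventual bounds 1 on
    the mean square distance to \<open>Y\<close> and 2 on the second moment of
    \<open>Y\<close>.\<close>
  ultimately have "\<forall>\<^sub>F n in sequentially. bexp (p n) (edges {1..n}) (\<lambda>S. (X n S $ a)\<^sup>2) \<le> 6"
    using eventually_ge_at_top[of 1]
  proof eventually_elim
    case (elim n)
    note pn = conjunct1[OF p[OF elim(3)]] conjunct2[OF p[OF elim(3)]]
    have "bexp (p n) (edges {1..n}) (\<lambda>S. (X n S $ a)\<^sup>2) \<le> bexp (p n) (edges {1..n}) (\<lambda>S. 2 * (X n S $ a - Y n S)\<^sup>2 + 2 * (Y n S)\<^sup>2)"
    proof (intro bexp_mono pn)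
      fix S
      show "(X n S $ a)\<^sup>2 \<le> 2 * (X n S $ a - Y n S)\<^sup>2 + 2 * (Y n S)\<^sup>2"
        using sum_squares_ge_zero[of "X n S $ a - 2 * Y n S" 0] by (simp add: power2_eq_square algebra_simps)
    qed
    also have "\<dots> = 2 * bexp (p n) (edges {1..n}) (\<lambda>S. (X n S $ a - Y n S)\<^sup>2) + 2 * bexp (p n) (edges {1..n}) (\<lambda>S. (Y n S)\<^sup>2)"
      by (simp only: bexp_add bexp_cmult)
    also have "bexp (p n) (edges {1..n}) (\<lambda>S. (Y n S)\<^sup>2) \<le> 2 * (real n)\<^sup>2 * p n * (1 - p n) / (s n)\<^sup>2"
      unfolding Y_def power_divide bexp_divc
      using degsum_variance_le[of "{1..n}" "p n" real] pn by (intro divide_right_mono) auto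
    finally show ?case using elim by simp
  qed
  then show "\<exists>C. \<forall>\<^sub>F n in sequentially. bexp (p n) (edges {1..n}) (\<lambda>S. (X n S $ a)\<^sup>2) \<le> C" by blast
qed

section \<open>Limits of binomial moments\<close>

lemma binexp_ffact_tendsto:
  assumes "(\<lambda>n. real n * p n) \<longlonglongrightarrow> c"
  shows "(\<lambda>n. binexp (n - j) (p n) (\<lambda>x. ffact x i)) \<longlonglongrightarrow> c ^ i"
proof -
  have "(\<lambda>n. ffact (n - j) i / real n ^ i * (real n * p n) ^ i) \<longlonglongrightarrow> 1 * c ^ i"
    by (intro tendsto_intros ffact_ratio_tendsto assms)
  moreover have "\<forall>\<^sub>F n in sequentially. ffact (n - j) i / real n ^ i * (real n * p n) ^ i = binexp (n - j) (p n) (\<lambda>x. ffact x i)"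
    using eventually_gt_at_top[of 0] by eventually_elim (simp add: binexp_ffact power_mult_distrib)
  ultimately show ?thesis using Lim_transform_eventually by fastforce
qed

text \<open>The \<open>m\<close>-th moment of a Poisson variable of mean \<open>c\<close>, whose
  factorial moments are the powers of \<open>c\<close>.\<close>

definition poisson_moment :: "real \<Rightarrow> nat \<Rightarrow> real" where
  "poisson_moment c m = (\<Sum>i=1..m. real (Stirling m i) * c ^ i)"

text \<open>The mean of \<open>(X + 1) ^ m - X ^ m\<close> for a Poisson variable \<open>X\<close>,
  which is also the derivative of \<open>poisson_moment\<close> in \<open>c\<close>.\<close>

definition poisson_increment :: "real \<Rightarrow> nat \<Rightarrow> real" where
  "poisson_increment c m = (\<Sum>i=1..m. real (Stirling m i) * (real i * c ^ (i - 1)))"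

text \<open>The mean of \<open>X ^ m * X ^ l\<close>, expanded by \<open>ffact_mult\<close> and not
  as a single power, so that it can be compared termwise with \<open>zagreb_cov\<close>.\<close>

definition poisson_moment2 :: "real \<Rightarrow> nat \<Rightarrow> nat \<Rightarrow> real" where
  "poisson_moment2 c m l = (\<Sum>i=1..m. \<Sum>j=1..l. real (Stirling m i) * real (Stirling l j) *
     (\<Sum>s\<le>min i j. fact i * fact j / (fact s * fact (i - s) * fact (j - s)) * c ^ (i + j - s)))"

context
  fixes p :: "nat \<Rightarrow> real" and c :: real
  assumes np: "(\<lambda>n. real n * p n) \<longlonglongrightarrow> c"
begin

lemma binexp_power_tendsto:
  "m \<ge> 1 \<Longrightarrow> (\<lambda>n. binexp (n - j) (p n) (\<lambda>x. real x ^ m)) \<longlonglongrightarrow> poisson_moment c m"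
  unfolding poisson_moment_def power_eq_sum_ffact' binexp_sum binexp_cmult
  by (intro tendsto_intros binexp_ffact_tendsto[OF np])

lemma binexp_power_diff_tendsto:
  assumes "m \<ge> 1"
  shows "(\<lambda>n. binexp (n - j) (p n) (\<lambda>x. real (Suc x) ^ m - real x ^ m)) \<longlonglongrightarrow> poisson_increment c m"
proof -
  have "real (Suc x) ^ m - real x ^ m = (\<Sum>i=1..m. real (Stirling m i) * (real i * ffact x (i - 1)))" for x
  proof -
    have "ffact (Suc x) i - ffact x i = real i * ffact x (i - 1)" for i
      by (cases i) (simp_all add: ffact_Suc_left)
    then show ?thesis
      unfolding power_eq_sum_ffact'[OF assms] sum_subtractf[symmetric] right_diff_distrib[symmetric] by simp
  qed
  then show ?thesis
    unfolding poisson_increment_def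
    by (simp only: binexp_sum binexp_cmult) (intro tendsto_intros binexp_ffact_tendsto[OF np])
qed

lemma binexp_power_mult_tendsto:
  assumes "m \<ge> 1" "l \<ge> 1"
  shows "(\<lambda>n. binexp (n - j) (p n) (\<lambda>x. real x ^ m * real x ^ l)) \<longlonglongrightarrow> poisson_moment2 c m l"
proof -
  have "real x ^ m * real x ^ l = (\<Sum>i=1..m. \<Sum>j=1..l. real (Stirling m i) * real (Stirling l j) *
     (\<Sum>s\<le>min i j. fact i * fact j / (fact s * fact (i - s) * fact (j - s)) * ffact x (i + j - s)))" for x
    unfolding power_eq_sum_ffact'[OF assms(1)] power_eq_sum_ffact'[OF assms(2)] sum_product
    unfolding ffact_mult[symmetric] by (intro sum.cong refl) (simp only: mult_ac)
  then show ?thesis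
    unfolding poisson_moment2_def
    by (simp only: binexp_sum binexp_cmult) (intro tendsto_intros binexp_ffact_tendsto[OF np])
qed

end

text \<open>The overlap \<open>s = 0\<close> contributes \<open>c ^ (i + j)\<close>, the product of
  the factorial moments, and cancels; this is why the sum in \<open>zagreb_cov\<close> starts at
  1.\<close>

lemma poisson_covariance:
  "poisson_moment2 c m l - poisson_moment c m * poisson_moment c l =
    (\<Sum>i=1..m. \<Sum>j=1..l. real (Stirling m i) * real (Stirling l j) *
     (\<Sum>s=1..min i j. fact i * fact j * c ^ (i + j - s) / (fact s * fact (i - s) * fact (j - s))))"
proof -
  have 1: "poisson_moment c m * poisson_moment c l = (\<Sum>i=1..m. \<Sum>j=1..l. real (Stirling m i) * real (Stirling l j) * c ^ (i + j))"
    unfolding poisson_moment_def sum_product by (intro sum.cong refl) (simp add: power_add)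
  have 2: "poisson_moment2 c m l = (\<Sum>i=1..m. \<Sum>j=1..l. real (Stirling m i) * real (Stirling l j) *
     (c ^ (i + j) + (\<Sum>s=1..min i j. fact i * fact j * c ^ (i + j - s) / (fact s * fact (i - s) * fact (j - s)))))"
    unfolding poisson_moment2_def
    by (intro sum.cong refl) (simp add: atMost_atLeast0 sum.atLeast_Suc_atMost)
  show ?thesis
    unfolding 1 2 by (simp only: sum_subtractf[symmetric] right_diff_distrib[symmetric] add_diff_cancel_left')
qed

text \<open>The two parts of the covariance have different sources: the sum over \<open>s\<close> is
  the covariance of powers of a single Poisson degree, the term with \<open>c ^ (i + j - 1)\<close>
  comes from pairs of vertices and the possible edge between them.\<close>

lemma zagreb_cov_eq:
  "zagreb_cov c m l = poisson_moment2 c m l - poisson_moment c m * poisson_moment c l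
     + c * poisson_increment c m * poisson_increment c l"
proof -
  have "c * poisson_increment c m * poisson_increment c l = (\<Sum>i=1..m. \<Sum>j=1..l.
      c * (real (Stirling m i) * (real i * c ^ (i - 1)) * (real (Stirling l j) * (real j * c ^ (j - 1)))))"
    unfolding mult.assoc[of c] unfolding poisson_increment_def sum_product unfolding sum_distrib_left ..
  also have "\<dots> = (\<Sum>i=1..m. \<Sum>j=1..l. real (Stirling m i) * real (Stirling l j) * (real i * real j * c ^ (i + j - 1)))"
  proof (intro sum.cong refl)
    fix i j assume "i \<in> {1..m}" "j \<in> {1..l}"
    then have "i + j - 1 = Suc ((i - 1) + (j - 1))" by auto
    then have "c ^ (i + j - 1) = c * (c ^ (i - 1) * c ^ (j - 1))" by (simp only: power_Suc power_add)
    then show "c * (real (Stirling m i) * (real i * c ^ (i - 1)) * (real (Stirling l j) * (real j * c ^ (j - 1)))) =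
        real (Stirling m i) * real (Stirling l j) * (real i * real j * c ^ (i + j - 1))"
      by (simp only: mult_ac)
  qed
  finally show ?thesis
    unfolding poisson_covariance zagreb_cov_def by (simp only: sum.distrib[symmetric] distrib_left[symmetric] add.commute)
qed

text \<open>A Gram factorisation, which shows positive semidefiniteness and feeds the construction
  of the limit law. It rests on \<open>(i choose s) * (j choose s) * fact s\<close> being the
  overlap coefficient. The term \<open>i * j * c ^ (i + j - 1)\<close> coincides with the overlap
  term for \<open>s = 1\<close>, hence the weight 2 there.\<close>

lemma zagreb_cov_factor:
  fixes c :: real
  assumes "0 \<le> c"
  defines "B \<equiv> \<lambda>m s. (\<Sum>i=1..m. real (Stirling m i) * (real (i choose s) * c ^ (i - s))) *
     sqrt (fact s * c ^ s * (if s = 1 then 2 else 1))"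
  assumes "m \<le> k" "l \<le> k"
  shows "zagreb_cov c m l = (\<Sum>s=1..k. B m s * B l s)"
proof -
  define A where "A m s = (\<Sum>i=1..m. real (Stirling m i) * (real (i choose s) * c ^ (i - s)))" for m s
  have BB: "B m s * B l s = A m s * A l s * (fact s * c ^ s * (if s = 1 then 2 else 1))" for s
  proof -
    have "B m s * B l s = A m s * A l s * (sqrt (fact s * c ^ s * (if s = 1 then 2 else 1)))\<^sup>2"
      by (simp only: B_def A_def power2_eq_square mult_ac)
    then show ?thesis using assms(1) by simp
  qed
  have AA: "A m s * A l s * (fact s * c ^ s) = (\<Sum>i=1..m. \<Sum>j=1..l. real (Stirling m i) * real (Stirling l j) *
     (if s \<le> min i j then fact i * fact j * c ^ (i + j - s) / (fact s * fact (i - s) * fact (j - s)) else 0))" for s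
    unfolding A_def sum_product unfolding sum_distrib_right
  proof (intro sum.cong refl)
    fix i j
    show "real (Stirling m i) * (real (i choose s) * c ^ (i - s)) * (real (Stirling l j) * (real (j choose s) * c ^ (j - s))) * (fact s * c ^ s)
      = real (Stirling m i) * real (Stirling l j) *
        (if s \<le> min i j then fact i * fact j * c ^ (i + j - s) / (fact s * fact (i - s) * fact (j - s)) else 0)"
    proof (cases "s \<le> min i j")
      case True
      then have "i + j - s = (i - s) + (j - s) + s" by auto
      then have "c ^ (i + j - s) = c ^ (i - s) * c ^ (j - s) * c ^ s" by (simp only: power_add)
      then show ?thesis using True by (simp add: binomial_fact mult_ac)
    next
      case False
      then show ?thesis by (auto simp: binomial_eq_0)
    qed
  qed
  have d1: "A m 1 = poisson_increment c m" for m
    by (simp add: A_def poisson_increment_def)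
  have "(\<Sum>s=1..k. B m s * B l s) = (\<Sum>s=1..k. A m s * A l s * (fact s * c ^ s) + (if s = 1 then c * A m 1 * A l 1 else 0))"
    unfolding BB by (intro sum.cong refl) auto
  also have "\<dots> = (\<Sum>s=1..k. A m s * A l s * (fact s * c ^ s)) + (\<Sum>s=1..k. if s = 1 then c * A m 1 * A l 1 else 0)"
    by (rule sum.distrib)
  also have "(\<Sum>s=1..k. if s = 1 then c * A m 1 * A l 1 else 0) = c * poisson_increment c m * poisson_increment c l"
    using assms(3,4) by (cases "k = 0") (auto simp: d1[unfolded One_nat_def] poisson_increment_def)
  also have "(\<Sum>s=1..k. A m s * A l s * (fact s * c ^ s)) = poisson_moment2 c m l - poisson_moment c m * poisson_moment c l"
  proof -
    have "(\<Sum>s=1..k. A m s * A l s * (fact s * c ^ s)) = (\<Sum>i=1..m. \<Sum>j=1..l. real (Stirling m i) * real (Stirling l j) *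
        (\<Sum>s=1..k. if s \<le> min i j then fact i * fact j * c ^ (i + j - s) / (fact s * fact (i - s) * fact (j - s)) else 0))"
      unfolding AA sum_distrib_left
      by (subst sum.swap) (intro sum.cong refl sum.swap)
    also have "\<dots> = (\<Sum>i=1..m. \<Sum>j=1..l. real (Stirling m i) * real (Stirling l j) *
        (\<Sum>s=1..min i j. fact i * fact j * c ^ (i + j - s) / (fact s * fact (i - s) * fact (j - s))))"
    proof (rule sum.cong[OF refl], rule sum.cong[OF refl], rule arg_cong2[where f = "(*)", OF refl])
      fix i j assume "i \<in> {1..m}" "j \<in> {1..l}"
      then have "{s \<in> {1..k}. s \<le> min i j} = {1..min i j}" using assms(3,4) by auto
      then show "(\<Sum>s=1..k. if s \<le> min i j then fact i * fact j * c ^ (i + j - s) / (fact s * fact (i - s) * fact (j - s)) else 0)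
         = (\<Sum>s=1..min i j. fact i * fact j * c ^ (i + j - s) / (fact s * fact (i - s) * fact (j - s)))"
        by (simp only: sum.inter_filter[OF finite_atLeastAtMost, symmetric])
    qed
    finally show ?thesis unfolding poisson_covariance .
  qed
  finally show ?thesis by (simp add: zagreb_cov_eq)
qed

text \<open>In the limit the means over \<open>n - 1\<close> and \<open>n - 2\<close> trials agree,
  so the two increment factors in \<open>degree_var\<close> share the limit \<open>d\<close> and the
  second summand tends to \<open>c * d ^ 2\<close>.\<close>

lemma degree_var_tendsto:
  fixes t :: "'k::finite \<Rightarrow> real" and r :: "'k \<Rightarrow> nat"
  assumes np: "(\<lambda>n. real n * p n) \<longlonglongrightarrow> c" and r: "\<And>a. r a \<ge> 1"
  shows "(\<lambda>n. degree_var n (p n) (\<lambda>x. \<Sum>a\<in>UNIV. t a * real x ^ r a))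
    \<longlonglongrightarrow> (\<Sum>a\<in>UNIV. \<Sum>b\<in>UNIV. t a * t b * zagreb_cov c (r a) (r b))"
proof -
  define P where "P x = (\<Sum>a\<in>UNIV. t a * real x ^ r a)" for x
  define m where "m = (\<Sum>a\<in>UNIV. t a * poisson_moment c (r a))"
  define d where "d = (\<Sum>a\<in>UNIV. t a * poisson_increment c (r a))"
  have P: "(\<lambda>n. binexp (n - j) (p n) P) \<longlonglongrightarrow> m" for j
    unfolding P_def[abs_def] m_def binexp_sum binexp_cmult
    by (intro tendsto_intros binexp_power_tendsto[OF np r])
  have dP: "(\<lambda>n. binexp (n - j) (p n) (\<lambda>x. P (Suc x) - P x)) \<longlonglongrightarrow> d" for j
    unfolding P_def[abs_def] d_def sum_subtractf[symmetric] right_diff_distrib[symmetric] binexp_sum binexp_cmult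
    by (intro tendsto_intros binexp_power_diff_tendsto[OF np r])
  have PS: "(\<lambda>n. binexp (n - j) (p n) (\<lambda>x. P (Suc x))) \<longlonglongrightarrow> m + d" for j
    using tendsto_add[OF P[of j] dP[of j]] by (simp add: binexp_diff)
  have P2: "(\<lambda>n. binexp (n - j) (p n) (\<lambda>x. (P x)\<^sup>2)) \<longlonglongrightarrow> (\<Sum>a\<in>UNIV. \<Sum>b\<in>UNIV. t a * t b * poisson_moment2 c (r a) (r b))" for j
  proof -
    have "(P x)\<^sup>2 = (\<Sum>a\<in>UNIV. \<Sum>b\<in>UNIV. t a * t b * (real x ^ r a * real x ^ r b))" for x
      unfolding P_def power2_eq_square sum_product by (simp only: mult_ac)
    then show ?thesis
      by (simp only: binexp_sum binexp_cmult) (intro tendsto_intros binexp_power_mult_tendsto[OF np r r])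
  qed
  have n1p: "(\<lambda>n. real (n - 1) * p n) \<longlonglongrightarrow> c"
    using binexp_ffact_tendsto[OF np, of 1 1] unfolding binexp_ffact by (simp add: ffact_def)
  have "(\<lambda>n. binexp (n - 1) (p n) (\<lambda>x. (P x)\<^sup>2) - (binexp (n - 1) (p n) P)\<^sup>2
    + (real (n - 1) * p n) * (binexp (n - 2) (p n) (\<lambda>x. P (Suc x)) - binexp (n - 1) (p n) P)
        * binexp (n - 2) (p n) (\<lambda>x. P (Suc x) - P x))
    \<longlonglongrightarrow> (\<Sum>a\<in>UNIV. \<Sum>b\<in>UNIV. t a * t b * poisson_moment2 c (r a) (r b)) - m\<^sup>2 + c * (m + d - m) * d"
    by (intro tendsto_intros P2 P PS dP n1p)
  also have "(\<lambda>n. binexp (n - 1) (p n) (\<lambda>x. (P x)\<^sup>2) - (binexp (n - 1) (p n) P)\<^sup>2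
    + (real (n - 1) * p n) * (binexp (n - 2) (p n) (\<lambda>x. P (Suc x)) - binexp (n - 1) (p n) P)
        * binexp (n - 2) (p n) (\<lambda>x. P (Suc x) - P x)) = (\<lambda>n. degree_var n (p n) P)"
  proof
    fix n
    have "binexp N q (\<lambda>x. (P x - M)\<^sup>2) = binexp N q (\<lambda>x. (P x)\<^sup>2) - 2 * M * binexp N q P + M\<^sup>2" for N q M
    proof -
      have "(\<lambda>x. (P x - M)\<^sup>2) = (\<lambda>x. (P x)\<^sup>2 - 2 * M * P x + M\<^sup>2)"
        by (simp add: fun_eq_iff power2_diff)
      then show ?thesis by (simp only: binexp_add binexp_diff binexp_cmult binexp_const)
    qed
    from this[of "n - 1" "p n" "binexp (n - 1) (p n) P"] show "binexp (n - 1) (p n) (\<lambda>x. (P x)\<^sup>2) - (binexp (n - 1) (p n) P)\<^sup>2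
    + (real (n - 1) * p n) * (binexp (n - 2) (p n) (\<lambda>x. P (Suc x)) - binexp (n - 1) (p n) P)
        * binexp (n - 2) (p n) (\<lambda>x. P (Suc x) - P x) = degree_var n (p n) P"
      by (simp add: degree_var_def power2_eq_square)
  qed
  also have "(\<Sum>a\<in>UNIV. \<Sum>b\<in>UNIV. t a * t b * poisson_moment2 c (r a) (r b)) - m\<^sup>2 + c * (m + d - m) * d
     = (\<Sum>a\<in>UNIV. \<Sum>b\<in>UNIV. t a * t b * zagreb_cov c (r a) (r b))"
  proof -
    have "m\<^sup>2 = (\<Sum>a\<in>UNIV. \<Sum>b\<in>UNIV. t a * t b * (poisson_moment c (r a) * poisson_moment c (r b)))"
      unfolding m_def power2_eq_square sum_product by (simp only: mult_ac)
    moreover have "c * (m + d - m) * d = (\<Sum>a\<in>UNIV. \<Sum>b\<in>UNIV. t a * t b * (c * poisson_increment c (r a) * poisson_increment c (r b)))"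
      unfolding d_def by (simp add: sum_distrib_left sum_distrib_right mult_ac sum_product)
    ultimately show ?thesis
      unfolding zagreb_cov_eq by (simp add: sum.distrib sum_subtractf algebra_simps)
  qed
  finally show ?thesis by (simp only: P_def[abs_def])
qed

text \<open>Brings powers under the growth hypothesis of \<open>degsum_clt\<close>.\<close>

lemma power_le_const_power_2: "\<exists>K. \<forall>x. real x ^ m \<le> K * 2 ^ x"
proof (intro exI allI)
  fix x
  have "ffact x i \<le> fact i * 2 ^ x" for i
    unfolding ffact_def using binomial_le_pow2[of x i]
    by (intro mult_left_mono) (metis of_nat_le_iff of_nat_numeral of_nat_power, simp)
  then show "real x ^ m \<le> (\<Sum>i\<le>m. real (Stirling m i) * fact i) * 2 ^ x"
    unfolding power_eq_sum_ffact sum_distrib_right mult.assoc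
    by (intro sum_mono mult_left_mono) auto
qed

section \<open>Increments of powers at a binomial variable\<close>

lemma power_increment: "real (Suc x) ^ r - real x ^ r = (\<Sum>l<r. real (r choose l) * real x ^ l)"
  using binomial_ring[of "real x" 1 r] by (simp add: lessThan_Suc_atMost[symmetric] add.commute)

text \<open>As \<open>n * p n\<close> tends to infinity, of the expansion into falling factorials
  only the term of degree \<open>d\<close> survives the division; it is present exactly when
  \<open>m = d\<close>, with coefficient \<open>Stirling d d = 1\<close>.\<close>

lemma binexp_power_ratio_tendsto:
  assumes y: "filterlim (\<lambda>n. real n * p n) at_top sequentially" and "m \<le> d"
  shows "(\<lambda>n. binexp (n - j) (p n) (\<lambda>x. real x ^ m) / (real n * p n) ^ d) \<longlonglongrightarrow> of_bool (m = d)"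
proof -
  have ypos: "\<forall>\<^sub>F n in sequentially. 0 < real n * p n"
    using y by (simp add: filterlim_at_top_dense)
  have lim: "(\<lambda>n. (real n * p n) ^ i / (real n * p n) ^ d) \<longlonglongrightarrow> of_bool (i = d)" if "i \<le> d" for i
  proof (cases "i = d")
    case True
    have "\<forall>\<^sub>F n in sequentially. 1 = (real n * p n) ^ i / (real n * p n) ^ d"
      using ypos by eventually_elim (auto simp: True intro!: gr0I)
    then show ?thesis using True by (auto intro: Lim_transform_eventually[OF tendsto_const])
  next
    case False
    have "(\<lambda>n. (1 / (real n * p n)) ^ (d - i)) \<longlonglongrightarrow> 0 ^ (d - i)"
      by (intro tendsto_power real_tendsto_divide_at_top[OF tendsto_const y])
    moreover have "\<forall>\<^sub>F n in sequentially. (1 / (real n * p n)) ^ (d - i) = (real n * p n) ^ i / (real n * p n) ^ d"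
      using ypos
    proof eventually_elim
      case (elim n)
      have "(1 / z) ^ (d - i) = z ^ i / z ^ d" if "z > 0" for z :: real
      proof -
        have "z ^ d = z ^ (d - i) * z ^ i" using \<open>i \<le> d\<close> by (simp flip: power_add)
        then show ?thesis using that by (simp add: power_one_over)
      qed
      then show ?case using elim .
    qed
    ultimately have "(\<lambda>n. (real n * p n) ^ i / (real n * p n) ^ d) \<longlonglongrightarrow> 0 ^ (d - i)"
      by (rule Lim_transform_eventually)
    then show ?thesis using False that by (simp add: power_0_left)
  qed
  have "(\<lambda>n. \<Sum>i\<le>m. real (Stirling m i) * (ffact (n - j) i / real n ^ i * ((real n * p n) ^ i / (real n * p n) ^ d)))
     \<longlonglongrightarrow> (\<Sum>i\<le>m. real (Stirling m i) * (1 * of_bool (i = d)))"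
    using assms(2) by (intro tendsto_intros ffact_ratio_tendsto lim) auto
  moreover have "\<forall>\<^sub>F n in sequentially. (\<Sum>i\<le>m. real (Stirling m i) * (ffact (n - j) i / real n ^ i * ((real n * p n) ^ i / (real n * p n) ^ d)))
     = binexp (n - j) (p n) (\<lambda>x. real x ^ m) / (real n * p n) ^ d"
    using eventually_gt_at_top[of 0]
  proof eventually_elim
    case (elim n)
    have "ffact (n - j) i / real n ^ i * ((real n * p n) ^ i / (real n * p n) ^ d) = ffact (n - j) i * p n ^ i / (real n * p n) ^ d" for i
      using ffact_moment_eq[OF elim, of j i "p n"] by simp
    then show ?case
      by (simp only: power_eq_sum_ffact binexp_sum binexp_cmult binexp_ffact sum_divide_distrib times_divide_eq_right)
  qed
  moreover have "(\<Sum>i\<le>m. real (Stirling m i) * (1 * of_bool (i = d))) = of_bool (m = d)"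
  proof (cases "m = d")
    case True
    have "{..m} \<inter> {i. i = d} = {d}" using True by auto
    then show ?thesis using True by simp
  next
    case False
    then show ?thesis using assms(2) by (auto intro!: sum.neutral)
  qed
  ultimately show ?thesis using Lim_transform_eventually by fastforce
qed

text \<open>A form of concentration of the degree: after expanding the square, only the top power
  \<open>r - 1\<close> of the increment, with coefficient \<open>r\<close>, survives, and the limit
  is \<open>1 - 2 + 1\<close>.\<close>

lemma binexp_increment_dense:
  assumes y: "filterlim (\<lambda>n. real n * p n) at_top sequentially" and r: "r \<ge> 1"
  shows "(\<lambda>n. binexp (n - j) (p n)
      (\<lambda>x. ((real (Suc x) ^ r - real x ^ r) / (real r * (real n * p n) ^ (r - 1)) - 1)\<^sup>2)) \<longlonglongrightarrow> 0"
proof -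
  define y where "y n = real n * p n" for n
  define M where "M m n = binexp (n - j) (p n) (\<lambda>x. real x ^ m)" for m n
  define d where "d = r - 1"
  have rd: "r = Suc d" using r by (simp add: d_def)
  have M: "(\<lambda>n. M m n / y n ^ e) \<longlonglongrightarrow> of_bool (m = e)" if "m \<le> e" for m e
    unfolding M_def y_def by (rule binexp_power_ratio_tendsto[OF assms(1) that])
  have "(\<lambda>n. (\<Sum>l<r. \<Sum>k<r. real (r choose l) * real (r choose k) * (M (l + k) n / y n ^ (2 * d))) / (real r)\<^sup>2
      - 2 * (\<Sum>l<r. real (r choose l) * (M l n / y n ^ d)) / real r + 1)
    \<longlonglongrightarrow> (\<Sum>l<r. \<Sum>k<r. real (r choose l) * real (r choose k) * of_bool (l + k = 2 * d)) / (real r)\<^sup>2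
      - 2 * (\<Sum>l<r. real (r choose l) * of_bool (l = d)) / real r + 1"
    using r by (intro tendsto_intros M) (auto simp: rd)
  also have "(\<Sum>l<r. \<Sum>k<r. real (r choose l) * real (r choose k) * of_bool (l + k = 2 * d)) = (real r)\<^sup>2"
  proof -
    have "(\<Sum>l<r. \<Sum>k<r. real (r choose l) * real (r choose k) * of_bool (l + k = 2 * d))
       = (\<Sum>l<r. \<Sum>k<r. if l = d \<and> k = d then (real r)\<^sup>2 else 0)"
      by (intro sum.cong refl) (auto simp: rd power2_eq_square)
    also have "\<dots> = (\<Sum>l<r. if l = d then (real r)\<^sup>2 else 0)"
      by (intro sum.cong refl) (auto simp: rd)
    finally show ?thesis by (simp add: rd)
  qed
  also have "(\<Sum>l<r. real (r choose l) * of_bool (l = d)) = real r"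
  proof -
    have "(\<Sum>l<r. real (r choose l) * of_bool (l = d)) = (\<Sum>l<r. if l = d then real r else 0)"
      by (intro sum.cong refl) (auto simp: rd)
    then show ?thesis by (simp add: rd)
  qed
  also have "(real r)\<^sup>2 / (real r)\<^sup>2 - 2 * real r / real r + 1 = 0" using r by simp
  also have "(\<lambda>n. (\<Sum>l<r. \<Sum>k<r. real (r choose l) * real (r choose k) * (M (l + k) n / y n ^ (2 * d))) / (real r)\<^sup>2
      - 2 * (\<Sum>l<r. real (r choose l) * (M l n / y n ^ d)) / real r + 1) = (\<lambda>n. binexp (n - j) (p n)
      (\<lambda>x. ((real (Suc x) ^ r - real x ^ r) / (real r * (real n * p n) ^ (r - 1)) - 1)\<^sup>2))"
  proof
    fix n
    have "((real (Suc x) ^ r - real x ^ r) / (real r * (real n * p n) ^ (r - 1)) - 1)\<^sup>2 =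
      (1 / ((real r)\<^sup>2 * y n ^ (2 * d))) * (\<Sum>l<r. \<Sum>k<r. real (r choose l) * real (r choose k) * real x ^ (l + k))
      - (2 / (real r * y n ^ d)) * (\<Sum>l<r. real (r choose l) * real x ^ l) + 1" for x
    proof -
      have "(\<Sum>l<r. \<Sum>k<r. real (r choose l) * real (r choose k) * real x ^ (l + k)) = (\<Sum>l<r. real (r choose l) * real x ^ l)\<^sup>2"
        unfolding power2_eq_square sum_product by (simp only: power_add mult_ac)
      then show ?thesis
        unfolding power_increment d_def[symmetric] y_def[symmetric]
        by (simp add: power2_diff power_divide power_mult_distrib power_mult[symmetric] mult.commute)
    qed
    then show "(\<Sum>l<r. \<Sum>k<r. real (r choose l) * real (r choose k) * (M (l + k) n / y n ^ (2 * d))) / (real r)\<^sup>2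
      - 2 * (\<Sum>l<r. real (r choose l) * (M l n / y n ^ d)) / real r + 1 = binexp (n - j) (p n)
      (\<lambda>x. ((real (Suc x) ^ r - real x ^ r) / (real r * (real n * p n) ^ (r - 1)) - 1)\<^sup>2)"
      by (simp only: binexp_add binexp_diff binexp_const binexp_cmult binexp_sum M_def[symmetric])
        (simp add: sum_divide_distrib sum_distrib_left mult_ac)
  qed
  finally show ?thesis .
qed

text \<open>Subtracting 1 removes the constant term of the increment, so the square involves
  positive powers only, and their moments vanish with \<open>n * p n\<close>.\<close>

lemma binexp_increment_sparse:
  assumes np: "(\<lambda>n. real n * p n) \<longlonglongrightarrow> 0" and r: "r \<ge> 1"
  shows "(\<lambda>n. binexp (n - j) (p n) (\<lambda>x. (real (Suc x) ^ r - real x ^ r - 1)\<^sup>2)) \<longlonglongrightarrow> 0"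
proof -
  have "(real (Suc x) ^ r - real x ^ r - 1)\<^sup>2 =
     (\<Sum>l=1..<r. \<Sum>k=1..<r. real (r choose l) * real (r choose k) * real x ^ (l + k))" for x
  proof -
    have "{..<r} = insert 0 {1..<r}" using r by auto
    then have "real (Suc x) ^ r - real x ^ r - 1 = (\<Sum>l=1..<r. real (r choose l) * real x ^ l)"
      unfolding power_increment by simp
    then show ?thesis
      unfolding power2_eq_square by (simp only: sum_product power_add mult_ac)
  qed
  moreover have "(\<lambda>n. \<Sum>l=1..<r. \<Sum>k=1..<r. real (r choose l) * real (r choose k) * binexp (n - j) (p n) (\<lambda>x. real x ^ (l + k)))
      \<longlonglongrightarrow> (\<Sum>l=1..<r. \<Sum>k=1..<r. real (r choose l) * real (r choose k) * poisson_moment 0 (l + k))"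
    by (intro tendsto_intros binexp_power_tendsto[OF np]) auto
  moreover have "poisson_moment 0 m = 0" for m
    by (simp add: poisson_moment_def)
  ultimately show ?thesis by (simp add: binexp_sum binexp_cmult)
qed

text \<open>The difference of a scaled index and a scaled edge count is again a degree functional,
  for \<open>Q x = \<alpha> * x ^ r - \<beta> * x\<close>; taking \<open>\<beta> = 0\<close> gives a
  plain variance bound.\<close>

lemma zagreb_variance_le:
  assumes p: "0 \<le> p" "p \<le> 1"
  shows "bexp p (edges {1..n}) (\<lambda>S. (\<alpha> * (zagreb n r S - zagreb_mean n p r)
        - \<beta> * (degsum real {1..n} S - real n * binexp (n - 1) p real))\<^sup>2)
    \<le> 2 * (real n)\<^sup>2 * p * (1 - p) * binexp (n - 2) p (\<lambda>x. (\<alpha> * (real (Suc x) ^ r - real x ^ r) - \<beta>)\<^sup>2)"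
proof -
  define Q where "Q x = \<alpha> * real x ^ r - \<beta> * real x" for x
  have "bexp p (edges {1..n}) (\<lambda>S. (\<alpha> * (zagreb n r S - zagreb_mean n p r)
        - \<beta> * (degsum real {1..n} S - real n * binexp (n - 1) p real))\<^sup>2) =
     bexp p (edges {1..n}) (\<lambda>S. (degsum Q {1..n} S - real n * binexp (n - 1) p Q)\<^sup>2)"
  proof (intro bexp_cong refl)
    fix S assume "S \<subseteq> edges {1..n}"
    moreover have "degsum Q {1..n} S = \<alpha> * degsum (\<lambda>x. real x ^ r) {1..n} S - \<beta> * degsum real {1..n} S"
      by (simp add: degsum_def Q_def sum_subtractf sum_distrib_left)
    moreover have "binexp (n - 1) p Q = \<alpha> * binexp (n - 1) p (\<lambda>x. real x ^ r) - \<beta> * binexp (n - 1) p real"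
      unfolding Q_def[abs_def] binexp_diff binexp_cmult ..
    ultimately show "(\<alpha> * (zagreb n r S - zagreb_mean n p r) - \<beta> * (degsum real {1..n} S - real n * binexp (n - 1) p real))\<^sup>2
       = (degsum Q {1..n} S - real n * binexp (n - 1) p Q)\<^sup>2"
      by (simp only: zagreb_eq_degsum zagreb_mean_eq[OF p]) (simp add: algebra_simps)
  qed
  also have "\<dots> \<le> 2 * (real n)\<^sup>2 * p * (1 - p) * binexp (n - 2) p (\<lambda>x. (Q (Suc x) - Q x)\<^sup>2)"
    using degsum_variance_le[of "{1..n}" p Q] p by simp
  also have "(\<lambda>x. (Q (Suc x) - Q x)\<^sup>2) = (\<lambda>x. (\<alpha> * (real (Suc x) ^ r - real x ^ r) - \<beta>)\<^sup>2)"
    by (simp add: Q_def fun_eq_iff algebra_simps)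
  finally show ?thesis .
qed

section \<open>The three regimes\<close>

context
  fixes p :: "nat \<Rightarrow> real" and idx :: "'k::finite \<Rightarrow> nat"
  assumes p: "\<And>n. n \<ge> 1 \<Longrightarrow> 0 < p n \<and> p n < 1" and idx: "\<And>a. idx a \<ge> 1"
begin

lemma edge_prob: "n \<ge> 1 \<Longrightarrow> 0 \<le> p n \<and> p n \<le> 1"
  using p[of n] by auto

lemma zagreb_clt_sparse:
  assumes np: "(\<lambda>n. real n * p n) \<longlonglongrightarrow> c"
    and N: "multivariate_normal N 0 (\<chi> a b. zagreb_cov c (idx a) (idx b))"
  shows "weak_conv_vec
            (\<lambda>n. distr (erdos_renyi n (p n)) borel
               (\<lambda>E. (1 / sqrt (real n)) *\<^sub>R
                  (\<chi> a. zagreb n (idx a) E - zagreb_mean n (p n) (idx a)))) N"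
proof (rule weak_conv_vec_erdos_renyi[OF edge_prob N])
  fix t :: "real ^ 'k"
  \<comment> \<open>For fixed \<open>t\<close> the projection on \<open>t\<close> is the degree
    functional of this \<open>P\<close>, so the one-dimensional limit theorem is applied at the
    argument 1.\<close>
  define P where "P x = (\<Sum>a\<in>UNIV. t $ a * real x ^ idx a)" for x
  define X where "X n S = (1 / sqrt (real n)) *\<^sub>R (\<chi> a. zagreb n (idx a) S - zagreb_mean n (p n) (idx a))" for n S
  define \<sigma> where "\<sigma> = (\<Sum>a\<in>UNIV. \<Sum>b\<in>UNIV. t $ a * t $ b * zagreb_cov c (idx a) (idx b))"
  have "\<forall>a. \<exists>K. \<forall>x. real x ^ idx a \<le> K * 2 ^ x"
    using power_le_const_power_2 by blast
  then obtain C where C: "\<And>a x. real x ^ idx a \<le> C a * 2 ^ x"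
    unfolding choice_iff by blast
  have PK: "\<bar>P x\<bar> \<le> (\<Sum>a\<in>UNIV. \<bar>t $ a\<bar> * C a) * 2 ^ x" for x
    unfolding P_def sum_distrib_right mult.assoc
    by (intro order.trans[OF sum_abs] sum_mono) (auto simp: abs_mult intro!: mult_left_mono C)
  have "(\<lambda>n. bexp (p n) (edges {1..n}) (\<lambda>S. iexp (1 * ((degsum P {1..n} S - real n * binexp (n - 1) (p n) P) / sqrt n))))
    \<longlonglongrightarrow> complex_of_real (exp (- \<sigma> * 1\<^sup>2 / 2))"
  proof (rule degsum_clt[OF edge_prob np PK])
    show "(\<lambda>n. degree_var n (p n) P) \<longlonglongrightarrow> \<sigma>"
      unfolding P_def[abs_def] \<sigma>_def by (rule degree_var_tendsto[OF np idx])
  qed auto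
  moreover have "\<forall>\<^sub>F n in sequentially. bexp (p n) (edges {1..n}) (\<lambda>S. iexp (1 * ((degsum P {1..n} S - real n * binexp (n - 1) (p n) P) / sqrt n)))
     = bexp (p n) (edges {1..n}) (\<lambda>S. iexp (t \<bullet> X n S))"
    using eventually_ge_at_top[of 1]
  proof eventually_elim
    case (elim n)
    show ?case
    proof (intro bexp_cong refl)
      fix S assume S: "S \<subseteq> edges {1..n}"
      have "degsum P {1..n} S = (\<Sum>a\<in>UNIV. t $ a * zagreb n (idx a) S)"
        unfolding zagreb_eq_degsum[OF S] degsum_def P_def sum_distrib_left by (rule sum.swap)
      moreover have "real n * binexp (n - 1) (p n) P = (\<Sum>a\<in>UNIV. t $ a * zagreb_mean n (p n) (idx a))"
        using edge_prob[OF elim] unfolding P_def[abs_def] binexp_sum binexp_cmult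
        by (simp add: zagreb_mean_eq sum_distrib_left mult_ac)
      ultimately have "1 * ((degsum P {1..n} S - real n * binexp (n - 1) (p n) P) / sqrt n) = t \<bullet> X n S"
        by (simp add: X_def inner_vec_def sum_subtractf[symmetric] right_diff_distrib[symmetric] sum_divide_distrib)
      then show "iexp (1 * ((degsum P {1..n} S - real n * binexp (n - 1) (p n) P) / sqrt n)) = iexp (t \<bullet> X n S)"
        by (simp only:)
    qed
  qed
  moreover have "t \<bullet> ((\<chi> a b. zagreb_cov c (idx a) (idx b)) *v t) = \<sigma>"
    by (simp add: inner_vec_def matrix_vector_mult_def \<sigma>_def sum_distrib_left mult_ac)
  ultimately show "(\<lambda>n. bexp (p n) (edges {1..n}) (\<lambda>S. iexp (t \<bullet> ((1 / sqrt (real n)) *\<^sub>R (\<chi> a. zagreb n (idx a) S - zagreb_mean n (p n) (idx a))))))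
     \<longlonglongrightarrow> complex_of_real (exp (- (t \<bullet> ((\<chi> a b. zagreb_cov c (idx a) (idx b)) *v t)) / 2))"
    unfolding X_def[symmetric] using Lim_transform_eventually by fastforce
next
  fix a
  obtain K where K: "\<And>x. real x ^ idx a \<le> K * 2 ^ x"
    using power_le_const_power_2 by metis
  \<comment> \<open>The factor 1 and the subtraction of 0 match the instance
    \<open>\<alpha> = 1\<close>, \<open>\<beta> = 0\<close> of
    \<open>zagreb_variance_le\<close>.\<close>
  have D: "\<bar>(1 * (real (Suc x) ^ idx a - real x ^ idx a) - 0)\<^sup>2\<bar> \<le> (2 * K)\<^sup>2 * 4 ^ x" for x
  proof -
    have "0 \<le> real (Suc x) ^ idx a - real x ^ idx a" by (simp add: power_mono)
    moreover have "real (Suc x) ^ idx a - real x ^ idx a \<le> 2 * K * 2 ^ x"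
    proof -
      have "real (Suc x) ^ idx a \<le> 2 * K * 2 ^ x" using K[of "Suc x"] by (simp add: mult_ac)
      moreover have "0 \<le> real x ^ idx a" by simp
      ultimately show ?thesis by linarith
    qed
    ultimately have "(real (Suc x) ^ idx a - real x ^ idx a)\<^sup>2 \<le> (2 * K * 2 ^ x)\<^sup>2"
      by (intro power_mono)
    then show ?thesis by (simp add: power_mult_distrib two_power_square)
  qed
  have "\<forall>\<^sub>F n in sequentially. real n * p n < c + 1"
    using np by (rule order_tendstoD(2)) simp
  then have "\<forall>\<^sub>F n in sequentially. bexp (p n) (edges {1..n})
      (\<lambda>S. (((1 / sqrt (real n)) *\<^sub>R (\<chi> a. zagreb n (idx a) S - zagreb_mean n (p n) (idx a))) $ a)\<^sup>2)
      \<le> 2 * (c + 1) * ((2 * K)\<^sup>2 * exp (3 * (c + 1)))"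
    using eventually_ge_at_top[of 1]
  proof eventually_elim
    case (elim n)
    note pn = conjunct1[OF edge_prob[OF elim(2)]] conjunct2[OF edge_prob[OF elim(2)]]
    let ?Z = "\<lambda>S. zagreb n (idx a) S - zagreb_mean n (p n) (idx a)"
    let ?b = "binexp (n - 2) (p n) (\<lambda>x. (1 * (real (Suc x) ^ idx a - real x ^ idx a) - 0)\<^sup>2)"
    have np2: "real (n - 2) * p n \<le> c + 1"
    proof -
      have "real (n - 2) * p n \<le> real n * p n" using pn by (intro mult_right_mono) auto
      then show ?thesis using elim by simp
    qed
    have b: "?b \<le> (2 * K)\<^sup>2 * exp ((4 - 1) * (c + 1))"
      using abs_binexp_le_power[OF pn _ np2 D] by simp
    have b0: "0 \<le> ?b" using pn by (intro binexp_nonneg) auto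
    have "bexp (p n) (edges {1..n}) (\<lambda>S. (((1 / sqrt (real n)) *\<^sub>R (\<chi> a. zagreb n (idx a) S - zagreb_mean n (p n) (idx a))) $ a)\<^sup>2)
       = bexp (p n) (edges {1..n}) (\<lambda>S. (1 * ?Z S - 0 * (degsum real {1..n} S - real n * binexp (n - 1) (p n) real))\<^sup>2) / real n"
      unfolding bexp_divc[symmetric] by (simp add: power_divide)
    also have "\<dots> \<le> 2 * (real n)\<^sup>2 * p n * (1 - p n) * ?b / real n"
      by (intro divide_right_mono zagreb_variance_le pn) auto
    also have "\<dots> = 2 * (real n * p n) * ((1 - p n) * ?b)"
      using elim by (simp add: power2_eq_square)
    also have "\<dots> \<le> 2 * (c + 1) * (1 * ((2 * K)\<^sup>2 * exp ((4 - 1) * (c + 1))))"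
    proof (rule mult_mono)
      show "(1 - p n) * ?b \<le> 1 * ((2 * K)\<^sup>2 * exp ((4 - 1) * (c + 1)))"
        using pn by (intro mult_mono b b0) auto
      have "0 \<le> real n * p n" using pn by simp
      from le_less_trans[OF this elim(1)] show "0 \<le> 2 * (c + 1)" by simp
      show "0 \<le> (1 - p n) * ?b" using pn b0 by (intro mult_nonneg_nonneg) auto
      show "2 * (real n * p n) \<le> 2 * (c + 1)"
        by (intro mult_left_mono less_imp_le[OF elim(1)]) auto
    qed
    finally show ?case by simp
  qed
  then show "\<exists>C. \<forall>\<^sub>F n in sequentially. bexp (p n) (edges {1..n})
      (\<lambda>S. (((1 / sqrt (real n)) *\<^sub>R (\<chi> a. zagreb n (idx a) S - zagreb_mean n (p n) (idx a))) $ a)\<^sup>2) \<le> C"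
    by blast
qed

text \<open>The scale \<open>s\<close> is the standard deviation of the degree sum to leading order.
  The two growth hypotheses make it tend to infinity, one when \<open>p\<close> is small and the
  other when \<open>p\<close> is large.\<close>

lemma zagreb_clt_dense:
  assumes np: "filterlim (\<lambda>n. real n * p n) at_top sequentially"
    and nq: "filterlim (\<lambda>n. real n ^ 2 * (1 - p n) ^ 3) at_top sequentially"
    and N: "multivariate_normal N 0 (\<chi> a b. 1)"
  shows "weak_conv_vec
            (\<lambda>n. distr (erdos_renyi n (p n)) borel
               (\<lambda>E. sqrt (p n / (2 * (1 - p n))) *\<^sub>R
                  (\<chi> a. (zagreb n (idx a) E - zagreb_mean n (p n) (idx a)) /
                        (real (idx a) * (real n * p n) ^ idx a)))) N"
proof -
  define s where "s n = sqrt (2 * (real n)\<^sup>2 * p n * (1 - p n))" for n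
  have s2: "(s n)\<^sup>2 = 2 * (real n)\<^sup>2 * p n * (1 - p n)" if "n \<ge> 1" for n
    using edge_prob[OF that] by (simp add: s_def)
  \<comment> \<open>If \<open>p n\<close> is at least 1/2, lowering the power of
    \<open>1 - p n\<close> from 3 to 1 only increases it and \<open>2 * p n\<close> is at least 1;
    otherwise \<open>n * p n\<close> gains the factor \<open>2 * n * (1 - p n)\<close>, which is at
    least 1.\<close>
  have lower: "min (real n * p n) (real n ^ 2 * (1 - p n) ^ 3) \<le> 2 * (real n)\<^sup>2 * p n * (1 - p n)" if "n \<ge> 1" for n
  proof (cases "p n \<ge> 1 / 2")
    case True
    have "(real n)\<^sup>2 * (1 - p n) ^ 3 \<le> (real n)\<^sup>2 * (1 - p n) ^ 1"
      using edge_prob[OF that] by (intro mult_left_mono power_decreasing) auto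
    also have "\<dots> \<le> (2 * p n) * ((real n)\<^sup>2 * (1 - p n) ^ 1)"
      using True edge_prob[OF that] mult_right_mono[of 1 "2 * p n" "(real n)\<^sup>2 * (1 - p n) ^ 1"] by simp
    finally show ?thesis by (simp add: min_def mult_ac)
  next
    case False
    have "1 * (real n * p n) \<le> (real n * (2 * (1 - p n))) * (real n * p n)"
      using False that edge_prob[OF that] mult_mono[of 1 "real n" 1 "2 * (1 - p n)"] by (intro mult_right_mono) auto
    then show ?thesis by (simp add: min_def power2_eq_square mult_ac)
  qed
  have s: "filterlim s at_top sequentially"
    unfolding s_def
  proof (rule filterlim_compose[OF sqrt_at_top], unfold filterlim_at_top, intro allI)
    fix Z
    show "\<forall>\<^sub>F n in sequentially. Z \<le> 2 * (real n)\<^sup>2 * p n * (1 - p n)"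
      using np[unfolded filterlim_at_top, rule_format, of Z] nq[unfolded filterlim_at_top, rule_format, of Z]
        eventually_ge_at_top[of 1]
    proof eventually_elim
      case (elim n)
      then show ?case using lower[of n] by linarith
    qed
  qed
  show ?thesis
  proof (rule weak_conv_vec_rank_one[OF edge_prob s _ _ N])
    have "\<forall>\<^sub>F n in sequentially. 1 = 2 * (real n)\<^sup>2 * p n * (1 - p n) / (s n)\<^sup>2"
      using eventually_ge_at_top[of 1] by eventually_elim (use p in \<open>force simp: s2\<close>)
    then show "(\<lambda>n. 2 * (real n)\<^sup>2 * p n * (1 - p n) / (s n)\<^sup>2) \<longlonglongrightarrow> 1"
      by (rule Lim_transform_eventually[OF tendsto_const])
  next
    fix a
    let ?X = "\<lambda>n S. (sqrt (p n / (2 * (1 - p n))) *\<^sub>R (\<chi> a. (zagreb n (idx a) S - zagreb_mean n (p n) (idx a)) /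
                        (real (idx a) * (real n * p n) ^ idx a))) $ a - (degsum real {1..n} S - real n * binexp (n - 1) (p n) real) / s n"
    let ?B = "\<lambda>n. binexp (n - 2) (p n) (\<lambda>x. ((real (Suc x) ^ idx a - real x ^ idx a) / (real (idx a) * (real n * p n) ^ (idx a - 1)) - 1)\<^sup>2)"
    show "(\<lambda>n. bexp (p n) (edges {1..n}) (\<lambda>S. (?X n S)\<^sup>2)) \<longlonglongrightarrow> 0"
    proof (rule tendsto_sandwich[OF _ _ tendsto_const binexp_increment_dense[OF np idx]])
      show "\<forall>\<^sub>F n in sequentially. 0 \<le> bexp (p n) (edges {1..n}) (\<lambda>S. (?X n S)\<^sup>2)"
        using eventually_ge_at_top[of 1] by eventually_elim (use edge_prob in \<open>auto intro!: bexp_nonneg\<close>)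
      show "\<forall>\<^sub>F n in sequentially. bexp (p n) (edges {1..n}) (\<lambda>S. (?X n S)\<^sup>2) \<le> ?B n"
        using eventually_ge_at_top[of 1]
      proof eventually_elim
        case (elim n)
        note pn = p[OF elim]
        define w where "w = sqrt (p n / (2 * (1 - p n)))"
        define \<alpha> where "\<alpha> = w / (real (idx a) * (real n * p n) ^ idx a)"
        have sp: "s n > 0" using pn elim by (simp add: s_def)
        \<comment> \<open>The prescribed prefactor is exactly \<open>n * p n / s n\<close>, which
          puts the index on the scale \<open>1 / s n\<close> of the edge count.\<close>
        have sw: "s n * w = real n * p n"
        proof -
          have "s n * w = sqrt ((real n * p n)\<^sup>2)"
            unfolding s_def w_def real_sqrt_mult[symmetric] using pn by (simp add: power2_eq_square field_simps)
          then show ?thesis using pn by simp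
        qed
        have "bexp (p n) (edges {1..n}) (\<lambda>S. (?X n S)\<^sup>2) = bexp (p n) (edges {1..n}) (\<lambda>S. (\<alpha> * (zagreb n (idx a) S - zagreb_mean n (p n) (idx a))
            - 1 / s n * (degsum real {1..n} S - real n * binexp (n - 1) (p n) real))\<^sup>2)"
          by (simp add: \<alpha>_def w_def)
        also have "\<dots> \<le> 2 * (real n)\<^sup>2 * p n * (1 - p n) * binexp (n - 2) (p n) (\<lambda>x. (\<alpha> * (real (Suc x) ^ idx a - real x ^ idx a) - 1 / s n)\<^sup>2)"
          using pn by (intro zagreb_variance_le) auto
        \<comment> \<open>The prefactor of the variance bound is \<open>(s n) ^ 2\<close>; moved
          inside, it turns the increment into one relative to \<open>r * (n * p) ^ (r - 1)\<close>,
          with \<open>r = idx a\<close>.\<close>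
        also have "\<dots> = binexp (n - 2) (p n) (\<lambda>x. (s n)\<^sup>2 * (\<alpha> * (real (Suc x) ^ idx a - real x ^ idx a) - 1 / s n)\<^sup>2)"
          unfolding binexp_cmult s2[OF elim] ..
        also have "(\<lambda>x. (s n)\<^sup>2 * (\<alpha> * (real (Suc x) ^ idx a - real x ^ idx a) - 1 / s n)\<^sup>2) =
            (\<lambda>x. ((real (Suc x) ^ idx a - real x ^ idx a) / (real (idx a) * (real n * p n) ^ (idx a - 1)) - 1)\<^sup>2)"
        proof
          fix x
          have "s n * \<alpha> = 1 / (real (idx a) * (real n * p n) ^ (idx a - 1))"
          proof -
            have "(real n * p n) ^ idx a = (real n * p n) * (real n * p n) ^ (idx a - 1)"
              using idx[of a] by (cases "idx a") auto
            then show ?thesis using sw pn elim by (simp add: \<alpha>_def)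
          qed
          then have "s n * (\<alpha> * (real (Suc x) ^ idx a - real x ^ idx a) - 1 / s n) =
              (real (Suc x) ^ idx a - real x ^ idx a) / (real (idx a) * (real n * p n) ^ (idx a - 1)) - 1"
            using sp by (simp add: right_diff_distrib mult.assoc[symmetric] diff_divide_distrib del: of_nat_Suc)
          then show "(s n)\<^sup>2 * (\<alpha> * (real (Suc x) ^ idx a - real x ^ idx a) - 1 / s n)\<^sup>2 =
              ((real (Suc x) ^ idx a - real x ^ idx a) / (real (idx a) * (real n * p n) ^ (idx a - 1)) - 1)\<^sup>2"
            unfolding power_mult_distrib[symmetric] by (simp only:)
        qed
        finally show ?case .
      qed
    qed
  qed
qed

lemma zagreb_clt_very_sparse:
  assumes np: "(\<lambda>n. real n * p n) \<longlonglongrightarrow> 0"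
    and n2p: "filterlim (\<lambda>n. real n ^ 2 * p n) at_top sequentially"
    and N: "multivariate_normal N 0 (\<chi> a b. 1)"
  shows "weak_conv_vec
            (\<lambda>n. distr (erdos_renyi n (p n)) borel
               (\<lambda>E. (1 / sqrt (2 * real n ^ 2 * p n)) *\<^sub>R
                  (\<chi> a. zagreb n (idx a) E -
                        (\<Sum>m = 1..idx a. real (Stirling (idx a) m) *
                           real n ^ (m + 1) * p n ^ m)))) N"
proof -
  define s where "s n = sqrt (2 * real n ^ 2 * p n)" for n
  have s2: "(s n)\<^sup>2 = 2 * (real n)\<^sup>2 * p n" if "n \<ge> 1" for n
    using edge_prob[OF that] by (simp add: s_def)
  have s: "filterlim s at_top sequentially"
    unfolding s_def mult.assoc
    by (rule filterlim_compose[OF sqrt_at_top]) (rule filterlim_tendsto_pos_mult_at_top[OF tendsto_const _ n2p], simp)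
  \<comment> \<open>The scale leaves out the factor \<open>1 - p n\<close> of the variance, which
    tends to 1 because of this.\<close>
  have p0: "p \<longlonglongrightarrow> 0"
  proof -
    have "(\<lambda>n. real n * p n / real n) \<longlonglongrightarrow> 0"
      by (rule real_tendsto_divide_at_top[OF np filterlim_real_sequentially])
    moreover have "\<forall>\<^sub>F n in sequentially. real n * p n / real n = p n"
      using eventually_gt_at_top[of 0] by eventually_elim simp
    ultimately show ?thesis by (rule Lim_transform_eventually)
  qed
  show ?thesis
    unfolding s_def[symmetric]
  proof (rule weak_conv_vec_rank_one[OF edge_prob s _ _ N])
    have "\<forall>\<^sub>F n in sequentially. 1 - p n = 2 * (real n)\<^sup>2 * p n * (1 - p n) / (s n)\<^sup>2"
      using eventually_ge_at_top[of 1] by eventually_elim (use p in \<open>force simp: s2\<close>)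
    moreover have "(\<lambda>n. 1 - p n) \<longlonglongrightarrow> 1 - 0" by (intro tendsto_intros p0)
    ultimately show "(\<lambda>n. 2 * (real n)\<^sup>2 * p n * (1 - p n) / (s n)\<^sup>2) \<longlonglongrightarrow> 1"
      using Lim_transform_eventually by fastforce
  next
    fix a
    let ?r = "idx a"
    let ?c = "\<lambda>n. \<Sum>m = 1..?r. real (Stirling ?r m) * real n ^ (m + 1) * p n ^ m"
    \<comment> \<open>The centring has \<open>n ^ m\<close> where the exact mean has the falling
      factorial of \<open>n - 1\<close>; by \<open>ffact_ratio_rate\<close> the discrepancy stays
      bounded, and it vanishes after division by \<open>s n\<close>.\<close>
    define bias where "bias n = (zagreb_mean n (p n) ?r - ?c n) / s n" for n
    let ?X = "\<lambda>n S. ((1 / s n) *\<^sub>R (\<chi> a. zagreb n (idx a) S - (\<Sum>m = 1..idx a. real (Stirling (idx a) m) *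
                           real n ^ (m + 1) * p n ^ m))) $ a - (degsum real {1..n} S - real n * binexp (n - 1) (p n) real) / s n"
    let ?B = "\<lambda>n. binexp (n - 2) (p n) (\<lambda>x. (real (Suc x) ^ ?r - real x ^ ?r - 1)\<^sup>2)"
    have bias: "bias \<longlonglongrightarrow> 0"
    proof -
      have "\<exists>L. (\<lambda>n. real n * (1 - ffact (n - 1) m / real n ^ m)) \<longlonglongrightarrow> L" for m
        by (rule ffact_ratio_rate)
      then obtain L where L: "\<And>m. (\<lambda>n. real n * (1 - ffact (n - 1) m / real n ^ m)) \<longlonglongrightarrow> L m" by metis
      have "(\<lambda>n. (\<Sum>m=1..?r. real (Stirling ?r m) * ((real n * p n) ^ m * (- (real n * (1 - ffact (n - 1) m / real n ^ m))))) / s n) \<longlonglongrightarrow> 0"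
      proof (rule real_tendsto_divide_at_top[OF _ s])
        show "(\<lambda>n. \<Sum>m=1..?r. real (Stirling ?r m) * ((real n * p n) ^ m * (- (real n * (1 - ffact (n - 1) m / real n ^ m)))))
          \<longlonglongrightarrow> (\<Sum>m=1..?r. real (Stirling ?r m) * (0 ^ m * (- L m)))"
          by (intro tendsto_intros np L)
      qed
      moreover have "\<forall>\<^sub>F n in sequentially. (\<Sum>m=1..?r. real (Stirling ?r m) * ((real n * p n) ^ m * (- (real n * (1 - ffact (n - 1) m / real n ^ m))))) / s n = bias n"
        using eventually_ge_at_top[of 1]
      proof eventually_elim
        case (elim n)
        have "zagreb_mean n (p n) ?r = (\<Sum>m=1..?r. real (Stirling ?r m) * (real n * (ffact (n - 1) m * p n ^ m)))"
          using edge_prob[OF elim]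
          by (simp only: zagreb_mean_eq power_eq_sum_ffact'[OF idx] binexp_sum binexp_cmult binexp_ffact)
            (simp add: sum_distrib_left mult_ac)
        then have "zagreb_mean n (p n) ?r - ?c n = (\<Sum>m=1..?r. real (Stirling ?r m) * (real n * (ffact (n - 1) m * p n ^ m) - real n ^ (m + 1) * p n ^ m))"
          by (simp add: sum_subtractf right_diff_distrib mult.assoc)
        also have "\<dots> = (\<Sum>m=1..?r. real (Stirling ?r m) * ((real n * p n) ^ m * (- (real n * (1 - ffact (n - 1) m / real n ^ m)))))"
          using elim by (intro sum.cong refl arg_cong2[where f = "(*)"]) (simp add: power_mult_distrib field_simps)
        finally show ?case by (simp add: bias_def)
      qed
      ultimately show ?thesis by (rule Lim_transform_eventually)
    qed
    have "(\<lambda>n. 2 * ?B n + 2 * (bias n)\<^sup>2) \<longlonglongrightarrow> 2 * 0 + 2 * 0\<^sup>2"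
      by (intro tendsto_intros binexp_increment_sparse[OF np idx] bias)
    then have lim: "(\<lambda>n. 2 * ?B n + 2 * (bias n)\<^sup>2) \<longlonglongrightarrow> 0" by simp
    show "(\<lambda>n. bexp (p n) (edges {1..n}) (\<lambda>S. (?X n S)\<^sup>2)) \<longlonglongrightarrow> 0"
    proof (rule tendsto_sandwich[OF _ _ tendsto_const lim])
      show "\<forall>\<^sub>F n in sequentially. 0 \<le> bexp (p n) (edges {1..n}) (\<lambda>S. (?X n S)\<^sup>2)"
        using eventually_ge_at_top[of 1] by eventually_elim (use edge_prob in \<open>auto intro!: bexp_nonneg\<close>)
      show "\<forall>\<^sub>F n in sequentially. bexp (p n) (edges {1..n}) (\<lambda>S. (?X n S)\<^sup>2) \<le> 2 * ?B n + 2 * (bias n)\<^sup>2"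
        using eventually_ge_at_top[of 1]
      proof eventually_elim
        case (elim n)
        note pn = conjunct1[OF edge_prob[OF elim]] conjunct2[OF edge_prob[OF elim]]
        have sp: "s n > 0" using p[OF elim] elim by (simp add: s_def)
        let ?R = "\<lambda>S. 1 / s n * (zagreb n ?r S - zagreb_mean n (p n) ?r) - 1 / s n * (degsum real {1..n} S - real n * binexp (n - 1) (p n) real)"
        have "bexp (p n) (edges {1..n}) (\<lambda>S. (?X n S)\<^sup>2) = bexp (p n) (edges {1..n}) (\<lambda>S. (?R S + bias n)\<^sup>2)"
          by (simp add: bias_def diff_divide_distrib algebra_simps)
        also have "\<dots> \<le> bexp (p n) (edges {1..n}) (\<lambda>S. 2 * (?R S)\<^sup>2 + 2 * (bias n)\<^sup>2)"
        proof (intro bexp_mono pn)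
          have "(x + y)\<^sup>2 \<le> 2 * x\<^sup>2 + 2 * y\<^sup>2" for x y :: real
            using sum_squares_bound[of x y] by (simp add: power2_sum)
          then show "(?R S + bias n)\<^sup>2 \<le> 2 * (?R S)\<^sup>2 + 2 * (bias n)\<^sup>2" for S .
        qed
        also have "\<dots> = 2 * bexp (p n) (edges {1..n}) (\<lambda>S. (?R S)\<^sup>2) + 2 * (bias n)\<^sup>2"
          unfolding bexp_add bexp_cmult by simp
        also have "bexp (p n) (edges {1..n}) (\<lambda>S. (?R S)\<^sup>2) \<le>
            2 * (real n)\<^sup>2 * p n * (1 - p n) * binexp (n - 2) (p n) (\<lambda>x. (1 / s n * (real (Suc x) ^ ?r - real x ^ ?r) - 1 / s n)\<^sup>2)"
          by (rule zagreb_variance_le[OF pn])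
        also have "\<dots> = (1 - p n) * binexp (n - 2) (p n) (\<lambda>x. (s n)\<^sup>2 * (1 / s n * (real (Suc x) ^ ?r - real x ^ ?r) - 1 / s n)\<^sup>2)"
          unfolding binexp_cmult s2[OF elim] by simp
        also have "(\<lambda>x. (s n)\<^sup>2 * (1 / s n * (real (Suc x) ^ ?r - real x ^ ?r) - 1 / s n)\<^sup>2) = (\<lambda>x. (real (Suc x) ^ ?r - real x ^ ?r - 1)\<^sup>2)"
        proof
          fix x
          have "s n * (1 / s n * (real (Suc x) ^ ?r - real x ^ ?r) - 1 / s n) = real (Suc x) ^ ?r - real x ^ ?r - 1"
            using sp by (simp add: right_diff_distrib del: of_nat_Suc)
          then show "(s n)\<^sup>2 * (1 / s n * (real (Suc x) ^ ?r - real x ^ ?r) - 1 / s n)\<^sup>2 = (real (Suc x) ^ ?r - real x ^ ?r - 1)\<^sup>2"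
            unfolding power_mult_distrib[symmetric] by (simp only:)
        qed
        also have "(1 - p n) * ?B n \<le> 1 * ?B n"
          using pn by (intro mult_right_mono binexp_nonneg) auto
        finally show ?case by simp
      qed
    qed
  qed
qed

end

text \<open>Vectors are indexed by a finite type, so \<open>idx\<close> labels the elements of that
  type by the orders 1 to \<open>k\<close>.\<close>

theorem theorem2:
  fixes p :: "nat \<Rightarrow> real" and k :: nat and idx :: "'k::finite \<Rightarrow> nat"
  assumes p: "\<And>n. n \<ge> 1 \<Longrightarrow> 0 < p n \<and> p n < 1"
    and k: "k \<ge> 2"
    and idx: "bij_betw idx UNIV {1..k}"
  shows
    "(\<forall>c > 0. (\<lambda>n. real n * p n) \<longlonglongrightarrow> c \<longrightarrow>
       (\<exists>N :: (real ^ 'k) measure.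
          multivariate_normal N 0 (\<chi> a b. zagreb_cov c (idx a) (idx b)) \<and>
          weak_conv_vec
            (\<lambda>n. distr (erdos_renyi n (p n)) borel
               (\<lambda>E. (1 / sqrt (real n)) *\<^sub>R
                  (\<chi> a. zagreb n (idx a) E - zagreb_mean n (p n) (idx a)))) N))
     \<and>
     (filterlim (\<lambda>n. real n * p n) at_top sequentially \<longrightarrow>
      filterlim (\<lambda>n. real n ^ 2 * (1 - p n) ^ 3) at_top sequentially \<longrightarrow>
       (\<exists>N :: (real ^ 'k) measure.
          multivariate_normal N 0 (\<chi> a b. 1) \<and>
          weak_conv_vec
            (\<lambda>n. distr (erdos_renyi n (p n)) borel
               (\<lambda>E. sqrt (p n / (2 * (1 - p n))) *\<^sub>R
                  (\<chi> a. (zagreb n (idx a) E - zagreb_mean n (p n) (idx a)) /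
                        (real (idx a) * (real n * p n) ^ idx a)))) N))
     \<and>
     ((\<lambda>n. real n * p n) \<longlonglongrightarrow> 0 \<longrightarrow>
      filterlim (\<lambda>n. real n ^ 2 * p n) at_top sequentially \<longrightarrow>
       (\<exists>N :: (real ^ 'k) measure.
          multivariate_normal N 0 (\<chi> a b. 1) \<and>
          weak_conv_vec
            (\<lambda>n. distr (erdos_renyi n (p n)) borel
               (\<lambda>E. (1 / sqrt (2 * real n ^ 2 * p n)) *\<^sub>R
                  (\<chi> a. zagreb n (idx a) E -
                        (\<Sum>m = 1..idx a. real (Stirling (idx a) m) *
                           real n ^ (m + 1) * p n ^ m)))) N))"
proof -
  have mem: "idx a \<in> {1..k}" for a
    using bij_betwE[OF idx] by blast
  then have idx1: "idx a \<ge> 1" and idxk: "idx a \<le> k" for a by simp_all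
  \<comment> \<open>The all-ones matrix has a one-column factor with all entries 1: \<open>U\<close>
    is the law of a vector whose coordinates are one and the same standard normal variable.\<close>
  obtain U :: "(real ^ 'k) measure" where U: "multivariate_normal U 0 (\<chi> a b. 1)"
    using exists_multivariate_normal[of "{()}" "\<lambda>_ _. 1"] by auto
  show ?thesis
  proof (intro conjI allI impI)
    fix c :: real assume c: "c > 0" and np: "(\<lambda>n. real n * p n) \<longlonglongrightarrow> c"
    \<comment> \<open>The Gram factor of \<open>zagreb_cov_factor\<close>; its columns are indexed
      by the overlap size \<open>s\<close>, which never exceeds \<open>k\<close>.\<close>
    let ?B = "\<lambda>m s. (\<Sum>i=1..m. real (Stirling m i) * (real (i choose s) * c ^ (i - s))) *
       sqrt (fact s * c ^ s * (if s = 1 then 2 else 1))"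
    have "(\<Sum>s=1..k. ?B (idx a) s * ?B (idx b) s) = zagreb_cov c (idx a) (idx b)" for a b
      using c idxk by (intro zagreb_cov_factor[symmetric]) auto
    then obtain N :: "(real ^ 'k) measure" where N: "multivariate_normal N 0 (\<chi> a b. zagreb_cov c (idx a) (idx b))"
      using exists_multivariate_normal[of "{1..k}" "\<lambda>a. ?B (idx a)"] by auto
    show "\<exists>N :: (real ^ 'k) measure.
          multivariate_normal N 0 (\<chi> a b. zagreb_cov c (idx a) (idx b)) \<and>
          weak_conv_vec
            (\<lambda>n. distr (erdos_renyi n (p n)) borel
               (\<lambda>E. (1 / sqrt (real n)) *\<^sub>R
                  (\<chi> a. zagreb n (idx a) E - zagreb_mean n (p n) (idx a)))) N"
      using N zagreb_clt_sparse[of p idx, OF p idx1] np by blast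
  next
    assume np: "filterlim (\<lambda>n. real n * p n) at_top sequentially"
      and nq: "filterlim (\<lambda>n. real n ^ 2 * (1 - p n) ^ 3) at_top sequentially"
    show "\<exists>N :: (real ^ 'k) measure.
          multivariate_normal N 0 (\<chi> a b. 1) \<and>
          weak_conv_vec
            (\<lambda>n. distr (erdos_renyi n (p n)) borel
               (\<lambda>E. sqrt (p n / (2 * (1 - p n))) *\<^sub>R
                  (\<chi> a. (zagreb n (idx a) E - zagreb_mean n (p n) (idx a)) /
                        (real (idx a) * (real n * p n) ^ idx a)))) N"
      using U zagreb_clt_dense[of p idx, OF p idx1] np nq by blast
  next
    assume np: "(\<lambda>n. real n * p n) \<longlonglongrightarrow> 0"
      and n2p: "filterlim (\<lambda>n. real n ^ 2 * p n) at_top sequentially"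
    show "\<exists>N :: (real ^ 'k) measure.
          multivariate_normal N 0 (\<chi> a b. 1) \<and>
          weak_conv_vec
            (\<lambda>n. distr (erdos_renyi n (p n)) borel
               (\<lambda>E. (1 / sqrt (2 * real n ^ 2 * p n)) *\<^sub>R
                  (\<chi> a. zagreb n (idx a) E -
                        (\<Sum>m = 1..idx a. real (Stirling (idx a) m) *
                           real n ^ (m + 1) * p n ^ m)))) N"
      using U zagreb_clt_very_sparse[of p idx, OF p idx1] np n2p by blast
  qed
qed

end
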